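(* Let $m\in\mathbb N$, $m\ge1$, $\lambda=1/m$, $c>-1$, and $Q(\zeta)=|\zeta|^{2/m}-\frac{2c}N\log|\zeta|$. Then the pre-kernel $\kappa_{\lambda,c}$ of the limiting rescaled kernel at the origin of the planar symplectic ensemble with potential $Q$ is $$\kappa_{\lambda,c}(z,w)=\Big(\frac2\lambda\Big)^{\frac1{2\lambda}}(zw)^{\lambda-1}\,\widetilde\kappa_{\lambda,c}\Big(\sqrt{\tfrac2\lambda}\,z^\lambda,\sqrt{\tfrac2\lambda}\,w^\lambda\Big),$$ where for $m=1$ $$\widetilde\kappa_{1,c}(z,w)=\int_0^1\Big(z\,e^{\frac12(1-s^2)z^2}-w\,e^{\frac12(1-s^2)w^2}\Big)F_{1,c}(szw)\,ds,$$ and for $m>1$ $$\widetilde\kappa_{\lambda,c}(z,w)=\sum_{j=1}^m\frac{(-1)^{m-j}}{G(m+1)}\int_0^1\Big(z\,g_{j,m}(z)W_{j,m}(sz)-w\,g_{j,m}(w)W_{j,m}(sw)\Big)F_{m,c}(szw)\,ds,$$ with $G(m+1)=\prod_{j=1}^{m-1}j!$.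
   Context: Ensemble. Write $dA(\zeta)=\frac1\pi d^2\zeta$. The planar symplectic ensemble with potential $Q$ is the probability measure on $\mathbb C^N$ with density (with respect to $\prod_jdA(\zeta_j)$) $\frac1{Z_N}e^{-\mathbf H_N}$, where $$\mathbf H_N=\sum_{j\ne k}\log\frac1{|\zeta_j-\zeta_k||\zeta_j-\bar\zeta_k|}+\sum_{j=1}^N\Big(\log\frac1{|\zeta_j-\bar\zeta_j|^2}+NQ(\zeta_j)\Big)$$ (first sum over ordered pairs). Define $\langle h|g\rangle=\int_{\mathbb C}(\bar\zeta-\zeta)e^{-NQ(\zeta)}\big(h(\zeta)\overline{g(\zeta)}-\overline{h(\zeta)}g(\zeta)\big)dA(\zeta)$ and let $q_k$ be monic polynomials of degree $k$ with real coefficients that are skew-orthogonal: $\langle q_{2k+1}|q_{2l}\rangle=-\langle q_{2l}|q_{2k+1}\rangle=s_k\delta_{kl}$, $\langle q_{2k+1}|q_{2l+1}\rangle=\langle q_{2k}|q_{2l}\rangle=0$, $s_k>0$. The ensemble is a Pfaffian point process with pre-kernel $$\boldsymbol\varkappa_N(\zeta,\eta)=\sum_{k=0}^{N-1}\frac{q_{2k+1}(\zeta)q_{2k}(\eta)-q_{2k}(\zeta)q_{2k+1}(\eta)}{s_k}.$$ Rescaling at the origin. With $r_N=(\lambda N/2)^{-1/(2\lambda)}$ set $\kappa_N(z,w)=r_N^3\,\boldsymbol\varkappa_N(r_Nz,r_Nw)$ and $$K_N(z,w)=e^{-\frac N2(Q(r_Nz)+Q(r_Nw))}\begin{pmatrix}\kappa_N(z,w)&\kappa_N(z,\bar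 w)\\ \kappa_N(\bar z,w)&\kappa_N(\bar z,\bar w)\end{pmatrix}.$$ The rescaled $k$-point functions are $R_{N,k}(z_1,\dots,z_k)=\prod_j(\bar z_j-z_j)\operatorname{Pf}[K_N(z_j,z_l)]_{j,l=1}^k$. Cocycles. A cocycle is a function $c(z,w)=h(z)h(w)$ with $|h|=1$ and $h(z)h(\bar z)=1$, $h$ continuous off a branch cut; multiplying the pre-kernel by a cocycle (i.e. replacing each entry $\kappa(x,y)$, $x\in\{z,\bar z\}$, $y\in\{w,\bar w\}$, by $c(x,y)\kappa(x,y)$; the resulting kernel is denoted $c\cdot K$) does not change the Pfaffians. The limiting rescaled kernel at the origin is the kernel $$K_{\lambda,c}(z,w)=e^{-\frac{|z|^{2\lambda}+|w|^{2\lambda}}\lambda}\begin{pmatrix}\kappa_{\lambda,c}(z,w)&\kappa_{\lambda,c}(z,\bar w)\\ \kappa_{\lambda,c}(\bar z,w)&\kappa_{\lambda,c}(\bar z,\bar w)\end{pmatrix}$$ such that $\lim_{N\to\infty}c_N\cdot K_N=K_{\lambda,c}$ for some sequence of cocycles $c_N$, where $\kappa_{\lambda,c}$ is holomorphic in both variables (with branch cuts) and is understood up to a cocycle. Fractional powers are taken with principal branches on $\mathbb C\setminus(-\infty,0]$, powers of $z^\lambda$ being read as $(z^\lambda)^s=z^{\lambda s}$ (and likewise powers of products factorwise). Special functions. $E_{a,b}(z)=\sum_{k=0}^\infty\frac{z^k}{\Gamma(ak+b)}$ and $$E_{\alpha,\mu,l}(z)=1+\sum_{k=1}^\infty z^k\prod_{i=0}^{k-1}\frac{\Gamma(\alpha(i\mu+l)+1)}{\Gamma(\alpha(i\mu+l+1)+1)}.$$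 For $m\in\mathbb N$: $F_{m,c}(z)=z^{m(1+c)-1}E_{2m,\,m(1+c)}(z^{2m})$; for $j=1,\dots,m$: $g_{j,m}(z)=z^{j-1}E_{m,\,2,\,1+\frac{j-1}m}(z^{2m})$ and $W_{j,m}(z)=W(g_{1,m},\dots,g_{j-1,m},g_{j+1,m},\dots,g_{m,m})(z)$, the Wronskian of the $m-1$ functions obtained by omitting $g_{j,m}$. *)

theory Defs
  imports
    "Jordan_Normal_Form.Determinant"
    "HOL-Analysis.Analysis"
begin

definition skew_form ::
  "nat \<Rightarrow> (complex \<Rightarrow> real) \<Rightarrow> (complex \<Rightarrow> complex) \<Rightarrow> (complex \<Rightarrow> complex) \<Rightarrow> complex" where
  "skew_form N Q h g =
     of_real (1 / pi) *
     (LINT \<zeta>|lborel. (cnj \<zeta> - \<zeta>) * of_real (exp (- real N * Q \<zeta>)) *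
                      (h \<zeta> * cnj (g \<zeta>) - cnj (h \<zeta>) * g \<zeta>))"

definition cpoly :: "real poly \<Rightarrow> complex \<Rightarrow> complex" where
  "cpoly p z = poly (map_poly of_real p) z"

definition skew_orthogonal ::
  "nat \<Rightarrow> (complex \<Rightarrow> real) \<Rightarrow> (nat \<Rightarrow> real poly) \<Rightarrow> (nat \<Rightarrow> real) \<Rightarrow> bool" where
  "skew_orthogonal N Q q s \<longleftrightarrow>
     (\<forall>k. degree (q k) = k \<and> lead_coeff (q k) = 1) \<and>
     (\<forall>k. s k > 0) \<and>
     (\<forall>k l. skew_form N Q (cpoly (q (2*k+1))) (cpoly (q (2*l))) = (if k = l then of_real (s k) else 0) \<and>
            skew_form N Q (cpoly (q (2*l))) (cpoly (q (2*k+1))) = - (if k = l then of_real (s k) else 0) \<and>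
            skew_form N Q (cpoly (q (2*k+1))) (cpoly (q (2*l+1))) = 0 \<and>
            skew_form N Q (cpoly (q (2*k))) (cpoly (q (2*l))) = 0)"

definition pre_kernel ::
  "nat \<Rightarrow> (nat \<Rightarrow> real poly) \<Rightarrow> (nat \<Rightarrow> real) \<Rightarrow> complex \<Rightarrow> complex \<Rightarrow> complex" where
  "pre_kernel N q s \<zeta> \<eta> =
     (\<Sum>k<N. (cpoly (q (2*k+1)) \<zeta> * cpoly (q (2*k)) \<eta> - cpoly (q (2*k)) \<zeta> * cpoly (q (2*k+1)) \<eta>)
               / of_real (s k))"

definition micro_scale :: "real \<Rightarrow> nat \<Rightarrow> real" where
  "micro_scale lam N = (lam * real N / 2) powr (- (1 / (2 * lam)))"

definition rescaled_pre_kernel ::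
  "real \<Rightarrow> nat \<Rightarrow> (nat \<Rightarrow> real poly) \<Rightarrow> (nat \<Rightarrow> real) \<Rightarrow> complex \<Rightarrow> complex \<Rightarrow> complex" where
  "rescaled_pre_kernel lam N q s z w =
     (let r = of_real (micro_scale lam N) in r ^ 3 * pre_kernel N q s (r * z) (r * w))"

text \<open>The kernel with pre-kernel \<open>\<kappa>\<close> and weight \<open>exp (- V z - V w)\<close>; both the rescaled
  kernel of the ensemble and its limit have this form, for different \<open>V\<close>.\<close>

definition matrix_kernel ::
  "(complex \<Rightarrow> real) \<Rightarrow> (complex \<Rightarrow> complex \<Rightarrow> complex) \<Rightarrow> complex \<Rightarrow> complex \<Rightarrow> complex^2^2" where
  "matrix_kernel V \<kappa> z w =
     exp (- (V z + V w)) *\<^sub>R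
       vector [vector [\<kappa> z w, \<kappa> z (cnj w)],
               vector [\<kappa> (cnj z) w, \<kappa> (cnj z) (cnj w)]]"

text \<open>All branch cuts are placed on the principal one, \<open>(-\<infinity>, 0]\<close>.\<close>

abbreviation slit_plane :: "complex set" where
  "slit_plane \<equiv> - \<real>\<^sub>\<le>\<^sub>0"

definition cocycle :: "(complex \<Rightarrow> complex \<Rightarrow> complex) \<Rightarrow> bool" where
  "cocycle cc \<longleftrightarrow>
     (\<exists>h. (\<forall>z w. cc z w = h z * h w) \<and> (\<forall>z. norm (h z) = 1) \<and> (\<forall>z. h z * h (cnj z) = 1) \<and>
          continuous_on slit_plane h)"

definition cocycle_mult ::
  "(complex \<Rightarrow> complex \<Rightarrow> complex) \<Rightarrow> (complex \<Rightarrow> complex \<Rightarrow> complex) \<Rightarrow> complex \<Rightarrow> complex \<Rightarrow> complex" where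
  "cocycle_mult cc \<kappa> = (\<lambda>x y. cc x y * \<kappa> x y)"

text \<open>\<open>\<kappa>\<close> is (a representative, modulo cocycles, of) the pre-kernel of the limiting rescaled
  kernel at the origin. The limit is locally uniform off the cuts: on the cut the
  condition \<open>h z * h (cnj z) = 1\<close> leaves only \<open>h z = 1\<close> or \<open>h z = -1\<close>, which cannot compensate the
  phase of a principal fractional power.
  The potential may depend on \<open>N\<close>.\<close>

definition limiting_pre_kernel ::
  "real \<Rightarrow> (nat \<Rightarrow> complex \<Rightarrow> real) \<Rightarrow> (nat \<Rightarrow> nat \<Rightarrow> real poly) \<Rightarrow> (nat \<Rightarrow> nat \<Rightarrow> real) \<Rightarrow>
   (complex \<Rightarrow> complex \<Rightarrow> complex) \<Rightarrow> bool" where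
  "limiting_pre_kernel lam Q q s \<kappa> \<longleftrightarrow>
     (\<forall>w\<in>slit_plane. (\<lambda>z. \<kappa> z w) holomorphic_on slit_plane) \<and>
     (\<forall>z\<in>slit_plane. (\<lambda>w. \<kappa> z w) holomorphic_on slit_plane) \<and>
     (\<exists>cc. (\<forall>N. cocycle (cc N)) \<and>
        (\<forall>C. compact C \<and> C \<subseteq> slit_plane \<times> slit_plane \<longrightarrow>
           uniform_limit C
             (\<lambda>N (z, w). matrix_kernel (\<lambda>x. real N / 2 * Q N (of_real (micro_scale lam N) * x))
                (cocycle_mult (cc N) (rescaled_pre_kernel lam N (q N) (s N))) z w)
             (\<lambda>(z, w). matrix_kernel (\<lambda>x. norm x powr (2 * lam) / lam) \<kappa> z w)
             sequentially))"

definition potential :: "nat \<Rightarrow> real \<Rightarrow> nat \<Rightarrow> complex \<Rightarrow> real" where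
  "potential m c N \<zeta> = norm \<zeta> powr (2 / real m) - 2 * c / real N * ln (norm \<zeta>)"

definition mittag_leffler :: "real \<Rightarrow> real \<Rightarrow> complex \<Rightarrow> complex" where
  "mittag_leffler a b z = (\<Sum>k. z ^ k / of_real (Gamma (a * real k + b)))"

definition kilbas_saigo :: "real \<Rightarrow> real \<Rightarrow> real \<Rightarrow> complex \<Rightarrow> complex" where
  "kilbas_saigo \<alpha> \<mu> l z =
     1 + (\<Sum>k. z ^ Suc k *
            of_real (\<Prod>i<Suc k. Gamma (\<alpha> * (real i * \<mu> + l) + 1) / Gamma (\<alpha> * (real i * \<mu> + l + 1) + 1)))"

text \<open>\<open>F_mc m c t z w\<close> is \<open>F\<^sub>m\<^sub>,\<^sub>c\<close> at the product \<open>t z w\<close>, where \<open>F\<^sub>m\<^sub>,\<^sub>c x = x\<^sup>a E (x\<^sup>2\<^sup>m)\<close>,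
  \<open>E = E\<^sub>2\<^sub>m\<^sub>,\<^sub>m\<^sub>(\<^sub>1\<^sub>+\<^sub>c\<^sub>)\<close> and \<open>a = m (1 + c) - 1\<close>. The fractional power of the product is taken
  factor by factor, which differs from \<open>(t z w) powr a\<close> when \<open>z w\<close> has crossed the cut.\<close>

definition F_mc :: "nat \<Rightarrow> real \<Rightarrow> real \<Rightarrow> complex \<Rightarrow> complex \<Rightarrow> complex" where
  "F_mc m c t z w =
     (let a = real m * (1 + c) - 1
      in of_real (t powr a) * z powr of_real a * w powr of_real a *
         mittag_leffler (2 * real m) (real m * (1 + c)) ((of_real t * z * w) ^ (2 * m)))"

definition g_jm :: "nat \<Rightarrow> nat \<Rightarrow> complex \<Rightarrow> complex" where
  "g_jm j m z = z ^ (j - 1) * kilbas_saigo (real m) 2 (1 + real (j - 1) / real m) (z ^ (2 * m))"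

definition wronskian :: "(complex \<Rightarrow> complex) list \<Rightarrow> complex \<Rightarrow> complex" where
  "wronskian fs z =
     Determinant.det (Matrix.mat (length fs) (length fs) (\<lambda>(i, k). (deriv ^^ i) (fs ! k) z))"

definition W_jm :: "nat \<Rightarrow> nat \<Rightarrow> complex \<Rightarrow> complex" where
  "W_jm j m = wronskian (map (\<lambda>i. g_jm i m) (filter (\<lambda>i. i \<noteq> j) [1..<m+1]))"

text \<open>The factor \<open>\<Prod>j=1..m-1. j!\<close> is the value \<open>G (m + 1)\<close> of the Barnes function.\<close>

definition kappa_tilde :: "nat \<Rightarrow> real \<Rightarrow> complex \<Rightarrow> complex \<Rightarrow> complex" where
  "kappa_tilde m c z w =
     (if m = 1 then
        LINT t:{0..1}|lborel.
          (z * exp (of_real (1/2 * (1 - t\<^sup>2)) * z\<^sup>2) - w * exp (of_real (1/2 * (1 - t\<^sup>2)) * w\<^sup>2)) * F_mc 1 c t z w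
      else
        (\<Sum>j=1..m. (-1) ^ (m - j) / of_nat (\<Prod>i=1..m-1. fact i) *
          (LINT t:{0..1}|lborel.
             (z * g_jm j m z * W_jm j m (of_real t * z) - w * g_jm j m w * W_jm j m (of_real t * w)) * F_mc m c t z w)))"

end

theory Submission
  imports Defs "HOL-Complex_Analysis.Complex_Analysis"
begin

text \<open>The potential is radial, so the skew form pairs only neighbouring monomials. This determines
  \<open>q\<^sub>2\<^sub>k\<close>, and \<open>q\<^sub>2\<^sub>k\<^sub>+\<^sub>1\<close> up to a multiple of \<open>q\<^sub>2\<^sub>k\<close> which cancels in the pre-kernel. After rescaling,
  the powers of \<open>N\<close> in the weight and in the pre-kernel cancel exactly: up to the cocycle \<open>h z = (z / \<bar>z\<bar>)\<^sup>c\<close>,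
  the rescaled pre-kernel is the \<open>N\<close>-th partial sum of a fixed double power series.

  It remains to recognise that series in the Wronskian formula. Since \<open>g\<^sub>1, \<dots>, g\<^sub>m\<close> solve
  \<open>u\<^sup>(\<^sup>m\<^sup>) = z\<^sup>m u\<close>, the sum \<open>\<Sum>\<^sub>j (-1)\<^sup>m\<^sup>-\<^sup>j g\<^sub>j(z) W\<^sub>j(\<zeta>) / G(m + 1)\<close> is the Green function of this equation, so the
  integral against \<open>F\<close> solves the inhomogeneous equation with right-hand side \<open>F(zw)\<close> and zero initial data;
  so does the power series, by the recursion of its coefficients.\<close>

text \<open>Equality with the Wronskian formula is obtained by duality instead of uniqueness for the
  initial value problem: the right-hand side carries \<open>t powr a\<close> with a = m(1+c) - 1,
  possibly negative, so the equation may be singular at the starting point t = 0. The jet of the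
  series is paired with a solution of the adjoint system prescribed at t = 1. Integrating the
  derivative of the pairing over [0,1] gives the Green integral; the boundary term at 1 is the
  series, and the one at 0 vanishes since every exponent m + a - i with i < m is positive. The
  adjoint solution consists of the Wronskian determinants of g_1, ..., g_m at tz with one row
  replaced by the values g_k(z); expanding along that row when it is the last one produces the
  minors W_j. G(m+1) is the Wronskian of all m functions. It is constant only for m > 1, where the
  equation has no term of order m - 1; for m = 1 the Green function is g_1(z)/g_1(tz) = exp((1 -
  t^2) z^2 / 2), whence the separate formula. Branch cuts enter only through powers of z and w that
  factor out; the remaining sum is entire.\<close>

subsection \<open>Radial moments\<close>

text \<open>Haar-measure argument: integrate \<open>1\<^sub>B(y) f(u z + y)\<close>, where \<open>B\<close> is the unit disc, in both orders.\<close>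

lemma distr_lborel_rotation:
  fixes u :: complex
  assumes u: "cmod u = 1"
  shows "distr lborel borel ((*) u) = lborel"
proof (rule measure_eqI)
  fix A :: "complex set" assume "A \<in> sets (distr lborel borel ((*) u))"
  then have A[measurable]: "A \<in> sets borel" by simp
  have u0: "u \<noteq> 0" using u by auto
  define b :: "complex \<Rightarrow> ennreal" where "b = indicator (ball 0 1)"
  have [measurable]: "b \<in> borel_measurable borel" 
    unfolding b_def by (intro borel_measurable_indicator borel_open open_ball)
  define f :: "complex \<Rightarrow> ennreal" where "f = indicator A"
  have [measurable]: "f \<in> borel_measurable borel" unfolding f_def by measurable
  have shift: "(\<integral>\<^sup>+z. g (c + z) \<partial>lborel) = (\<integral>\<^sup>+z. g z \<partial>lborel)"
    if [measurable]: "g \<in> borel_measurable borel" for g :: "complex \<Rightarrow> ennreal" and c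
  proof -
    have "(\<integral>\<^sup>+z. g z \<partial>lborel) = (\<integral>\<^sup>+z. g z \<partial>distr lborel borel ((+) c))"
      by (simp add: lborel_distr_plus)
    also have "\<dots> = (\<integral>\<^sup>+z. g (c + z) \<partial>lborel)" by (subst nn_integral_distr) auto
    finally show ?thesis ..
  qed
  have ball: "emeasure lborel (ball (c::complex) 1) = ennreal pi" for c
    by (subst emeasure_ball) (simp_all add: unit_ball_vol_2)
  have "ennreal pi * emeasure (distr lborel borel ((*) u)) A
      = (\<integral>\<^sup>+y. b y \<partial>lborel) * (\<integral>\<^sup>+z. f (u * z) \<partial>lborel)"
  proof -
    have "(\<integral>\<^sup>+z. f (u * z) \<partial>lborel) = (\<integral>\<^sup>+z. f z \<partial>distr lborel borel ((*) u))"
      by (subst nn_integral_distr) auto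
    then show ?thesis by (simp add: b_def f_def ball)
  qed
  also have "\<dots> = (\<integral>\<^sup>+y. b y * (\<integral>\<^sup>+z. f (u * z) \<partial>lborel) \<partial>lborel)"
    by (simp add: nn_integral_multc)
  also have "\<dots> = (\<integral>\<^sup>+y. (\<integral>\<^sup>+z. b y * f (u * z + y) \<partial>lborel) \<partial>lborel)"
  proof (rule nn_integral_cong)
    fix y
    have "(\<integral>\<^sup>+z. f (u * z) \<partial>lborel) = (\<integral>\<^sup>+z. f (u * (y / u + z)) \<partial>lborel)"
      by (rule shift[symmetric]) measurable
    also have "\<dots> = (\<integral>\<^sup>+z. f (u * z + y) \<partial>lborel)"
      using u0 by (simp add: algebra_simps)
    finally show "b y * (\<integral>\<^sup>+z. f (u * z) \<partial>lborel) = (\<integral>\<^sup>+z. b y * f (u * z + y) \<partial>lborel)"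
      by (simp add: nn_integral_cmult)
  qed
  also have "\<dots> = (\<integral>\<^sup>+z. (\<integral>\<^sup>+y. b y * f (u * z + y) \<partial>lborel) \<partial>lborel)"
    by (rule lborel_pair.Fubini') measurable
  also have "\<dots> = (\<integral>\<^sup>+z. (\<integral>\<^sup>+y. b (y - u * z) * f y \<partial>lborel) \<partial>lborel)"
  proof (rule nn_integral_cong)
    fix z
    show "(\<integral>\<^sup>+y. b y * f (u * z + y) \<partial>lborel) = (\<integral>\<^sup>+y. b (y - u * z) * f y \<partial>lborel)"
      by (subst shift[of "\<lambda>y. b (y - u * z) * f y" "u * z", symmetric]) auto
  qed
  also have "\<dots> = (\<integral>\<^sup>+y. (\<integral>\<^sup>+z. b (y - u * z) * f y \<partial>lborel) \<partial>lborel)"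
    by (rule lborel_pair.Fubini') measurable
  also have "\<dots> = (\<integral>\<^sup>+y. ennreal pi * f y \<partial>lborel)"
  proof (rule nn_integral_cong)
    fix y
    have "b (y - u * z) = indicator (ball (y / u) 1) z" for z
    proof -
      have "y - u * z = u * (y / u - z)" using u0 by (simp add: algebra_simps)
      then have "cmod (y - u * z) = cmod (y / u - z)" using u by (metis norm_mult mult_1)
      then show ?thesis by (simp add: b_def indicator_def dist_norm norm_minus_commute[of "u * z" y])
    qed
    then have "(\<integral>\<^sup>+z. b (y - u * z) * f y \<partial>lborel) = (\<integral>\<^sup>+z. indicator (ball (y / u) 1) z * f y \<partial>lborel)"
      by simp
    also have "\<dots> = (\<integral>\<^sup>+z. indicator (ball (y / u) 1) z \<partial>lborel) * f y"
      by (intro nn_integral_multc borel_measurable_indicator) simp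
    finally show "(\<integral>\<^sup>+z. b (y - u * z) * f y \<partial>lborel) = ennreal pi * f y"
      by (simp add: ball)
  qed
  also have "\<dots> = ennreal pi * emeasure lborel A"
    by (simp add: nn_integral_cmult f_def)
  finally have eq: "ennreal pi * emeasure (distr lborel borel ((*) u)) A = ennreal pi * emeasure lborel A" .
  have "x = y" if "ennreal pi * x = ennreal pi * y" for x y
    using that ennreal_mult_cancel_left[of "ennreal pi" x y] by simp
  with eq show "emeasure (distr lborel borel ((*) u)) A = emeasure lborel A" by blast
qed simp

lemma integral_lborel_rotation:
  fixes u :: complex and f :: "complex \<Rightarrow> complex"
  assumes "cmod u = 1" and [measurable]: "f \<in> borel_measurable borel"
  shows "(LINT z|lborel. f (u * z)) = (LINT z|lborel. f z)"
proof -
  have "(LINT z|lborel. f z) = (LINT z|distr lborel borel ((*) u). f z)"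
    using assms by (simp add: distr_lborel_rotation)
  also have "\<dots> = (LINT z|lborel. f (u * z))"
    by (subst integral_distr) auto
  finally show ?thesis ..
qed

text \<open>The set where N |z|^(2/m) <= a is a disc of area pi (a/N)^m, and the density is the
  derivative of this area; half-lines form an intersection-stable generator of the Borel sets. This
  replaces polar coordinates.\<close>

lemma distr_lborel_radial:
  fixes m :: nat and N :: real
  assumes m: "m \<ge> 1" and N: "N > 0"
  shows "distr lborel borel (\<lambda>z::complex. N * cmod z powr (2 / real m)) =
         density lborel (\<lambda>t. ennreal (pi * real m * t ^ (m - 1) / N ^ m) * indicator {0..} t)"
    (is "?M = ?D")
proof (rule measure_eqI_generator_eq[where E = "range (\<lambda>a. {..a::real})" and \<Omega> = UNIV and A = "\<lambda>i. {..real i}"])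
  have pos: "0 \<le> t \<Longrightarrow> 0 \<le> pi * real m * t ^ (m - 1) / N ^ m" for t using N by simp
  have eM: "emeasure ?M {..a} = (if a < 0 then 0 else ennreal (pi * (a / N) ^ m))" for a
  proof -
    have *: "emeasure ?M {..a} = emeasure lborel {z::complex. N * cmod z powr (2 / real m) \<le> a}"
      by (subst emeasure_distr) (auto simp: vimage_def)
    show ?thesis
    proof (cases "a < 0")
      case True
      have "{z::complex. N * cmod z powr (2 / real m) \<le> a} = {}"
        using True N by (auto simp: not_le intro!: order.strict_trans2[OF True])
      then show ?thesis using True * by simp
    next
      case False
      define r where "r = (a / N) powr (real m / 2)"
      have r: "r \<ge> 0" by (simp add: r_def)
      have an: "a / N \<ge> 0" using False N by simp
      have iff: "N * x powr (2 / real m) \<le> a \<longleftrightarrow> x \<le> r" if "x \<ge> 0" for x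
      proof -
        have "N * x powr (2 / real m) \<le> a \<longleftrightarrow> x powr (2 / real m) \<le> a / N"
          using N by (simp add: field_simps)
        also have "\<dots> \<longleftrightarrow> (x powr (2 / real m)) powr (real m / 2) \<le> (a / N) powr (real m / 2)"
          using an m powr_mono2[of "real m / 2" "x powr (2 / real m)" "a / N"]
            powr_less_mono2[of "real m / 2" "a / N" "x powr (2 / real m)"]
          by (auto simp: not_le[symmetric])
        also have "(x powr (2 / real m)) powr (real m / 2) = x"
          using that m by (simp add: powr_powr)
        finally show ?thesis by (simp add: r_def)
      qed
      have "{z::complex. N * cmod z powr (2 / real m) \<le> a} = cball 0 r"
        by (auto simp: iff)
      moreover have "r ^ 2 = (a / N) ^ m"
      proof -
        have "r ^ 2 = (a / N) powr real m"
          by (simp add: r_def power2_eq_square flip: powr_add)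
        then show ?thesis using an m
          by (cases "a / N = 0") (auto simp: powr_realpow)
      qed
      ultimately show ?thesis using False r *
        by (simp add: emeasure_cball unit_ball_vol_2)
    qed
  qed
  have eD: "emeasure ?D {..a} = (if a < 0 then 0 else ennreal (pi * (a / N) ^ m))" for a
  proof -
    have *: "emeasure ?D {..a} = (\<integral>\<^sup>+t. ennreal (pi * real m * t ^ (m - 1) / N ^ m) * indicator {0..a} t \<partial>lborel)"
      by (subst emeasure_density) (auto intro!: nn_integral_cong split: split_indicator)
    show ?thesis
    proof (cases "a < 0")
      case True then show ?thesis using * by simp
    next
      case False
      have "(\<integral>\<^sup>+t. ennreal (pi * real m * t ^ (m - 1) / N ^ m) * indicator {0..a} t \<partial>lborel)
          = ennreal (pi * (a / N) ^ m - pi * (0 / N) ^ m)"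
      proof (rule nn_integral_FTC_Icc)
        fix x :: real
        have "((\<lambda>x. pi * (x / N) ^ m) has_real_derivative pi * (real m * (x / N) ^ (m - 1) * (1 / N))) (at x)"
          using N by (auto intro!: derivative_eq_intros)
        also have "pi * (real m * (x / N) ^ (m - 1) * (1 / N)) = pi * real m * x ^ (m - 1) / N ^ m"
          using N m by (cases m) (simp_all add: power_divide field_simps)
        finally show "((\<lambda>x. pi * (x / N) ^ m) has_real_derivative pi * real m * x ^ (m - 1) / N ^ m) (at x)" .
      qed (use pos False N in auto)
      then show ?thesis using * False m by (simp add: power_0_left)
    qed
  qed
  show "emeasure ?M X = emeasure ?D X" if "X \<in> range (\<lambda>a. {..a::real})" for X
    using that eM eD by auto
  show "emeasure ?M {..real i} \<noteq> \<infinity>" for i unfolding eM by simp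
  show "Int_stable (range (\<lambda>a. {..a::real}))" by (auto simp: Int_stable_def)
  show "sets ?M = sigma_sets UNIV (range atMost)"
    using borel_eq_atMost by (metis sets_distr sets_measure_of top_greatest Pow_UNIV)
  show "sets ?D = sigma_sets UNIV (range atMost)"
    using borel_eq_atMost by (metis sets_density sets_lborel sets_measure_of top_greatest Pow_UNIV)
  show "(\<Union>i. {..real i}) = UNIV" by (auto simp: real_arch_simple)
qed auto

text \<open>Under t = N |z|^(2/m) the integrand becomes (t/N)^(mp) exp(-t), and the density of t
  turns this into Euler's integral. The condition \<open>p > -1\<close> is integrability at the
  origin.\<close>

lemma nn_integral_radial_moment:
  fixes m :: nat and N p :: real
  assumes m: "m \<ge> 1" and N: "N > 0" and p: "p > -1"
  shows "(\<integral>\<^sup>+z. ennreal (cmod z powr (2 * p) * exp (- N * cmod z powr (2 / real m))) \<partial>lborel)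
         = ennreal (pi * real m * N powr (- (real m * (p + 1))) * Gamma (real m * (p + 1)))"
proof -
  define f where "f t = ennreal ((t / N) powr (real m * p) * exp (- t))" for t
  have [measurable]: "f \<in> borel_measurable borel" unfolding f_def by measurable
  have mp: "real m * (p + 1) > 0" using m p by simp
  have "(\<integral>\<^sup>+z. ennreal (cmod z powr (2 * p) * exp (- N * cmod z powr (2 / real m))) \<partial>lborel)
      = (\<integral>\<^sup>+z. f (N * cmod z powr (2 / real m)) \<partial>lborel)"
    using N m by (intro nn_integral_cong) (simp add: f_def powr_powr)
  also have "\<dots> = (\<integral>\<^sup>+t. f t \<partial>distr lborel borel (\<lambda>z::complex. N * cmod z powr (2 / real m)))"
    by (subst nn_integral_distr) auto
  also have "\<dots> = (\<integral>\<^sup>+t. ennreal (pi * real m * t ^ (m - 1) / N ^ m) * indicator {0..} t * f t \<partial>lborel)"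
    unfolding distr_lborel_radial[OF m N] by (subst nn_integral_density) auto
  also have "\<dots> = (\<integral>\<^sup>+t. ennreal (pi * real m * N powr (- (real m * (p + 1)))) *
       ennreal (indicator {0..} t * t powr (real m * (p + 1) - 1) / exp t) \<partial>lborel)"
  proof (rule nn_integral_cong_AE)
    have "AE t::real in lborel. t \<noteq> 0" by (rule AE_lborel_singleton)
    then show "AE t in lborel. ennreal (pi * real m * t ^ (m - 1) / N ^ m) * indicator {0..} t * f t =
        ennreal (pi * real m * N powr (- (real m * (p + 1)))) *
        ennreal (indicator {0..} t * t powr (real m * (p + 1) - 1) / exp t)"
    proof eventually_elim
      case (elim t)
      show ?case
      proof (cases "t > 0")
        case True
        have 1: "t ^ (m - 1) = t powr (real m - 1)"
          using True m by (subst powr_realpow[symmetric]) (auto simp: of_nat_diff)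
        have 2: "N ^ m = N powr real m" using N by (simp add: powr_realpow)
        have "pi * real m * t ^ (m - 1) / N ^ m * ((t / N) powr (real m * p) * exp (- t)) =
          pi * real m * (t powr (real m - 1) * t powr (real m * p)) / (N powr real m * N powr (real m * p)) * exp (- t)"
          unfolding 1 2 using True N by (simp add: powr_divide)
        also have "\<dots> = pi * real m * N powr (- (real m * (p + 1))) * (t powr (real m * (p + 1) - 1) / exp t)"
          unfolding powr_add[symmetric] powr_minus_divide
          by (simp add: algebra_simps exp_minus divide_inverse)
        finally show ?thesis using True N
          by (simp add: f_def ennreal_mult[symmetric])
      qed (use elim in auto)
    qed
  qed
  also have "\<dots> = ennreal (pi * real m * N powr (- (real m * (p + 1)))) * ennreal (Gamma (real m * (p + 1)))"
    using mp by (subst nn_integral_cmult) (auto simp: Gamma_conv_nn_integral_real)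
  also have "\<dots> = ennreal (pi * real m * N powr (- (real m * (p + 1))) * Gamma (real m * (p + 1)))"
    using mp by (subst ennreal_mult[symmetric]) auto
  finally show ?thesis .
qed

text \<open>The squared norm of \<zeta>^j for the weight exp(-N Q) and the measure dA. The factor
  1/pi of dA is included, hence the pi in \<open>integral_monomial_weight\<close>.\<close>

definition moment :: "nat \<Rightarrow> real \<Rightarrow> nat \<Rightarrow> nat \<Rightarrow> real" where
  "moment m c N j = real m * real N powr (- (real m * (real j + 1 + c))) * Gamma (real m * (real j + 1 + c))"

lemma moment_pos:
  assumes "m \<ge> 1" "c > -1" "N \<ge> 1"
  shows "moment m c N j > 0"
  using assms unfolding moment_def by (intro mult_pos_pos Gamma_real_pos) auto

text \<open>The diagonal case is a radial moment. Off the diagonal a rotation leaves the weight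
  invariant and can be chosen to change the sign of the monomial.\<close>

lemma
  fixes m N i j :: nat and c :: real
  assumes m: "m \<ge> 1" and c: "c > -1" and N: "N \<ge> 1"
  shows integrable_monomial_weight:
      "integrable lborel (\<lambda>z. of_real (exp (- real N * potential m c N z)) * (z ^ i * cnj z ^ j))" (is "integrable _ ?f")
    and integral_monomial_weight:
      "(LINT z|lborel. of_real (exp (- real N * potential m c N z)) * (z ^ i * cnj z ^ j)) =
        of_real (if i = j then pi * moment m c N j else 0)"
proof -
  define w where "w z = exp (- real N * potential m c N z)" for z :: complex
  have [measurable]: "potential m c N \<in> borel_measurable borel"
    unfolding potential_def by measurable
  have [measurable]: "w \<in> borel_measurable borel" unfolding w_def by measurable
  have [measurable]: "cnj \<in> borel_measurable borel"
    by (intro borel_measurable_continuous_onI continuous_intros)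
  \<comment> \<open>At z = 0 the left side is positive while \<open>0 powr x = 0\<close>, so the
    formula holds only off a null set.\<close>
  have w: "w z = cmod z powr (2 * c) * exp (- real N * cmod z powr (2 / real m))" if "z \<noteq> 0" for z
    using that N unfolding w_def potential_def
    by (simp add: powr_def algebra_simps flip: exp_add)
  have nn: "(\<integral>\<^sup>+z. ennreal (w z * cmod z ^ k) \<partial>lborel) =
     ennreal (pi * real m * real N powr (- (real m * (c + real k / 2 + 1))) * Gamma (real m * (c + real k / 2 + 1)))" for k
  proof -
    have "(\<integral>\<^sup>+z. ennreal (w z * cmod z ^ k) \<partial>lborel) =
       (\<integral>\<^sup>+z. ennreal (cmod z powr (2 * (c + real k / 2)) * exp (- real N * cmod z powr (2 / real m))) \<partial>lborel)"
    proof (rule nn_integral_cong_AE)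
      have "AE z::complex in lborel. z \<noteq> 0" by (rule AE_lborel_singleton)
      then show "AE z in lborel. ennreal (w z * cmod z ^ k) =
          ennreal (cmod z powr (2 * (c + real k / 2)) * exp (- real N * cmod z powr (2 / real m)))"
        by eventually_elim (simp add: w powr_add powr_realpow algebra_simps)
    qed
    then show ?thesis
      using nn_integral_radial_moment[of m "real N" "c + real k / 2"] m N c by simp
  qed
  have int: "integrable lborel (\<lambda>z. w z * cmod z ^ k)" for k
  proof (rule integrableI_nonneg)
    show "AE z in lborel. 0 \<le> w z * cmod z ^ k" by (simp add: w_def)
    show "(\<integral>\<^sup>+z. ennreal (w z * cmod z ^ k) \<partial>lborel) < \<infinity>" unfolding nn by simp
  qed measurable
  show "integrable lborel ?f"
  proof (rule Bochner_Integration.integrable_bound[OF int[of "i + j"]])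
    show "?f \<in> borel_measurable lborel" unfolding w_def[symmetric] by measurable
    show "AE z in lborel. norm (?f z) \<le> norm (w z * cmod z ^ (i + j))"
      by (simp add: norm_mult norm_power power_add w_def)
  qed
  show "(LINT z|lborel. ?f z) = of_real (if i = j then pi * moment m c N j else 0)"
  proof (cases "i = j")
    case True
    have "(LINT z|lborel. ?f z) = (LINT z|lborel. complex_of_real (w z * cmod z ^ (2 * j)))"
    proof (rule Bochner_Integration.integral_cong)
      fix z
      have "z ^ j * cnj z ^ j = of_real (cmod z ^ (2 * j))"
        by (metis complex_norm_square power_mult power_mult_distrib of_real_power)
      then show "?f z = complex_of_real (w z * cmod z ^ (2 * j))"
        using True by (simp add: w_def)
    qed simp
    also have "\<dots> = of_real (LINT z|lborel. w z * cmod z ^ (2 * j))"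
      by (rule integral_complex_of_real)
    also have "(LINT z|lborel. w z * cmod z ^ (2 * j)) = pi * moment m c N j"
    proof -
      have "0 \<le> pi * moment m c N j" using moment_pos[OF m c N, of j] by simp
      moreover have "(\<integral>\<^sup>+z. ennreal (w z * cmod z ^ (2 * j)) \<partial>lborel) = ennreal (pi * moment m c N j)"
        unfolding nn moment_def by (simp add: algebra_simps)
      ultimately show ?thesis
        by (subst integral_eq_nn_integral) (auto simp: w_def)
    qed
    finally show ?thesis using True by simp
  next
    case False
    define d where "d = int i - int j"
    have d: "d \<noteq> 0" using False by (simp add: d_def)
    \<comment> \<open>The angle pi/(i - j) makes u^i (cnj u)^j equal to \<open>cis pi\<close>, that
      is -1.\<close>
    define u where "u = cis (pi / real_of_int d)"
    have u: "cmod u = 1" by (simp add: u_def)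
    have ud: "u ^ i * cnj u ^ j = -1"
    proof -
      have "u ^ i * cnj u ^ j = cis (real i * (pi / d)) * cis (- (real j * (pi / d)))"
        by (simp add: u_def Complex.DeMoivre cis_cnj flip: complex_cnj_power)
      also have "\<dots> = cis (real_of_int d * (pi / d))"
        by (simp add: cis_mult d_def algebra_simps diff_divide_distrib)
      finally show ?thesis using d by simp
    qed
    have "(LINT z|lborel. ?f z) = (LINT z|lborel. ?f (u * z))"
      by (rule integral_lborel_rotation[symmetric, OF u]) (unfold w_def[symmetric], measurable)
    also have "\<dots> = (LINT z|lborel. - ?f z)"
    proof (rule Bochner_Integration.integral_cong)
      fix z
      have "?f (u * z) = of_real (w z) * (u ^ i * cnj u ^ j * (z ^ i * cnj z ^ j))"
        using u by (simp add: w_def potential_def norm_mult power_mult_distrib algebra_simps)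
      then show "?f (u * z) = - ?f z" unfolding ud by (simp add: w_def)
    qed simp
    also have "\<dots> = - (LINT z|lborel. ?f z)" by simp
    finally have "(LINT z|lborel. ?f z) = 0" by (simp add: eq_neg_iff_add_eq_0)
    then show ?thesis using False by simp
  qed
qed

subsection \<open>Skew-orthogonal polynomials\<close>

text \<open>\<open>skew_row h p j\<close> is \<open>\<langle>p|\<zeta>\<^sup>j\<rangle>\<close> when \<open>h\<close> is the sequence of moments.\<close>

definition skew_row :: "(nat \<Rightarrow> real) \<Rightarrow> real poly \<Rightarrow> nat \<Rightarrow> real" where
  "skew_row h p j = 2 * h (j + 1) * coeff p (j + 1) - (if j = 0 then 0 else 2 * h j * coeff p (j - 1))"

lemma cpoly_altdef: "cpoly p z = (\<Sum>i\<le>degree p. of_real (coeff p i) * z ^ i)"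
  by (simp add: cpoly_def poly_altdef coeff_map_poly degree_map_poly)

text \<open>The inner conditional is the Gram matrix of the monomials: the factor cnj \<zeta> -
  \<zeta> shifts one exponent by one, and orthogonality of the monomials leaves only the two
  diagonals next to the main one.\<close>

lemma sum_coeff_skew_row:
  "(\<Sum>i\<le>degree p. coeff p i * (if i = j + 1 then 2 * h i else if j = i + 1 then - 2 * h j else 0)) = skew_row h p j"
proof -
  have a: "(\<Sum>i\<le>degree p. if i = k then coeff p i * x else 0) = coeff p k * x" for k and x :: real
    by (auto simp: coeff_eq_0)
  have "(\<Sum>i\<le>degree p. coeff p i * (if i = j + 1 then 2 * h i else if j = i + 1 then - 2 * h j else 0))
     = (\<Sum>i\<le>degree p. (if i = j + 1 then coeff p i * (2 * h (j + 1)) else 0) -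
          (if j = 0 then 0 else if i = j - 1 then coeff p i * (2 * h j) else 0))"
    by (intro sum.cong) auto
  also have "\<dots> = skew_row h p j"
    unfolding sum_subtractf skew_row_def by (cases "j = 0") (simp_all add: a del: sum.delta sum.delta')
  finally show ?thesis .
qed

lemma skew_form_cpoly:
  assumes m: "m \<ge> 1" and c: "c > -1" and N: "N \<ge> 1"
  shows "skew_form N (potential m c N) (cpoly p) (cpoly q) =
     of_real (\<Sum>j\<le>degree q. coeff q j * skew_row (moment m c N) p j)"
proof -
  define w where "w z = complex_of_real (exp (- real N * potential m c N z))" for z :: complex
  define h where "h = moment m c N"
  define J where "J i j z = w z * (z ^ i * cnj z ^ j)" for i j z
  have J: "integrable lborel (J i j)" "(LINT z|lborel. J i j z) = of_real (if i = j then pi * h j else 0)" for i j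
    unfolding J_def w_def h_def
    using integrable_monomial_weight[OF m c N] integral_monomial_weight[OF m c N] by auto
  define B where "B i j = (if i = j + 1 then 2 * h i else if j = i + 1 then - 2 * h j else 0)" for i j
  \<comment> \<open>The four terms of (cnj z - z)(z^i cnj z^j - cnj z^i z^j), weight included. Each
    nonzero entry of \<open>B\<close> collects two of them, whence the factor 2.\<close>
  define K where "K i j z = J i (j + 1) z - J j (i + 1) z - J (i + 1) j z + J (j + 1) i z" for i j z
  have K: "integrable lborel (K i j)" "(LINT z|lborel. K i j z) = of_real (pi * B i j)" for i j
    unfolding K_def using J by (auto simp: B_def)
  have *: "(cnj z - z) * w z * (cpoly p z * cnj (cpoly q z) - cnj (cpoly p z) * cpoly q z) =
     (\<Sum>i\<le>degree p. \<Sum>j\<le>degree q. of_real (coeff p i * coeff q j) * K i j z)" for z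
  proof -
    have 1: "cpoly p z * cnj (cpoly q z) = (\<Sum>i\<le>degree p. \<Sum>j\<le>degree q. of_real (coeff p i * coeff q j) * (z ^ i * cnj z ^ j))"
      unfolding cpoly_altdef cnj_sum sum_product by (intro sum.cong) (auto simp: algebra_simps)
    have 2: "cnj (cpoly p z) * cpoly q z = (\<Sum>i\<le>degree p. \<Sum>j\<le>degree q. of_real (coeff p i * coeff q j) * (cnj z ^ i * z ^ j))"
      unfolding cpoly_altdef cnj_sum sum_product by (intro sum.cong) (auto simp: algebra_simps)
    show ?thesis
      unfolding 1 2 sum_subtractf[symmetric] sum_distrib_left
      by (intro sum.cong) (auto simp: K_def J_def algebra_simps)
  qed
  have "skew_form N (potential m c N) (cpoly p) (cpoly q) =
     of_real (1 / pi) * (LINT z|lborel. (\<Sum>i\<le>degree p. \<Sum>j\<le>degree q. of_real (coeff p i * coeff q j) * K i j z))"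
    unfolding skew_form_def w_def[symmetric] * ..
  also have "\<dots> = of_real (1 / pi) * (\<Sum>i\<le>degree p. \<Sum>j\<le>degree q. of_real (coeff p i * coeff q j) * of_real (pi * B i j))"
    using K by simp
  also have "\<dots> = of_real (\<Sum>i\<le>degree p. \<Sum>j\<le>degree q. coeff p i * coeff q j * B i j)"
    by (simp add: sum_distrib_left algebra_simps)
  also have "(\<Sum>i\<le>degree p. \<Sum>j\<le>degree q. coeff p i * coeff q j * B i j) =
     (\<Sum>j\<le>degree q. coeff q j * (\<Sum>i\<le>degree p. coeff p i * B i j))"
    by (subst sum.swap) (simp add: sum_distrib_left algebra_simps)
  also have "\<dots> = (\<Sum>j\<le>degree q. coeff q j * skew_row h p j)"
    unfolding B_def sum_coeff_skew_row ..
  finally show ?thesis by (simp add: h_def)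
qed

text \<open>The coefficient of z^(2i) in q_(2k): orthogonality to odd monomials fixes the quotient
  of neighbouring even coefficients as a quotient of moments.\<close>

definition even_ratio :: "(nat \<Rightarrow> real) \<Rightarrow> nat \<Rightarrow> nat \<Rightarrow> real" where
  "even_ratio h k i = (\<Prod>j=i..<k. h (2 * j + 2) / h (2 * j + 1))"

text \<open>Row j links only the coefficients of index j+1 and j-1, so the parities decouple. Even
  rows propagate zeros upwards, starting from row 0, which has a single term; odd rows determine the
  even coefficients downwards from the one of index 2k.\<close>

lemma skew_row_eq_0_imp:
  fixes h :: "nat \<Rightarrow> real"
  assumes h: "\<And>j. h j > 0" and row: "\<And>j. j < 2 * k \<Longrightarrow> skew_row h p j = 0"
  shows odd_coeff_skew: "i < k \<Longrightarrow> coeff p (2 * i + 1) = 0"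
    and even_coeff_skew: "i \<le> k \<Longrightarrow> coeff p (2 * i) = even_ratio h k i * coeff p (2 * k)"
proof -
  show "i < k \<Longrightarrow> coeff p (2 * i + 1) = 0"
  proof (induction i)
    case 0
    then show ?case using row[of 0] h[of 1] by (auto simp: skew_row_def)
  next
    case (Suc i)
    then show ?case using row[of "2 * i + 2"] h[of "2 * i + 3"]
      by (auto simp: skew_row_def numeral_3_eq_3)
  qed
  show "i \<le> k \<Longrightarrow> coeff p (2 * i) = even_ratio h k i * coeff p (2 * k)"
  proof (induction i rule: inc_induct)
    case base
    then show ?case by (simp add: even_ratio_def)
  next
    case (step i)
    have "h (2 * i + 1) * coeff p (2 * i) = h (2 * i + 2) * coeff p (2 * Suc i)"
      using row[of "2 * i + 1"] step.hyps by (simp add: skew_row_def)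
    then have "coeff p (2 * i) = h (2 * i + 2) / h (2 * i + 1) * coeff p (2 * Suc i)"
      using h[of "2 * i + 1"] by (simp add: field_simps)
    also have "\<dots> = h (2 * i + 2) / h (2 * i + 1) * even_ratio h k (Suc i) * coeff p (2 * k)"
      using step.IH by simp
    also have "h (2 * i + 2) / h (2 * i + 1) * even_ratio h k (Suc i) = even_ratio h k i"
      using step.hyps by (simp add: even_ratio_def prod.atLeast_Suc_lessThan)
    finally show ?case .
  qed
qed

definition even_poly :: "(nat \<Rightarrow> real) \<Rightarrow> nat \<Rightarrow> real poly" where
  "even_poly h k = (\<Sum>i\<le>k. monom (even_ratio h k i) (2 * i))"

lemma coeff_even_poly:
  "coeff (even_poly h k) (2 * i) = (if i \<le> k then even_ratio h k i else 0)"
  "coeff (even_poly h k) (2 * i + 1) = 0"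
proof -
  have "2 * j = 2 * i + 1 \<longleftrightarrow> False" for j :: nat by presburger
  then show "coeff (even_poly h k) (2 * i + 1) = 0"
    unfolding even_poly_def coeff_sum by (intro sum.neutral) auto
  have "coeff (even_poly h k) (2 * i) = (\<Sum>j\<le>k. if j = i then even_ratio h k j else 0)"
    unfolding even_poly_def coeff_sum by (intro sum.cong) auto
  then show "coeff (even_poly h k) (2 * i) = (if i \<le> k then even_ratio h k i else 0)"
    by simp
qed

lemma cpoly_monom: "cpoly (monom a n) z = of_real a * z ^ n"
  by (simp add: cpoly_def map_poly_monom poly_monom)

lemma cpoly_add: "cpoly (p + q) z = cpoly p z + cpoly q z"
proof -
  have "map_poly complex_of_real (p + q) = map_poly of_real p + map_poly of_real q"
    by (intro poly_eqI) (simp add: coeff_map_poly)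
  then show ?thesis by (simp add: cpoly_def)
qed

lemma cpoly_smult: "cpoly (smult a p) z = of_real a * cpoly p z"
  by (simp add: cpoly_def map_poly_smult)

lemma cpoly_even_poly:
  "cpoly (even_poly h k) z = (\<Sum>i\<le>k. of_real (even_ratio h k i) * z ^ (2 * i))"
proof -
  have "finite A \<Longrightarrow> cpoly (sum f A) z = (\<Sum>i\<in>A. cpoly (f i) z)" for f and A :: "nat set"
    by (induction A rule: finite_induct) (auto simp: cpoly_add, simp add: cpoly_def)
  then show ?thesis by (simp add: even_poly_def cpoly_monom)
qed

text \<open>Passing from k to k+1 multiplies all old coefficients by the same quotient of moments.
  After rescaling this becomes the recursion of \<open>kernel_coeff\<close>.\<close>

lemma cpoly_even_poly_Suc:
  "cpoly (even_poly h (Suc k)) z =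
     z ^ (2 * Suc k) + of_real (h (2 * k + 2) / h (2 * k + 1)) * cpoly (even_poly h k) z"
proof -
  have 1: "even_ratio h (Suc k) i = even_ratio h k i * (h (2 * k + 2) / h (2 * k + 1))" if "i \<le> k" for i
    using that by (simp add: even_ratio_def)
  have "cpoly (even_poly h (Suc k)) z =
     z ^ (2 * Suc k) + (\<Sum>i\<le>k. of_real (even_ratio h (Suc k) i) * z ^ (2 * i))"
    by (simp add: cpoly_even_poly even_ratio_def)
  also have "(\<Sum>i\<le>k. complex_of_real (even_ratio h (Suc k) i) * z ^ (2 * i)) =
      (\<Sum>i\<le>k. of_real (h (2 * k + 2) / h (2 * k + 1)) * (of_real (even_ratio h k i) * z ^ (2 * i)))"
    by (intro sum.cong) (simp_all add: 1)
  finally show ?thesis by (simp add: cpoly_even_poly sum_distrib_left)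
qed

text \<open>Orthogonality to all q_l with l < 2k is orthogonality to all monomials of degree below
  2k, so \<open>skew_row_eq_0_imp\<close> applies to q_(2k) and q_(2k+1) alike. For q_(2k+1) it
  leaves the coefficient of z^(2k) undetermined, which is \<alpha>. The value of \<open>s k\<close>
  comes from the leading term alone, since the coefficient of index 2k-1 vanishes.\<close>

lemma skew_orthogonal_potential:
  assumes m: "m \<ge> 1" and c: "c > -1" and N: "N \<ge> 1"
    and q: "skew_orthogonal N (potential m c N) q s"
  defines "h \<equiv> moment m c N"
  shows "q (2 * k) = even_poly h k"
    and "\<exists>\<alpha>. q (2 * k + 1) = monom 1 (2 * k + 1) + smult \<alpha> (even_poly h k)"
    and "s k = 2 * h (2 * k + 1)"
proof -
  have h: "h j > 0" for j unfolding h_def by (rule moment_pos[OF m c N])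
  have deg: "degree (q k) = k" and lead: "coeff (q k) k = 1" for k
    using q unfolding skew_orthogonal_def by (metis)+
  have form: "skew_form N (potential m c N) (cpoly p) (cpoly (q l)) =
     of_real ((\<Sum>j<l. coeff (q l) j * skew_row h p j) + skew_row h p l)" for p l
    unfolding skew_form_cpoly[OF m c N] deg h_def[symmetric]
    by (simp add: lessThan_Suc_atMost[symmetric] lead)
  \<comment> \<open>Each q_j is monic of degree j, so this is forward substitution in a
    unitriangular system.\<close>
  have row0: "skew_row h p j = 0"
    if "j < n" and orth: "\<And>l. l < n \<Longrightarrow> skew_form N (potential m c N) (cpoly p) (cpoly (q l)) = 0" for p j n
    using \<open>j < n\<close>
  proof (induction j rule: less_induct)
    case (less j)
    then have "(\<Sum>i<j. coeff (q j) i * skew_row h p i) = 0"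
      by (intro sum.neutral) auto
    with orth[OF less.prems] show ?case unfolding form by simp
  qed
  have ev: "skew_form N (potential m c N) (cpoly (q (2 * k))) (cpoly (q l)) = 0" if "l < 2 * k + 1" for k l
  proof (cases "even l")
    case True
    then show ?thesis using q by (auto simp: skew_orthogonal_def elim!: evenE)
  next
    case False
    then obtain i where "l = 2 * i + 1" by (auto elim: oddE)
    moreover from this have "i \<noteq> k" using that by auto
    ultimately show ?thesis using q by (auto simp: skew_orthogonal_def)
  qed
  have od: "skew_form N (potential m c N) (cpoly (q (2 * k + 1))) (cpoly (q l)) = 0" if "l < 2 * k" for k l
  proof (cases "even l")
    case True
    then obtain i where "l = 2 * i" by (auto elim: evenE)
    moreover from this have "i \<noteq> k" using that by auto
    ultimately show ?thesis using q by (auto simp: skew_orthogonal_def)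
  next
    case False
    then obtain i where "l = 2 * i + 1" by (auto elim: oddE)
    then show ?thesis using q by (auto simp: skew_orthogonal_def)
  qed
  have rows: "skew_row h (q (2 * k)) j = 0" if "j < 2 * k" for j
    by (rule row0[of j "2 * k"]) (use that ev in auto)
  have rowso: "skew_row h (q (2 * k + 1)) j = 0" if "j < 2 * k" for j
    by (rule row0[of j "2 * k"]) (use that od in auto)
  show "q (2 * k) = even_poly h k"
  proof (rule poly_eqI)
    fix n
    show "coeff (q (2 * k)) n = coeff (even_poly h k) n"
    proof (cases "even n")
      case True
      then obtain i where n: "n = 2 * i" by (auto elim: evenE)
      show ?thesis
        using even_coeff_skew[of h k "q (2 * k)" i] h rows lead[of "2 * k"] deg[of "2 * k"]
        by (cases "i \<le> k") (auto simp: n coeff_even_poly coeff_eq_0)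
    next
      case False
      then obtain i where n: "n = 2 * i + 1" by (auto elim: oddE)
      show ?thesis
        using odd_coeff_skew[of h k "q (2 * k)" i] h rows deg[of "2 * k"]
        by (cases "i < k") (simp_all only: n coeff_even_poly, auto simp: coeff_eq_0)
    qed
  qed
  have qo: "q (2 * k + 1) = monom 1 (2 * k + 1) + smult (coeff (q (2 * k + 1)) (2 * k)) (even_poly h k)"
  proof (rule poly_eqI)
    fix n
    show "coeff (q (2 * k + 1)) n = coeff (monom 1 (2 * k + 1) + smult (coeff (q (2 * k + 1)) (2 * k)) (even_poly h k)) n"
    proof (cases "even n")
      case True
      then obtain i where n: "n = 2 * i" by (auto elim: evenE)
      have "2 * k + 1 \<noteq> 2 * i" by presburger
      then show ?thesis
        using even_coeff_skew[of h k "q (2 * k + 1)" i] h rowso deg[of "2 * k + 1"]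
        by (cases "i \<le> k") (auto simp: n coeff_even_poly coeff_eq_0)
    next
      case False
      then obtain i where n: "n = 2 * i + 1" by (auto elim: oddE)
      consider "i < k" | "i = k" | "i > k" by linarith
      then show ?thesis
      proof cases
        case 1
        then show ?thesis
          using odd_coeff_skew[of h k "q (2 * k + 1)" i] h rowso
          by (simp only: n coeff_add coeff_smult coeff_even_poly) simp
      next
        case 2
        then show ?thesis using lead[of "2 * k + 1"]
          by (simp only: n coeff_add coeff_smult coeff_even_poly) simp
      next
        case 3
        then show ?thesis using deg[of "2 * k + 1"]
          by (simp only: n coeff_add coeff_smult coeff_even_poly) (simp add: coeff_eq_0)
      qed
    qed
  qed
  then show "\<exists>\<alpha>. q (2 * k + 1) = monom 1 (2 * k + 1) + smult \<alpha> (even_poly h k)" by blast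
  have "of_real (s k) = skew_form N (potential m c N) (cpoly (q (2 * k + 1))) (cpoly (q (2 * k)))"
    using q by (simp add: skew_orthogonal_def)
  also have "\<dots> = of_real (skew_row h (q (2 * k + 1)) (2 * k))"
    unfolding form using rowso by simp
  finally have "s k = skew_row h (q (2 * k + 1)) (2 * k)" using of_real_eq_iff by blast
  also have "\<dots> = 2 * h (2 * k + 1)"
  proof (cases k)
    case 0
    then show ?thesis using lead[of 1] by (simp add: skew_row_def)
  next
    case (Suc k')
    have "coeff (q (2 * k + 1)) (2 * k' + 1) = 0"
      using odd_coeff_skew[of h k "q (2 * k + 1)" k'] h rowso Suc by simp
    then show ?thesis using lead[of "2 * k + 1"] Suc by (simp add: skew_row_def)
  qed
  finally show "s k = 2 * h (2 * k + 1)" .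
qed

lemma pre_kernel_potential:
  assumes m: "m \<ge> 1" and c: "c > -1" and N: "N \<ge> 1"
    and q: "skew_orthogonal N (potential m c N) q s"
  defines "h \<equiv> moment m c N"
  shows "pre_kernel N q s z w =
    (\<Sum>k<N. (z ^ (2 * k + 1) * cpoly (even_poly h k) w - cpoly (even_poly h k) z * w ^ (2 * k + 1))
       / of_real (2 * h (2 * k + 1)))"
  unfolding pre_kernel_def
proof (rule sum.cong)
  fix k
  note * = skew_orthogonal_potential[OF m c N q, of k, folded h_def]
  obtain \<alpha> where \<alpha>: "q (2 * k + 1) = monom 1 (2 * k + 1) + smult \<alpha> (even_poly h k)"
    using *(2) by blast
  show "(cpoly (q (2 * k + 1)) z * cpoly (q (2 * k)) w - cpoly (q (2 * k)) z * cpoly (q (2 * k + 1)) w) / of_real (s k) =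
    (z ^ (2 * k + 1) * cpoly (even_poly h k) w - cpoly (even_poly h k) z * w ^ (2 * k + 1))
       / of_real (2 * h (2 * k + 1))"
    unfolding *(1,3) \<alpha> cpoly_add cpoly_smult cpoly_monom by (simp add: algebra_simps)
qed simp

text \<open>The Taylor coefficients in the limit: up to a power of \<open>N\<close>, \<open>kernel_coeff\<close> is the
  rescaled value of \<open>q\<^sub>2\<^sub>k / s\<^sub>k\<close>, with \<open>u\<close> in the role of \<open>(2m)\<^sup>m w\<^sup>2\<close>.\<close>

fun kernel_coeff :: "nat \<Rightarrow> real \<Rightarrow> nat \<Rightarrow> complex \<Rightarrow> complex" where
  "kernel_coeff m c 0 u = 1 / of_real (Gamma (real m * (2 + c)))"
| "kernel_coeff m c (Suc k) u =
     (of_real (Gamma (real m * (real (2 * k) + 3 + c))) * kernel_coeff m c k u + u ^ Suc k) /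
     of_real (Gamma (real m * (real (2 * k) + 4 + c)))"

text \<open>Homogeneity in N: a quotient of consecutive moments contributes N^(-m), and so does z^2,
  hence every term of q_(2k) carries N^(-mk). Division by the moment of index 2k+1, which carries
  N^(-m(2k+2+c)), gives the single power on the right.\<close>

lemma cpoly_even_poly_rescaled:
  assumes m: "m \<ge> 1" and c: "c > -1" and N: "N \<ge> 1"
  defines "h \<equiv> moment m c N"
  assumes z: "z ^ 2 = of_real (real N powr (- real m)) * u"
  shows "cpoly (even_poly h k) z / of_real (2 * h (2 * k + 1)) =
     of_real (real N powr (real m * (real k + 2 + c)) / (2 * real m)) * kernel_coeff m c k u"
proof (induction k)
  case 0
  have G: "Gamma (real m * (2 + c)) > 0" using m c by (intro Gamma_real_pos) auto
  have h1: "h 1 = real m * (1 / real N powr (real m * (2 + c))) * Gamma (real m * (2 + c))"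
    unfolding h_def moment_def by (simp add: powr_minus_divide)
  show ?case unfolding cpoly_even_poly using m N G by (simp add: even_ratio_def h1[unfolded One_nat_def])
next
  case (Suc k)
  define G3 where "G3 = Gamma (real m * (real (2 * k) + 3 + c))"
  define G4 where "G4 = Gamma (real m * (real (2 * k) + 4 + c))"
  have G: "G3 > 0" "G4 > 0" using m c unfolding G3_def G4_def by (auto intro!: Gamma_real_pos mult_pos_pos)
  have h1: "h (2 * k + 1) > 0" unfolding h_def by (rule moment_pos[OF m c N])
  have h2: "h (2 * k + 2) = real m * real N powr (- (real m * (2 * real k + 3 + c))) * G3"
    unfolding h_def moment_def G3_def by (simp add: algebra_simps)
  have h3: "h (2 * Suc k + 1) = real m * real N powr (- (real m * (2 * real k + 4 + c))) * G4"
    unfolding h_def moment_def G4_def by (simp add: algebra_simps)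
  have N0: "real N > 0" using N by simp
  have zp: "z ^ (2 * Suc k) = of_real (real N powr (- (real m * (real k + 1)))) * u ^ Suc k"
  proof -
    have "(real N powr (- real m)) ^ Suc k = real N powr (- (real m * (real k + 1)))"
      using N0 by (subst powr_power) (auto simp: algebra_simps)
    then show ?thesis unfolding power_mult z power_mult_distrib
      by (metis of_real_power)
  qed
  have "cpoly (even_poly h (Suc k)) z =
     z ^ (2 * Suc k) + of_real (2 * h (2 * k + 2)) * (cpoly (even_poly h k) z / of_real (2 * h (2 * k + 1)))"
    unfolding cpoly_even_poly_Suc using h1 by simp
  also have "\<dots> = of_real (real N powr (- (real m * (real k + 1)))) * u ^ Suc k +
     of_real (2 * h (2 * k + 2) * (real N powr (real m * (real k + 2 + c)) / (2 * real m))) * kernel_coeff m c k u"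
    unfolding Suc.IH zp by simp
  also have "2 * h (2 * k + 2) * (real N powr (real m * (real k + 2 + c)) / (2 * real m)) =
      (real N powr (- (real m * (2 * real k + 3 + c))) * real N powr (real m * (real k + 2 + c))) * G3"
    unfolding h2 using m by simp
  also have "real N powr (- (real m * (2 * real k + 3 + c))) * real N powr (real m * (real k + 2 + c))
     = real N powr (- (real m * (real k + 1)))"
    unfolding powr_add[symmetric] by (simp add: algebra_simps)
  finally have e: "cpoly (even_poly h (Suc k)) z =
     of_real (real N powr (- (real m * (real k + 1)))) * (of_real G3 * kernel_coeff m c k u + u ^ Suc k)"
    by (simp add: algebra_simps)
  have kS: "kernel_coeff m c (Suc k) u = (of_real G3 * kernel_coeff m c k u + u ^ Suc k) / of_real G4"
    by (simp only: kernel_coeff.simps G3_def G4_def)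
  have "cpoly (even_poly h (Suc k)) z / of_real (2 * h (2 * Suc k + 1)) =
     of_real (real N powr (- (real m * (real k + 1))) * G4 / (2 * h (2 * Suc k + 1))) * kernel_coeff m c (Suc k) u"
    unfolding e kS using G by simp
  also have "real N powr (- (real m * (real k + 1))) * G4 / (2 * h (2 * Suc k + 1)) =
     real N powr (- (real m * (real k + 1))) / (real N powr (- (real m * (2 * real k + 4 + c)))) / (2 * real m)"
    unfolding h3 using G by simp
  also have "real N powr (- (real m * (real k + 1))) / (real N powr (- (real m * (2 * real k + 4 + c))))
     = real N powr (real m * (real (Suc k) + 2 + c))"
    unfolding powr_diff[symmetric] by (simp add: algebra_simps)
  finally show ?case .
qed

subsection \<open>Decay of the coefficients\<close>

text \<open>Faster decay than any geometric sequence. For power series coefficients this is infinite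
  radius of convergence, in a form that passes easily through recursions and majorants.\<close>

definition rapid :: "(nat \<Rightarrow> 'a::real_normed_vector) \<Rightarrow> bool" where
  "rapid p \<longleftrightarrow> (\<forall>B>0. \<exists>M. \<forall>k. norm (p k) * B ^ k \<le> M)"

lemma rapid_bound:
  assumes "rapid p" "\<And>k. norm (q k) \<le> norm (p k)"
  shows "rapid q"
  unfolding rapid_def
proof (intro allI impI)
  fix B :: real assume B: "B > 0"
  then obtain M where M: "norm (p k) * B ^ k \<le> M" for k using assms(1) unfolding rapid_def by blast
  have "norm (q k) * B ^ k \<le> M" for k
    by (rule order_trans[OF mult_right_mono M]) (use B assms(2) in auto)
  then show "\<exists>M. \<forall>k. norm (q k) * B ^ k \<le> M" by blast
qed

lemma rapid_summable_norm:
  fixes x :: real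
  assumes "rapid p" "x \<ge> 0"
  shows "summable (\<lambda>k. norm (p k) * x ^ k)"
proof -
  \<comment> \<open>B exceeds 2x, so the bound at B yields the geometric majorant M (1/2)^n at x;
    the 1 keeps B positive for x = 0.\<close>
  define B where "B = 2 * x + 1"
  have B: "B > 0" using assms by (simp add: B_def)
  obtain M where M: "norm (p k) * B ^ k \<le> M" for k using assms B unfolding rapid_def by blast
  show ?thesis
  proof (rule summable_comparison_test')
    show "summable (\<lambda>k. M * (1 / 2) ^ k)" by (intro summable_mult summable_geometric) simp
    show "norm (norm (p n) * x ^ n) \<le> M * (1 / 2) ^ n" if "n \<ge> 0" for n
    proof -
      have "x ^ n \<le> (B / 2) ^ n" using assms by (intro power_mono) (auto simp: B_def)
      then have "norm (p n) * x ^ n \<le> norm (p n) * (B / 2) ^ n" by (intro mult_left_mono) auto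
      also have "\<dots> = norm (p n) * B ^ n * (1 / 2) ^ n" by (simp add: power_divide)
      also have "\<dots> \<le> M * (1 / 2) ^ n" by (intro mult_right_mono M) auto
      finally show ?thesis using assms by simp
    qed
  qed
qed

lemma rapid_summable:
  fixes p :: "nat \<Rightarrow> complex"
  assumes "rapid p"
  shows "summable (\<lambda>k. p k * x ^ k)"
proof (rule summable_norm_cancel)
  show "summable (\<lambda>k. norm (p k * x ^ k))"
    using rapid_summable_norm[OF assms, of "norm x"] by (simp add: norm_mult norm_power)
qed

text \<open>The factor is absorbed by k <= 2^k, at the price of doubling B. Such factors arise when
  t^(\<beta> + nk) is differentiated termwise.\<close>

lemma rapid_linear_mult:
  fixes p :: "nat \<Rightarrow> complex"
  assumes "rapid p"
  shows "rapid (\<lambda>k. of_real (\<alpha> + \<beta> * real k) * p k)"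
  unfolding rapid_def
proof (intro allI impI)
  fix B :: real assume B: "B > 0"
  then have "2 * B > 0" by simp
  then obtain M where M: "norm (p k) * (2 * B) ^ k \<le> M" for k using assms unfolding rapid_def by blast
  have "norm (of_real (\<alpha> + \<beta> * real k) * p k) * B ^ k \<le> (\<bar>\<alpha>\<bar> + \<bar>\<beta>\<bar>) * M" for k
  proof -
    have k: "real k \<le> 2 ^ k" using of_nat_less_two_power[of k, where 'a = real] by linarith
    have "norm (complex_of_real (\<alpha> + \<beta> * real k)) \<le> \<bar>\<alpha>\<bar> + \<bar>\<beta>\<bar> * real k"
      unfolding norm_of_real using abs_triangle_ineq[of \<alpha> "\<beta> * real k"] by (simp add: abs_mult)
    also have "\<dots> \<le> \<bar>\<alpha>\<bar> * 2 ^ k + \<bar>\<beta>\<bar> * 2 ^ k"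
      using k mult_left_mono[of 1 "2 ^ k" "\<bar>\<alpha>\<bar>"] by (intro add_mono mult_left_mono) auto
    finally have n: "norm (complex_of_real (\<alpha> + \<beta> * real k)) \<le> (\<bar>\<alpha>\<bar> + \<bar>\<beta>\<bar>) * 2 ^ k"
      by (simp add: algebra_simps)
    have "norm (of_real (\<alpha> + \<beta> * real k) * p k) * B ^ k \<le> ((\<bar>\<alpha>\<bar> + \<bar>\<beta>\<bar>) * 2 ^ k) * norm (p k) * B ^ k"
      unfolding norm_mult using n B by (intro mult_right_mono) auto
    also have "\<dots> = (\<bar>\<alpha>\<bar> + \<bar>\<beta>\<bar>) * (norm (p k) * (2 * B) ^ k)"
      by (simp add: power_mult_distrib)
    also have "\<dots> \<le> (\<bar>\<alpha>\<bar> + \<bar>\<beta>\<bar>) * M" by (intro mult_left_mono M) auto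
    finally show ?thesis .
  qed
  then show "\<exists>M. \<forall>k. norm (of_real (\<alpha> + \<beta> * real k) * p k) * B ^ k \<le> M" by blast
qed

lemma rapid_mult_power:
  fixes p :: "nat \<Rightarrow> complex"
  assumes "rapid p"
  shows "rapid (\<lambda>k. p k * x ^ k)"
  unfolding rapid_def
proof (intro allI impI)
  fix B :: real assume B: "B > 0"
  define C where "C = B * (norm x + 1)"
  have C: "C > 0" using B by (simp add: C_def add_nonneg_pos)
  obtain M where M: "norm (p k) * C ^ k \<le> M" for k using assms C unfolding rapid_def by blast
  have "norm (p k * x ^ k) * B ^ k \<le> M" for k
  proof -
    have "norm (p k * x ^ k) * B ^ k = norm (p k) * (B * norm x) ^ k"
      by (simp add: norm_mult norm_power power_mult_distrib)
    also have "\<dots> \<le> norm (p k) * C ^ k"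
      using B by (intro mult_left_mono power_mono) (auto simp: C_def)
    also note M
    finally show ?thesis .
  qed
  then show "\<exists>M. \<forall>k. norm (p k * x ^ k) * B ^ k \<le> M" by blast
qed

text \<open>Once \<delta> k B <= 1/2, a bound L >= M on E k B^k reproduces itself because (L + M)/2
  <= L; \<open>L\<close> therefore contains M besides the finitely many earlier terms. The source
  \<open>U\<close> accommodates \<open>kernel_coeff\<close>, whose recursion is
  inhomogeneous.\<close>

lemma rapid_recursion:
  fixes E U \<delta> :: "nat \<Rightarrow> real"
  assumes E: "\<And>k. E k \<ge> 0" and U: "rapid U" and \<delta>: "\<delta> \<longlonglongrightarrow> 0" "\<And>k. \<delta> k \<ge> 0"
    and rec: "\<And>k. E (Suc k) \<le> \<delta> k * (E k + U k)"
  shows "rapid E"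
  unfolding rapid_def
proof (intro allI impI)
  fix B :: real assume B: "B > 0"
  obtain M where M: "norm (U k) * B ^ k \<le> M" for k using U B unfolding rapid_def by blast
  have M0: "M \<ge> 0" using M[of 0] norm_ge_zero[of "U 0"] by simp
  have "eventually (\<lambda>k. \<delta> k < 1 / (2 * B)) sequentially"
    using \<delta>(1) B by (intro order_tendstoD) auto
  then obtain K where K: "\<And>k. k \<ge> K \<Longrightarrow> \<delta> k < 1 / (2 * B)" unfolding eventually_sequentially by blast
  define L where "L = (\<Sum>k\<le>K. E k * B ^ k) + M"
  have pos: "E k * B ^ k \<ge> 0" for k using E B by simp
  have "E k * B ^ k \<le> L" for k
  proof (cases "k \<le> K")
    case True
    then have "E k * B ^ k \<le> (\<Sum>k\<le>K. E k * B ^ k)"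
      by (intro member_le_sum) (use pos in auto)
    then show ?thesis using M0 by (simp add: L_def)
  next
    case False
    then have "K \<le> k" by simp
    then show ?thesis
    proof (induction k rule: dec_induct)
      case base
      have "E K * B ^ K \<le> (\<Sum>k\<le>K. E k * B ^ k)"
        by (rule member_le_sum) (use pos in auto)
      then show ?case using M0 by (simp add: L_def)
    next
      case (step k)
      have "E (Suc k) * B ^ Suc k \<le> \<delta> k * (E k + U k) * B ^ Suc k"
        using rec[of k] B by (intro mult_right_mono) auto
      also have "\<dots> = (\<delta> k * B) * (E k * B ^ k + U k * B ^ k)" by (simp add: algebra_simps)
      also have "\<dots> \<le> (\<delta> k * B) * (L + M)"
      proof (intro mult_left_mono add_mono step.IH)
        have "U k * B ^ k \<le> norm (U k) * B ^ k" using B by (intro mult_right_mono) auto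
        also note M
        finally show "U k * B ^ k \<le> M" .
      qed (use \<delta> B in auto)
      also have "\<dots> \<le> 1 / 2 * (L + M)"
      proof (intro mult_right_mono)
        have "\<delta> k * B \<le> 1 / (2 * B) * B" using K[of k] step.hyps B by (intro mult_right_mono) auto
        then show "\<delta> k * B \<le> 1 / 2" using B by simp
        have "L \<ge> 0" unfolding L_def using M0 pos by (intro add_nonneg_nonneg sum_nonneg) auto
        then show "0 \<le> L + M" using M0 by simp
      qed
      also have "\<dots> \<le> L"
      proof -
        have "(\<Sum>k\<le>K. E k * B ^ k) \<ge> 0" using pos by (intro sum_nonneg) auto
        then show ?thesis by (simp add: L_def)
      qed
      finally show ?case .
    qed
  qed
  then show "\<exists>M. \<forall>k. norm (E k) * B ^ k \<le> M" using E by auto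
qed

section \<open>Gamma quotients and majorants of the coefficients\<close>

lemma Gamma_ratio_pochhammer:
  fixes x :: real
  assumes "x > 0"
  shows "Gamma (x + real n) / Gamma x = pochhammer x n"
proof -
  have "x \<notin> \<int>\<^sub>\<le>\<^sub>0" using assms nonpos_Ints_nonpos[of x] by auto
  then show ?thesis using pochhammer_Gamma[of x n] by simp
qed

text \<open>The Gamma factor of \<open>moment\<close>, free of N. The values at even indices 2k are
  the denominators Gamma(2mk + m(1+c)) of the Mittag-Leffler series.\<close>

definition Gam :: "nat \<Rightarrow> real \<Rightarrow> nat \<Rightarrow> real" where
  "Gam m c j = Gamma (real m * (real j + 1 + c))"

lemma Gam_pos: "m \<ge> 1 \<Longrightarrow> c > -1 \<Longrightarrow> Gam m c j > 0"
  unfolding Gam_def by (intro Gamma_real_pos) auto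

lemma Gam_Suc:
  assumes "m \<ge> 1" "c > -1"
  shows "Gam m c (Suc j) = pochhammer (real m * (real j + 1 + c)) m * Gam m c j"
proof -
  have "real m * (real j + 1 + c) > 0" using assms by (intro mult_pos_pos) auto
  from Gamma_ratio_pochhammer[OF this, of m] Gam_pos[OF assms, of j]
  show ?thesis by (simp add: Gam_def field_simps)
qed

lemma kernel_coeff_Suc:
  "kernel_coeff m c (Suc k) u =
     (of_real (Gam m c (2 * k + 2)) * kernel_coeff m c k u + u ^ Suc k) / of_real (Gam m c (2 * k + 3))"
  by (simp add: Gam_def algebra_simps)

lemma pochhammer_ge_self:
  fixes x :: real
  assumes "x \<ge> 1" "m \<ge> 1"
  shows "x \<le> pochhammer x m"
proof -
  obtain n where n: "m = Suc n" using assms by (cases m) auto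
  have "pochhammer (x + 1) n \<ge> 1"
    unfolding pochhammer_prod using assms by (intro prod_ge_1) auto
  then have "x * 1 \<le> x * pochhammer (x + 1) n" using assms by (intro mult_left_mono) auto
  then show ?thesis by (simp add: n pochhammer_rec)
qed

text \<open>The index is shifted by one because the argument m(j+2+c) is then at least j+1; in the
  very first quotient the argument m(1+c) can be arbitrarily small.\<close>

lemma Gam_ratio:
  assumes "m \<ge> 1" "c > -1"
  shows "Gam m c (Suc j) / Gam m c (Suc (Suc j)) \<le> 1 / (real j + 1)"
proof -
  define x where "x = real m * (real (Suc j) + 1 + c)"
  have "1 * (real j + 1) \<le> real m * (real (Suc j) + 1 + c)"
    using assms by (intro mult_mono) auto
  then have x: "x \<ge> real j + 1" by (simp add: x_def)
  have p: "x \<le> pochhammer x m" using x assms by (intro pochhammer_ge_self) auto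
  have G: "Gam m c (Suc j) > 0" using Gam_pos assms by blast
  have "Gam m c (Suc j) / Gam m c (Suc (Suc j)) = 1 / pochhammer x m"
    unfolding Gam_Suc[OF assms, of "Suc j"] using G by (simp add: x_def)
  also have "\<dots> \<le> 1 / (real j + 1)" using p x by (intro divide_left_mono mult_pos_pos) auto
  finally show ?thesis .
qed

lemma rapid_inverse_Gam:
  assumes m: "m \<ge> 1" and c: "c > -1"
  shows "rapid (\<lambda>k. 1 / Gam m c (2 * k))"
proof (rule rapid_recursion[where U = "\<lambda>_. 0" and \<delta> = "\<lambda>k. Gam m c (2 * k) / Gam m c (2 * k + 2)"])
  show "1 / Gam m c (2 * k) \<ge> 0" "Gam m c (2 * k) / Gam m c (2 * k + 2) \<ge> 0" for k
    using Gam_pos[OF m c] by (auto simp: less_imp_le)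
  show "rapid (\<lambda>_. 0 :: real)" by (auto simp: rapid_def)
  show "1 / Gam m c (2 * Suc k) \<le> Gam m c (2 * k) / Gam m c (2 * k + 2) * (1 / Gam m c (2 * k) + 0)" for k
    using Gam_pos[OF m c, of "2 * k"] by simp
  show "(\<lambda>k. Gam m c (2 * k) / Gam m c (2 * k + 2)) \<longlonglongrightarrow> 0"
  proof (rule Lim_null_comparison)
    have ev: "Gam m c (2 * Suc k) / Gam m c (2 * Suc k + 2) \<le> 1 / (real k + 1)" for k
    proof -
      have "Gam m c (2 * Suc k) / Gam m c (2 * Suc k + 2) =
         (Gam m c (Suc (2 * k + 1)) / Gam m c (Suc (Suc (2 * k + 1)))) *
         (Gam m c (Suc (2 * k + 2)) / Gam m c (Suc (Suc (2 * k + 2))))"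
        using Gam_pos[OF m c, of "2 * k + 3"] by (simp add: numeral_3_eq_3 numeral_2_eq_2)
      also have "\<dots> \<le> (1 / (real (2 * k + 1) + 1)) * (1 / (real (2 * k + 2) + 1))"
        using Gam_pos[OF m c] by (intro mult_mono Gam_ratio m c) (auto simp: less_imp_le)
      also have "\<dots> \<le> 1 / (real k + 1) * 1"
        by (intro mult_mono divide_left_mono) auto
      finally show ?thesis by simp
    qed
    \<comment> \<open>The term k = 0 contains \<open>Gam m c 0\<close>, to which
      \<open>Gam_ratio\<close> does not apply, so the bound starts at 1.\<close>
    show "eventually (\<lambda>k. norm (Gam m c (2 * k) / Gam m c (2 * k + 2)) \<le> 1 / real k) sequentially"
      unfolding eventually_sequentially
    proof (intro exI[of _ 1] allI impI)
      fix n :: nat assume "n \<ge> 1"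
      then obtain k where n: "n = Suc k" by (cases n) auto
      show "norm (Gam m c (2 * n) / Gam m c (2 * n + 2)) \<le> 1 / real n"
        using ev[of k] Gam_pos[OF m c, of "2 * n"] Gam_pos[OF m c, of "2 * n + 2"] unfolding n
        by (simp add: add.commute)
    qed
    show "(\<lambda>k. 1 / real k) \<longlonglongrightarrow> 0" by (rule lim_1_over_n)
  qed
qed

lemma rapid_mult_power_real:
  fixes p :: "nat \<Rightarrow> real"
  assumes "rapid p"
  shows "rapid (\<lambda>k. p k * x ^ k)"
proof -
  have "rapid (\<lambda>k. complex_of_real (p k))" using assms by (simp add: rapid_def)
  from rapid_mult_power[OF this, of "of_real x"] show ?thesis
    unfolding rapid_def by (simp add: norm_mult norm_power abs_mult power_abs)
qed

text \<open>E solves the recursion of \<open>kernel_coeff\<close> with |u| replaced by R. A single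
  majorant on the whole disc is what the M-test for the scaling limit requires.\<close>

lemma kernel_coeff_bound:
  assumes m: "m \<ge> 1" and c: "c > -1" and R: "R \<ge> 0"
  obtains E :: "nat \<Rightarrow> real" where "rapid E" "\<And>k u. norm u \<le> R \<Longrightarrow> norm (kernel_coeff m c k u) \<le> E k"
proof -
  define r where "r k = Gam m c (2 * k + 2) / Gam m c (2 * k + 3)" for k
  define U where "U k = R ^ Suc k / Gam m c (2 * k + 2)" for k
  define E where "E = rec_nat (1 / Gam m c 1) (\<lambda>k e. r k * (e + U k))"
  have E0: "E 0 = 1 / Gam m c 1" and ES: "E (Suc k) = r k * (E k + U k)" for k
    by (simp_all add: E_def)
  have G: "Gam m c j > 0" for j by (rule Gam_pos[OF m c])
  have r: "r k > 0" for k unfolding r_def using G by simp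
  have U: "U k \<ge> 0" for k unfolding U_def using G R by (simp add: less_imp_le)
  have Enn: "E k \<ge> 0" for k
    by (induction k) (use G r U in \<open>auto simp: E0 ES less_imp_le\<close>)
  have "rapid E"
  proof (rule rapid_recursion[where U = U and \<delta> = r])
    show "rapid U"
    proof -
      have "rapid (\<lambda>k. 1 / Gam m c (2 * k) * R ^ k)"
        by (rule rapid_mult_power_real[OF rapid_inverse_Gam[OF m c]])
      then have *: "rapid (\<lambda>k. R ^ k / Gam m c (2 * k))" by simp
      show ?thesis unfolding rapid_def
      proof (intro allI impI)
        fix B :: real assume B: "B > 0"
        then obtain M where M: "norm (R ^ k / Gam m c (2 * k)) * B ^ k \<le> M" for k
          using * unfolding rapid_def by blast
        have "norm (U k) * B ^ k \<le> M / B" for k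
          using M[of "Suc k"] B by (simp add: U_def field_simps)
        then show "\<exists>M. \<forall>k. norm (U k) * B ^ k \<le> M" by blast
      qed
    qed
    show "r \<longlonglongrightarrow> 0"
    proof (rule Lim_null_comparison)
      show "(\<lambda>k. 1 / real (Suc k)) \<longlonglongrightarrow> 0" by (rule LIMSEQ_Suc[OF lim_1_over_n])
      have "norm (r k) \<le> 1 / real (Suc k)" for k
      proof -
        have "r k \<le> 1 / (real (2 * k + 1) + 1)"
          using Gam_ratio[OF m c, of "2 * k + 1"] by (simp add: r_def numeral_3_eq_3 numeral_2_eq_2)
        also have "\<dots> \<le> 1 / real (Suc k)" by (intro divide_left_mono) auto
        finally show ?thesis using r[of k] by simp
      qed
      then show "eventually (\<lambda>k. norm (r k) \<le> 1 / real (Suc k)) sequentially" by simp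
    qed
  qed (use Enn r ES in \<open>auto simp: less_imp_le\<close>)
  moreover have "norm (kernel_coeff m c k u) \<le> E k" if u: "norm u \<le> R" for k u
  proof (induction k)
    case 0
    then show ?case using G[of 1] by (simp add: E0 Gam_def norm_divide)
  next
    case (Suc k)
    have "norm (of_real (Gam m c (2 * k + 2)) * kernel_coeff m c k u + u ^ Suc k) \<le>
       Gam m c (2 * k + 2) * norm (kernel_coeff m c k u) + norm u ^ Suc k"
      using norm_triangle_ineq[of "of_real (Gam m c (2 * k + 2)) * kernel_coeff m c k u" "u ^ Suc k"] G[of "2 * k + 2"]
      by (simp add: norm_mult norm_power)
    also have "\<dots> \<le> Gam m c (2 * k + 2) * E k + R ^ Suc k"
      using G[of "2 * k + 2"] Suc.IH u by (intro add_mono mult_left_mono power_mono) auto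
    also have "\<dots> = Gam m c (2 * k + 3) * E (Suc k)"
      using G[of "2 * k + 2"] G[of "2 * k + 3"] by (simp add: ES r_def U_def field_simps)
    finally show ?case
      unfolding kernel_coeff_Suc norm_divide using G[of "2 * k + 3"]
      by (simp add: divide_le_eq mult.commute)
  qed
  ultimately show ?thesis using that by blast
qed

lemma rapid_kernel_coeff:
  assumes "m \<ge> 1" "c > -1"
  shows "rapid (\<lambda>k. kernel_coeff m c k u)"
proof -
  obtain E where E: "rapid E" "\<And>k v. norm v \<le> norm u \<Longrightarrow> norm (kernel_coeff m c k v) \<le> E k"
    using kernel_coeff_bound[OF assms, of "norm u"] by auto
  show ?thesis
    by (rule rapid_bound[OF E(1)]) (use E(2) order_trans abs_ge_self in \<open>fastforce\<close>)
qed

subsection \<open>The inhomogeneous equation\<close>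

lemma powr_series_has_vector_derivative:
  fixes p :: "nat \<Rightarrow> complex" and t \<beta> :: real
  assumes p: "rapid p" and t: "t > 0"
  shows "((\<lambda>t. of_real (t powr \<beta>) * (\<Sum>k. p k * of_real t ^ (n * k))) has_vector_derivative
     of_real (t powr (\<beta> - 1)) * (\<Sum>k. of_real (\<beta> + real (n * k)) * p k * of_real t ^ (n * k))) (at t)"
proof -
  define P where "P u = (\<Sum>k. p k * u ^ k)" for u :: complex
  define u where "u = complex_of_real t ^ n"
  have sp: "summable (\<lambda>k. p k * x ^ k)" for x by (rule rapid_summable[OF p])
  have "DERIV P u :> (\<Sum>k. diffs p k * u ^ k)"
    unfolding P_def by (rule termdiffs_strong_converges_everywhere) (rule sp)
  then have D: "(P has_field_derivative (\<Sum>k. diffs p k * u ^ k)) (at (of_real t ^ n))" by (simp add: u_def)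
  have sk: "summable (\<lambda>k. of_nat k * p k * x ^ k)" for x
    using rapid_summable[OF rapid_linear_mult[OF p, of 0 1], of x] by simp
  \<comment> \<open>Multiplying by u restores the index lost by differentiation. For n > 0 the
    factor u = t^n is supplied by t^\<beta> t^(n-1) = t^(\<beta>-1) t^n.\<close>
  have shift: "u * (\<Sum>k. diffs p k * u ^ k) = (\<Sum>k. of_nat k * p k * u ^ k)"
  proof -
    have sd: "summable (\<lambda>k. diffs p k * u ^ k)"
      by (rule termdiff_converges_all) (rule sp)
    have "(\<Sum>k. of_nat k * p k * u ^ k) = (\<Sum>k. of_nat (Suc k) * p (Suc k) * u ^ Suc k)"
      using suminf_split_head[OF sk[of u]] by simp
    also have "\<dots> = (\<Sum>k. u * (diffs p k * u ^ k))"
      by (intro suminf_cong) (simp add: diffs_def algebra_simps)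
    also have "\<dots> = u * (\<Sum>k. diffs p k * u ^ k)" by (rule suminf_mult[OF sd])
    finally show ?thesis ..
  qed
  have "((\<lambda>t. P (of_real t ^ n)) has_vector_derivative
      (of_nat n * of_real t ^ (n - 1)) * (\<Sum>k. diffs p k * u ^ k)) (at t)"
  proof -
    have "((\<lambda>t. of_real t ^ n) has_vector_derivative of_nat n * complex_of_real t ^ (n - 1)) (at t)"
      by (rule has_vector_derivative_real_field) (auto intro!: derivative_eq_intros)
    from field_vector_diff_chain_at[OF this D] show ?thesis by (simp add: o_def)
  qed
  moreover have "((\<lambda>t. complex_of_real (t powr \<beta>)) has_vector_derivative of_real (\<beta> * t powr (\<beta> - 1))) (at t)"
    using t by (intro has_vector_derivative_of_real) (auto intro!: derivative_eq_intros simp flip: has_real_derivative_iff_has_vector_derivative)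
  ultimately have "((\<lambda>t. of_real (t powr \<beta>) * P (of_real t ^ n)) has_vector_derivative
      of_real (t powr \<beta>) * ((of_nat n * of_real t ^ (n - 1)) * (\<Sum>k. diffs p k * u ^ k)) +
      of_real (\<beta> * t powr (\<beta> - 1)) * P (of_real t ^ n)) (at t)"
    by (intro has_vector_derivative_mult)
  also have "of_real (t powr \<beta>) * ((of_nat n * of_real t ^ (n - 1)) * (\<Sum>k. diffs p k * u ^ k)) +
      of_real (\<beta> * t powr (\<beta> - 1)) * P (of_real t ^ n) =
      of_real (t powr (\<beta> - 1)) * (of_nat n * (\<Sum>k. of_nat k * p k * u ^ k) + of_real \<beta> * P u)"
  proof -
    have "t powr \<beta> = t powr (\<beta> - 1) * t" using t by (simp add: powr_mult_base mult.commute)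
    moreover have nu: "of_nat n * of_real t * complex_of_real t ^ (n - 1) = of_nat n * u"
      by (cases n) (auto simp: u_def)
    ultimately have "of_real (t powr \<beta>) * ((of_nat n * of_real t ^ (n - 1)) * S) =
      of_real (t powr (\<beta> - 1)) * ((of_nat n * of_real t * complex_of_real t ^ (n - 1)) * S)" for S
      by (simp add: mult_ac)
    then have "of_real (t powr \<beta>) * ((of_nat n * of_real t ^ (n - 1)) * (\<Sum>k. diffs p k * u ^ k)) =
      of_real (t powr (\<beta> - 1)) * (of_nat n * (u * (\<Sum>k. diffs p k * u ^ k)))"
      unfolding nu by (simp only: mult.assoc)
    then show ?thesis unfolding shift by (simp add: algebra_simps u_def)
  qed
  also have "of_nat n * (\<Sum>k. of_nat k * p k * u ^ k) + of_real \<beta> * P u =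
     (\<Sum>k. of_real (\<beta> + real (n * k)) * p k * of_real t ^ (n * k))"
    unfolding P_def suminf_mult[OF sk, symmetric] suminf_mult[OF sp, symmetric]
    by (subst suminf_add[OF summable_mult[OF sk] summable_mult[OF sp]])
       (intro suminf_cong, simp add: u_def power_mult[symmetric] algebra_simps)
  finally show ?thesis by (simp add: P_def power_mult)
qed

lemma powr_series_continuous_on:
  fixes p :: "nat \<Rightarrow> complex"
  assumes p: "rapid p" and \<beta>: "\<beta> > 0"
  shows "continuous_on {0..} (\<lambda>t. of_real (t powr \<beta>) * (\<Sum>k. p k * of_real t ^ (n * k)))"
proof -
  have "continuous_on UNIV (\<lambda>u. \<Sum>k. p k * u ^ k)"
    by (intro DERIV_continuous_on[where D = "\<lambda>u. \<Sum>k. diffs p k * u ^ k"] 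
        termdiffs_strong_converges_everywhere rapid_summable[OF p])
  then have "continuous_on {0..} (\<lambda>t::real. \<Sum>k. p k * (of_real t ^ n) ^ k)"
    by (rule continuous_on_compose2) (auto intro!: continuous_intros)
  then show ?thesis unfolding power_mult
    by (intro continuous_intros continuous_on_powr') (use \<beta> in auto)
qed

text \<open>For a < 0 the integrand can be unbounded at 0; it is dominated by a multiple of t^a, as
  the continuous factor is bounded on [0,1].\<close>

lemma set_integrable_powr_mult:
  fixes f :: "real \<Rightarrow> complex"
  assumes a: "a > -1" and f: "continuous_on {0..1} f"
  shows "set_integrable lborel {0..1} (\<lambda>t. f t * of_real (t powr a))"
proof -
  have "(\<lambda>t. t powr a) integrable_on {0..1::real}"
    using has_integral_powr_from_0[OF a, of 1] by (auto simp: integrable_on_def)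
  then have "(\<lambda>t. t powr a) absolutely_integrable_on {0..1::real}"
    by (rule nonnegative_absolutely_integrable_1) auto
  then have I: "set_integrable lborel {0..1} (\<lambda>t. t powr a)"
    unfolding set_integrable_def by (subst (asm) integrable_completion) auto
  have "bounded (f ` {0..1})" by (intro compact_imp_bounded compact_continuous_image f) simp
  then obtain C where C: "\<forall>t\<in>{0..1}. norm (f t) \<le> C" unfolding bounded_iff by auto
  have fm: "(\<lambda>t. indicator {0..1} t *\<^sub>R f t) \<in> borel_measurable borel"
    by (rule borel_measurable_continuous_on_indicator) (use f in auto)
  show ?thesis unfolding set_integrable_def
  proof (rule Bochner_Integration.integrable_bound)
    show "integrable lborel (\<lambda>t. C * (indicator {0..1} t *\<^sub>R t powr a))"
      using I unfolding set_integrable_def by (rule integrable_mult_right)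
    have "(\<lambda>t. (indicator {0..1} t *\<^sub>R f t) * of_real (t powr a)) \<in> borel_measurable borel"
      using fm by measurable
    then show "(\<lambda>t. indicator {0..1} t *\<^sub>R (f t * complex_of_real (t powr a))) \<in> borel_measurable lborel"
      by simp
    show "AE t in lborel. norm (indicator {0..1} t *\<^sub>R (f t * complex_of_real (t powr a))) \<le>
        norm (C * (indicator {0..1} t *\<^sub>R t powr a))"
    proof (rule AE_I2)
      fix t :: real
      show "norm (indicator {0..1} t *\<^sub>R (f t * complex_of_real (t powr a))) \<le>
        norm (C * (indicator {0..1} t *\<^sub>R t powr a))"
      proof (cases "t \<in> {0..1}")
        case True
        then have "norm (f t) \<le> \<bar>C\<bar>" using C by force
        then show ?thesis using True by (simp add: norm_mult abs_mult mult_right_mono)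
      qed simp
    qed
  qed
qed

text \<open>With \<open>V i\<close> the \<open>i\<close>-th derivative of the series solution along the ray through \<open>z\<close>, the system for \<open>N\<close>
  is the adjoint one: all terms of the derivative of \<open>\<Sum>i<m. V i * N i\<close> cancel except the inhomogeneity.\<close>

lemma adjoint_system_integral:
  fixes z w :: complex and N :: "nat \<Rightarrow> real \<Rightarrow> complex"
  assumes m: "m \<ge> 1" and c: "c > -1"
  defines "a \<equiv> real m * (1 + c) - 1"
  assumes N0: "\<And>t. 0 < t \<Longrightarrow> t < 1 \<Longrightarrow>
      (N 0 has_vector_derivative - (z * (of_real t * z) ^ m) * N (m - 1) t) (at t)"
    and NS: "\<And>i t. Suc i < m \<Longrightarrow> 0 < t \<Longrightarrow> t < 1 \<Longrightarrow>
      (N (Suc i) has_vector_derivative - z * N i t) (at t)"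
    and cont: "\<And>i. i < m \<Longrightarrow> continuous_on {0..1} (N i)"
    and N1: "\<And>i. i < m \<Longrightarrow> N i 1 = (if i = 0 then 1 else 0)"
  shows "((\<lambda>t. z * N (m - 1) t * (of_real (t powr a) * mittag_leffler (2 * real m) (real m * (1 + c)) ((of_real t * z * w) ^ (2 * m))))
     has_integral z ^ m * (\<Sum>k. kernel_coeff m c k (w ^ (2 * m)) * z ^ (2 * m * k))) {0..1}"
proof -
  define e where "e k = kernel_coeff m c k (w ^ (2 * m))" for k
  define G where "G = Gam m c"
  have Gp: "G j > 0" for j unfolding G_def by (rule Gam_pos[OF m c])
  \<comment> \<open>The product is the falling factorial produced by i derivatives of t^(m + a +
    2mk).\<close>
  define p where "p i k = e k * z ^ (2 * m * k) * of_real (\<Prod>r<i. real m + a - real r + real (2 * m * k))" for i k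
  have p0: "rapid (p 0)"
  proof -
    have "rapid (\<lambda>k. e k * (z ^ (2 * m)) ^ k)"
      unfolding e_def by (intro rapid_mult_power rapid_kernel_coeff m c)
    moreover have "p 0 = (\<lambda>k. e k * (z ^ (2 * m)) ^ k)" by (rule ext) (simp add: p_def power_mult)
    ultimately show ?thesis by simp
  qed
  have pS: "p (Suc i) k = of_real ((real m + a - real i) + real (2 * m * k)) * p i k" for i k
    by (simp add: p_def algebra_simps)
  have rp: "rapid (p i)" for i
  proof (induction i)
    case 0
    then show ?case by (rule p0)
  next
    case (Suc i)
    have "p (Suc i) = (\<lambda>k. of_real ((real m + a - real i) + real (2 * m) * real k) * p i k)"
      by (rule ext) (simp add: pS)
    then show ?case by (simp only:) (rule rapid_linear_mult[OF Suc])
  qed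
  \<comment> \<open>\<open>V 0\<close> is the series at the point tz, without the factor z^a. A
    derivative in the complex variable lowers the power of z by one, hence z^(m-i), and d/dt of
    \<open>V i\<close> is z times \<open>V (Suc i)\<close>.\<close>
  define V where "V i t = of_real (t powr (real m + a - real i)) * (\<Sum>k. p i k * of_real t ^ (2 * m * k)) * z ^ (m - i)"
    for i and t :: real
  have am: "a > -1" using m c by (simp add: a_def)
  have V': "(V i has_vector_derivative z * V (Suc i) t) (at t)" if "t > 0" "i < m" for i t
  proof -
    have "m - i = Suc (m - Suc i)" using that by simp
    then have "z * V (Suc i) t = of_real (t powr (real m + a - real i - 1)) *
       (\<Sum>k. of_real (real m + a - real i + real (2 * m * k)) * p i k * of_real t ^ (2 * m * k)) * z ^ (m - i)"
      by (simp add: V_def pS algebra_simps)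
    moreover have "(V i has_vector_derivative of_real (t powr (real m + a - real i - 1)) *
       (\<Sum>k. of_real (real m + a - real i + real (2 * m * k)) * p i k * of_real t ^ (2 * m * k)) * z ^ (m - i)) (at t)"
      unfolding V_def by (intro has_vector_derivative_mult_left powr_series_has_vector_derivative rp that)
    ultimately show ?thesis by simp
  qed
  have Vc: "continuous_on {0..1} (V i)" if "i < m" for i
  proof -
    have "real m + a - real i > 0" using that am by linarith
    from powr_series_continuous_on[OF rp this, of i "2 * m"]
    have "continuous_on {0..1} (\<lambda>t. complex_of_real (t powr (real m + a - real i)) * (\<Sum>k. p i k * of_real t ^ (2 * m * k)))"
      by (rule continuous_on_subset) auto
    then show ?thesis unfolding V_def by (rule continuous_on_mult[OF _ continuous_on_const])
  qed
  \<comment> \<open>The inhomogeneous equation of order m. The falling factorial of length m is a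
    quotient of consecutive values of \<open>Gam\<close>, which brings in the recursion of
    \<open>kernel_coeff\<close>: its homogeneous part gives (tz)^m V 0, its source the
    Mittag-Leffler series, and its initial value the constant term of that series.\<close>
  have Vm: "V m t = (of_real t * z) ^ m * V 0 t +
      of_real (t powr a) * mittag_leffler (2 * real m) (real m * (1 + c)) ((of_real t * z * w) ^ (2 * m))"
    if "t > 0" for t
  proof -
    define X where "X = (of_real t * z) ^ (2 * m)"
    have Xk: "(complex_of_real t) ^ (2 * m * k) * z ^ (2 * m * k) = X ^ k" for k
      by (simp add: X_def power_mult power_mult_distrib)
    have pm: "p m k * of_real t ^ (2 * m * k) = e k * of_real (G (2 * k + 1) / G (2 * k)) * X ^ k" for k
    proof -
      have "(\<Prod>r<m. real m + a - real r + real (2 * m * k)) = (\<Prod>r<m. (real m * (real (2 * k) + 1 + c)) + real (m - Suc r))"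
        by (intro prod.cong) (auto simp: a_def of_nat_diff algebra_simps)
      also have "\<dots> = (\<Prod>r<m. (real m * (real (2 * k) + 1 + c)) + real r)"
        by (rule prod.nat_diff_reindex)
      also have "\<dots> = pochhammer (real m * (real (2 * k) + 1 + c)) m"
        by (simp add: pochhammer_prod atLeast0LessThan)
      also have "\<dots> = G (2 * k + 1) / G (2 * k)"
        using Gam_Suc[OF m c, of "2 * k"] Gp[of "2 * k"] by (simp add: G_def)
      finally show ?thesis unfolding p_def Xk[symmetric] by (simp add: algebra_simps)
    qed
    have ml: "mittag_leffler (2 * real m) (real m * (1 + c)) ((of_real t * z * w) ^ (2 * m)) =
       (\<Sum>k. (w ^ (2 * m)) ^ k / of_real (G (2 * k)) * X ^ k)"
      unfolding mittag_leffler_def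
      by (intro suminf_cong) (simp add: G_def Gam_def X_def power_mult_distrib algebra_simps)
    have eS: "e (Suc k) * of_real (G (2 * Suc k + 1) / G (2 * Suc k)) = e k + (w ^ (2 * m)) ^ Suc k / of_real (G (2 * Suc k))" for k
      using Gp[of "2 * k + 2"] Gp[of "2 * k + 3"] unfolding e_def kernel_coeff_Suc G_def[symmetric]
      by (simp add: field_simps numeral_3_eq_3)
    have e0: "e 0 * of_real (G 1 / G 0) = 1 / of_real (G 0)"
      using Gp[of 0] Gp[of 1] by (simp add: e_def G_def Gam_def)
    have s1: "summable (\<lambda>k. p m k * of_real t ^ (2 * m * k))"
      using rapid_summable[OF rp[of m], of "of_real t ^ (2 * m)"] by (simp add: power_mult)
    have s2: "summable (\<lambda>k. e k * X ^ k)"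
      unfolding e_def by (intro rapid_summable rapid_kernel_coeff m c)
    have s3: "summable (\<lambda>k. (w ^ (2 * m)) ^ k / of_real (G (2 * k)) * X ^ k)"
    proof -
      have "rapid (\<lambda>k. complex_of_real (1 / Gam m c (2 * k)))"
        using rapid_inverse_Gam[OF m c] by (simp add: rapid_def norm_divide)
      from rapid_summable[OF rapid_mult_power[OF this, of "w ^ (2 * m)"], of X]
      show ?thesis by (simp add: G_def)
    qed
    have S0: "(\<Sum>k. p 0 k * of_real t ^ (2 * m * k)) = (\<Sum>k. e k * X ^ k)"
      unfolding p_def Xk[symmetric] by (simp add: algebra_simps)
    have "(\<Sum>k. p m k * of_real t ^ (2 * m * k)) =
       p m 0 + (\<Sum>k. p m (Suc k) * of_real t ^ (2 * m * Suc k))"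
      using suminf_split_head[OF s1] by simp
    also have "p m 0 = 1 / of_real (G 0)"
      using pm[of 0] e0 by simp
    also have "(\<Sum>k. p m (Suc k) * of_real t ^ (2 * m * Suc k)) =
        (\<Sum>k. X * (e k * X ^ k) + (w ^ (2 * m)) ^ Suc k / of_real (G (2 * Suc k)) * X ^ Suc k)"
      unfolding pm eS by (intro suminf_cong) (simp add: algebra_simps)
    also have "\<dots> = X * (\<Sum>k. e k * X ^ k) + (\<Sum>k. (w ^ (2 * m)) ^ Suc k / of_real (G (2 * Suc k)) * X ^ Suc k)"
    proof -
      have "summable (\<lambda>k. (w ^ (2 * m)) ^ Suc k / of_real (G (2 * Suc k)) * X ^ Suc k)"
        using summable_Suc_iff[of "\<lambda>k. (w ^ (2 * m)) ^ k / of_real (G (2 * k)) * X ^ k"] s3 by blast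
      from suminf_add[OF summable_mult[OF s2, of X] this] show ?thesis
        unfolding suminf_mult[OF s2] by simp
    qed
    also have "(\<Sum>k. (w ^ (2 * m)) ^ Suc k / of_real (G (2 * Suc k)) * X ^ Suc k) =
        (\<Sum>k. (w ^ (2 * m)) ^ k / of_real (G (2 * k)) * X ^ k) - 1 / of_real (G 0)"
      using suminf_split_head[OF s3] by simp
    finally have S: "(\<Sum>k. p m k * of_real t ^ (2 * m * k)) = X * (\<Sum>k. e k * X ^ k) +
        mittag_leffler (2 * real m) (real m * (1 + c)) ((of_real t * z * w) ^ (2 * m))"
      unfolding ml by (simp add: algebra_simps)
    have "t powr (real m + a) = t ^ m * t powr a"
      using that by (simp add: powr_add powr_realpow)
    then have "(of_real t * z) ^ m * V 0 t = of_real (t powr a) * (X * (\<Sum>k. e k * X ^ k))"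
      unfolding V_def S0 X_def
      by (simp add: power_mult_distrib power2_eq_square power_even_eq mult_2 power_add)
    then show ?thesis unfolding V_def S by (simp add: algebra_simps)
  qed
  define D where "D t = (\<Sum>i<m. V i t * N i t)" for t
  obtain n where n: "m = Suc n" using m by (cases m) auto
  have "((\<lambda>t. z * N (m - 1) t * (of_real (t powr a) * mittag_leffler (2 * real m) (real m * (1 + c)) ((of_real t * z * w) ^ (2 * m))))
     has_integral D 1 - D 0) {0..1}"
  \<comment> \<open>The integrand may blow up like t^a at 0, so \<open>D\<close> is differentiated
    only in the open interval and is merely continuous at the ends.\<close>
  proof (rule fundamental_theorem_of_calculus_interior)
    show "continuous_on {0..1} D" unfolding D_def by (intro continuous_intros Vc cont) auto
    fix t :: real assume t: "t \<in> {0<..<1}"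
    define dN where "dN i = (case i of 0 \<Rightarrow> - (z * (of_real t * z) ^ m) * N (m - 1) t | Suc j \<Rightarrow> - z * N j t)" for i
    have "(D has_vector_derivative (\<Sum>i<m. V i t * dN i + z * V (Suc i) t * N i t)) (at t)"
      unfolding D_def
    proof (rule has_vector_derivative_sum)
      fix i assume "i \<in> {..<m}"
      then have i: "i < m" by simp
      have "(N i has_vector_derivative dN i) (at t)"
        unfolding dN_def using N0[of t] NS[of _ t] t i by (cases i) auto
      then show "((\<lambda>t. V i t * N i t) has_vector_derivative V i t * dN i + z * V (Suc i) t * N i t) (at t)"
        using t i by (intro has_vector_derivative_mult V') auto
    qed
    also have "(\<Sum>i<m. V i t * dN i + z * V (Suc i) t * N i t) = z * N (m - 1) t * (V m t - (of_real t * z) ^ m * V 0 t)"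
    proof -
      have s1: "(\<Sum>i<m. V i t * dN i) = V 0 t * (- (z * (of_real t * z) ^ m) * N n t) + (\<Sum>i<n. V (Suc i) t * (- z * N i t))"
        unfolding n sum.lessThan_Suc_shift by (simp add: dN_def n)
      have s2: "(\<Sum>i<m. z * V (Suc i) t * N i t) = (\<Sum>i<n. z * V (Suc i) t * N i t) + z * V m t * N n t"
        unfolding n by simp
      have s3: "(\<Sum>i<n. V (Suc i) t * (- z * N i t)) = - (\<Sum>i<n. z * V (Suc i) t * N i t)"
        unfolding sum_negf[symmetric] by (intro sum.cong) (auto simp: algebra_simps)
      show ?thesis unfolding sum.distrib s1 s2 s3 by (simp add: n algebra_simps)
    qed
    also have "V m t - (of_real t * z) ^ m * V 0 t = of_real (t powr a) *
        mittag_leffler (2 * real m) (real m * (1 + c)) ((of_real t * z * w) ^ (2 * m))"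
      using Vm[of t] t by simp
    finally show "(D has_vector_derivative z * N (m - 1) t * (of_real (t powr a) *
        mittag_leffler (2 * real m) (real m * (1 + c)) ((of_real t * z * w) ^ (2 * m)))) (at t)" .
  qed simp
  moreover have "D 0 = 0" unfolding D_def V_def by simp
  moreover have "D 1 = z ^ m * (\<Sum>k. e k * z ^ (2 * m * k))"
  proof -
    have "D 1 = (\<Sum>i<m. if i = 0 then V 0 1 else 0)" unfolding D_def by (intro sum.cong) (auto simp: N1)
    also have "\<dots> = V 0 1" using m by simp
    also have "\<dots> = z ^ m * (\<Sum>k. e k * z ^ (2 * m * k))" by (simp add: V_def p_def)
    finally show ?thesis .
  qed
  ultimately show ?thesis by (simp add: e_def)
qed

subsection \<open>Wronskians\<close>

text \<open>Rows are given as a function so that replacing a row becomes a function update, the form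
  suited to the row-wise product rule.\<close>

definition rowdet :: "nat \<Rightarrow> (nat \<Rightarrow> nat \<Rightarrow> complex) \<Rightarrow> complex" where
  "rowdet n \<rho> = Determinant.det (Matrix.mat n n (\<lambda>(r, k). \<rho> r k))"

lemma rowdet_cong:
  "(\<And>r k. r < n \<Longrightarrow> k < n \<Longrightarrow> \<rho> r k = \<rho>' r k) \<Longrightarrow> rowdet n \<rho> = rowdet n \<rho>'"
  unfolding rowdet_def by (intro arg_cong[where f = Determinant.det] eq_matI) auto

lemma rowdet_altdef:
  "rowdet n \<rho> = (\<Sum>p\<in>{p. p permutes {0..<n}}. signof p * (\<Prod>i=0..<n. \<rho> i (p i)))"
  unfolding rowdet_def
  by (subst det_def'[of _ n]) (auto intro!: sum.cong prod.cong simp: permutes_in_image)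

lemma rowdet_identical_rows:
  assumes "i < n" "j < n" "i \<noteq> j" "\<And>k. k < n \<Longrightarrow> \<rho> i k = \<rho> j k"
  shows "rowdet n \<rho> = 0"
  unfolding rowdet_def using assms
  by (intro Determinant.det_identical_rows[where n = n and i = i and j = j] eq_vecI) auto

lemma rowdet_scale_row:
  assumes "i < n"
  shows "rowdet n (\<rho>(i := \<lambda>k. a * v k)) = a * rowdet n (\<rho>(i := v))"
proof -
  have eq: "Matrix.mat n n (\<lambda>(r, k). (\<rho>(i := \<lambda>k. a * v k)) r k) = multrow i a (Matrix.mat n n (\<lambda>(r, k). (\<rho>(i := v)) r k))"
    by (rule eq_matI) auto
  show ?thesis unfolding rowdet_def eq by (rule det_multrow[OF assms]) simp
qed

lemma rowdet_swap_rows: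
  assumes "i < n" "j < n" "i \<noteq> j"
  shows "rowdet n (\<rho>(i := u, j := v)) = - rowdet n (\<rho>(i := v, j := u))"
proof -
  have eq: "Matrix.mat n n (\<lambda>(r, k). (\<rho>(i := u, j := v)) r k) = swaprows i j (Matrix.mat n n (\<lambda>(r, k). (\<rho>(i := v, j := u)) r k))"
    using assms by (intro eq_matI) auto
  show ?thesis unfolding rowdet_def eq by (rule det_swaprows[OF assms]) simp
qed

text \<open>Leibniz' formula and the product rule, regrouped by the row that is
  differentiated.\<close>

lemma has_field_derivative_rowdet:
  assumes "\<And>r k. r < n \<Longrightarrow> k < n \<Longrightarrow> ((\<lambda>x. \<rho> x r k) has_field_derivative \<rho>' r k) (at x)"
  shows "((\<lambda>x. rowdet n (\<rho> x)) has_field_derivative (\<Sum>l<n. rowdet n ((\<rho> x)(l := \<rho>' l)))) (at x)"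
proof -
  let ?P = "{p. p permutes {0..<n}}"
  have "((\<lambda>x. rowdet n (\<rho> x)) has_field_derivative
      (\<Sum>p\<in>?P. signof p * (\<Sum>l=0..<n. \<rho>' l (p l) * (\<Prod>i\<in>{0..<n} - {l}. \<rho> x i (p i))))) (at x)"
    unfolding rowdet_altdef
    by (intro DERIV_sum DERIV_cmult has_field_derivative_prod assms) (auto simp: permutes_in_image)
  also have "(\<Sum>p\<in>?P. signof p * (\<Sum>l=0..<n. \<rho>' l (p l) * (\<Prod>i\<in>{0..<n} - {l}. \<rho> x i (p i)))) =
     (\<Sum>l=0..<n. \<Sum>p\<in>?P. signof p * (\<rho>' l (p l) * (\<Prod>i\<in>{0..<n} - {l}. \<rho> x i (p i))))"
    unfolding sum_distrib_left by (rule sum.swap)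
  also have "\<dots> = (\<Sum>l=0..<n. rowdet n ((\<rho> x)(l := \<rho>' l)))"
  proof (intro sum.cong refl)
    fix l assume l: "l \<in> {0..<n}"
    have "(\<Prod>i=0..<n. ((\<rho> x)(l := \<rho>' l)) i (p i)) = \<rho>' l (p l) * (\<Prod>i\<in>{0..<n} - {l}. \<rho> x i (p i))" for p
      by (subst prod.remove[OF _ l]) auto
    then show "(\<Sum>p\<in>?P. signof p * (\<rho>' l (p l) * (\<Prod>i\<in>{0..<n} - {l}. \<rho> x i (p i)))) = rowdet n ((\<rho> x)(l := \<rho>' l))"
      unfolding rowdet_altdef by simp
  qed
  finally show ?thesis by (simp add: atLeast0LessThan)
qed

lemma filter_neq_upt:
  assumes "j \<ge> 1" "j \<le> m"
  shows "filter (\<lambda>i. i \<noteq> j) [1..<m + 1] = [1..<j] @ [j + 1..<m + 1]"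
proof -
  have "[1..<m + 1] = [1..<j] @ j # [j + 1..<m + 1]"
    using assms upt_add_eq_append[of 1 j "m + 1 - j"] upt_conv_Cons[of j "m + 1"] by simp
  moreover have "filter (\<lambda>i. i \<noteq> j) [1..<j] = [1..<j]" "filter (\<lambda>i. i \<noteq> j) [j + 1..<m + 1] = [j + 1..<m + 1]"
    by (auto simp: filter_id_conv)
  ultimately show ?thesis by simp
qed

text \<open>The omitted function g_j is column k0 = j - 1 when counted from 0; the conditional skips
  it, exactly as the minor in a Laplace expansion does.\<close>

lemma W_jm_rowdet:
  assumes "k0 < m"
  shows "W_jm (Suc k0) m \<zeta> = rowdet (m - 1) (\<lambda>r k. (deriv ^^ r) (g_jm (if k < k0 then Suc k else Suc (Suc k)) m) \<zeta>)"
proof -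
  define l where "l = filter (\<lambda>i. i \<noteq> Suc k0) [1..<m + 1]"
  have l: "l = [1..<Suc k0] @ [Suc k0 + 1..<m + 1]"
    unfolding l_def using assms by (intro filter_neq_upt) auto
  have len: "length l = m - 1" unfolding l length_append length_upt using assms by arith
  have nth: "l ! k = (if k < k0 then Suc k else Suc (Suc k))" if "k < m - 1" for k
    using that assms unfolding l by (auto simp: nth_append)
  show ?thesis unfolding W_jm_def l_def[symmetric] wronskian_def rowdet_def
    by (intro arg_cong[where f = Determinant.det] eq_matI) (auto simp: len nth)
qed

text \<open>Laplace expansion along row m - 1: the remaining rows hold the derivatives of orders 0,
  ..., m - 2, so the minors are the W_j. With b k = g_(k+1)(z) this is the kernel in
  \<open>kappa_tilde\<close> up to the factor z / G(m+1).\<close>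

lemma rowdet_last_row:
  assumes m: "m \<ge> 1"
  shows "rowdet m ((\<lambda>r k. (deriv ^^ r) (g_jm (Suc k) m) \<zeta>)(m - 1 := b)) =
     (\<Sum>j=1..m. (-1) ^ (m - j) * (b (j - 1) * W_jm j m \<zeta>))"
proof -
  define \<rho> where "\<rho> = (\<lambda>r k. (deriv ^^ r) (g_jm (Suc k) m) \<zeta>)(m - 1 := b)"
  define A where "A = Matrix.mat m m (\<lambda>(r, k). \<rho> r k)"
  have A: "A \<in> carrier_mat m m" by (simp add: A_def)
  have "rowdet m \<rho> = Determinant.det A" by (simp add: rowdet_def A_def)
  also have "\<dots> = (\<Sum>k<m. A $$ (m - 1, k) * cofactor A (m - 1) k)"
    by (rule laplace_expansion_row[OF A]) (use m in auto)
  also have "\<dots> = (\<Sum>k<m. (-1) ^ (m - Suc k) * (b k * W_jm (Suc k) m \<zeta>))"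
  proof (intro sum.cong refl)
    fix k assume "k \<in> {..<m}"
    then have k: "k < m" by simp
    have "mat_delete A (m - 1) k = Matrix.mat (m - 1) (m - 1)
        (\<lambda>(r, k'). (deriv ^^ r) (g_jm (if k' < k then Suc k' else Suc (Suc k')) m) \<zeta>)"
      using k by (intro eq_matI) (auto simp: mat_delete_def A_def \<rho>_def)
    then have "Determinant.det (mat_delete A (m - 1) k) = W_jm (Suc k) m \<zeta>"
      unfolding W_jm_rowdet[OF k] by (simp add: rowdet_def)
    moreover have "(-1::complex) ^ (m - 1 + k) = (-1) ^ (m - Suc k)"
    proof -
      have "m - 1 + k = (m - Suc k) + 2 * k" using k by simp
      then show ?thesis by (simp only: power_add power_mult) simp
    qed
    moreover have "A $$ (m - 1, k) = b k" using k by (simp add: A_def \<rho>_def)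
    ultimately show "A $$ (m - 1, k) * cofactor A (m - 1) k = (-1) ^ (m - Suc k) * (b k * W_jm (Suc k) m \<zeta>)"
      by (simp add: cofactor_def)
  qed
  also have "\<dots> = (\<Sum>j=1..m. (-1) ^ (m - j) * (b (j - 1) * W_jm j m \<zeta>))"
    by (rule sum.reindex_bij_witness[of _ "\<lambda>j. j - 1" Suc]) auto
  finally show ?thesis by (simp add: \<rho>_def)
qed

section \<open>Power series and differential equation of the functions g_j\<close>

lemma pochhammer_of_nat_pos: "pochhammer (real (n + 1)) m > 0"
  by (intro pochhammer_pos) simp

text \<open>The coefficient of z^(2mk + d) in g_(d+1): the Gamma arguments in the Kilbas-Saigo
  function differ by the integer m, so their quotient is an inverse Pochhammer symbol.\<close>

definition g_coeff :: "nat \<Rightarrow> nat \<Rightarrow> nat \<Rightarrow> real" where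
  "g_coeff m d k = (\<Prod>i<k. 1 / pochhammer (real (2 * m * i + m + d + 1)) m)"

lemma rapid_g_coeff:
  assumes "m \<ge> 1"
  shows "rapid (g_coeff m d)"
proof (rule rapid_recursion[where U = "\<lambda>_. 0" and \<delta> = "\<lambda>k. 1 / pochhammer (real (2 * m * k + m + d + 1)) m"])
  have p: "pochhammer (real (2 * m * k + m + d + 1)) m > 0" for k by (rule pochhammer_of_nat_pos)
  show "g_coeff m d k \<ge> 0" "0 \<le> 1 / pochhammer (real (2 * m * k + m + d + 1)) m" for k
    unfolding g_coeff_def using p by (auto intro!: prod_nonneg simp: less_imp_le)
  show "g_coeff m d (Suc k) \<le> 1 / pochhammer (real (2 * m * k + m + d + 1)) m * (g_coeff m d k + 0)" for k
    by (simp add: g_coeff_def)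
  show "rapid (\<lambda>_. 0 :: real)" by (auto simp: rapid_def)
  show "(\<lambda>k. 1 / pochhammer (real (2 * m * k + m + d + 1)) m) \<longlonglongrightarrow> 0"
  proof (rule Lim_null_comparison)
    show "(\<lambda>k. 1 / real (Suc k)) \<longlonglongrightarrow> 0" by (rule LIMSEQ_Suc[OF lim_1_over_n])
    have "norm (1 / pochhammer (real (2 * m * k + m + d + 1)) m) \<le> 1 / real (Suc k)" for k
    proof -
      have "1 * k \<le> (2 * m) * k" using assms by (intro mult_le_mono1) simp
      then have "Suc k \<le> 2 * m * k + m + d + 1" by linarith
      then have "real (Suc k) \<le> real (2 * m * k + m + d + 1)" by (simp only: of_nat_le_iff)
      also have "\<dots> \<le> pochhammer (real (2 * m * k + m + d + 1)) m"
        using assms by (intro pochhammer_ge_self) auto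
      finally show ?thesis using p[of k] by (simp add: frac_le)
    qed
    then show "eventually (\<lambda>k. norm (1 / pochhammer (real (2 * m * k + m + d + 1)) m) \<le> 1 / real (Suc k)) sequentially"
      by simp
  qed
qed

text \<open>The choice l = 1 + d/m makes both Gamma arguments integers, the smaller one being 2mi +
  m + d + 1.\<close>

lemma kilbas_saigo_g_coeff:
  assumes "m \<ge> 1"
  shows "kilbas_saigo (real m) 2 (1 + real d / real m) u = (\<Sum>k. of_real (g_coeff m d k) * u ^ k)"
proof -
  have "rapid (\<lambda>k. complex_of_real (g_coeff m d k))" using rapid_g_coeff[OF assms, of d] by (simp add: rapid_def)
  from rapid_summable[OF this] have s: "summable (\<lambda>k. of_real (g_coeff m d k) * u ^ k)" .
  have f: "Gamma (real m * (real i * 2 + (1 + real d / real m)) + 1) / Gamma (real m * (real i * 2 + (1 + real d / real m) + 1) + 1)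
     = 1 / pochhammer (real (2 * m * i + m + d + 1)) m" for i
  proof -
    have "real m * (real i * 2 + (1 + real d / real m)) + 1 = real (2 * m * i + m + d + 1)"
      "real m * (real i * 2 + (1 + real d / real m) + 1) + 1 = real (2 * m * i + m + d + 1) + real m"
      using assms by (simp_all add: algebra_simps)
    moreover have "real (2 * m * i + m + d + 1) > 0" by (simp only: of_nat_0_less_iff)
    note Gamma_ratio_pochhammer[OF this, of m]
    ultimately show ?thesis by (simp only: flip: \<open>Gamma _ / Gamma _ = pochhammer _ _\<close>) simp
  qed
  show ?thesis unfolding kilbas_saigo_def f g_coeff_def[symmetric]
    using suminf_split_head[OF s] by (simp add: g_coeff_def mult.commute)
qed

text \<open>Formal series reduce higher derivatives to a computation with coefficients. For d < m,
  \<open>n div (2 * m)\<close> recovers k from n = 2mk + d.\<close>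

definition g_fps :: "nat \<Rightarrow> nat \<Rightarrow> complex fps" where
  "g_fps m d = Abs_fps (\<lambda>n. if \<exists>k. n = 2 * m * k + d then of_real (g_coeff m d (n div (2 * m))) else 0)"

lemma g_fps_nth:
  assumes "d < m"
  shows "fps_nth (g_fps m d) (2 * m * k + d) = of_real (g_coeff m d k)"
    and "\<nexists>k. n = 2 * m * k + d \<Longrightarrow> fps_nth (g_fps m d) n = 0"
proof -
  have "(2 * m * k + d) div (2 * m) = k" using assms by (simp add: div_mult_self3)
  then show "fps_nth (g_fps m d) (2 * m * k + d) = of_real (g_coeff m d k)" unfolding g_fps_def by auto
qed (auto simp: g_fps_def)

lemma g_fps_sums:
  assumes d: "d < m"
  shows "(\<lambda>n. fps_nth (g_fps m d) n * z ^ n) sums g_jm (Suc d) m z"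
proof -
  have m: "m \<ge> 1" using d by simp
  have r: "rapid (\<lambda>k. complex_of_real (g_coeff m d k))" using rapid_g_coeff[OF m, of d] by (simp add: rapid_def)
  have "(\<lambda>k. of_real (g_coeff m d k) * (z ^ (2 * m)) ^ k) sums kilbas_saigo (real m) 2 (1 + real d / real m) (z ^ (2 * m))"
    unfolding kilbas_saigo_g_coeff[OF m] by (rule summable_sums[OF rapid_summable[OF r]])
  from sums_mult[OF this, of "z ^ d"]
  have "(\<lambda>k. z ^ d * (of_real (g_coeff m d k) * (z ^ (2 * m)) ^ k)) sums g_jm (Suc d) m z" by (simp add: g_jm_def)
  also have "(\<lambda>k. z ^ d * (of_real (g_coeff m d k) * (z ^ (2 * m)) ^ k)) =
     (\<lambda>k. fps_nth (g_fps m d) (2 * m * k + d) * z ^ (2 * m * k + d))"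
    unfolding g_fps_nth(1)[OF d] power_add power_mult by (simp add: mult_ac)
  finally show ?thesis
    by (subst (asm) sums_mono_reindex[of "\<lambda>k. 2 * m * k + d"])
       (use m g_fps_nth(2)[OF d] in \<open>auto simp: strict_mono_def\<close>)
qed

lemma fps_conv_radius_g_fps: "d < m \<Longrightarrow> fps_conv_radius (g_fps m d) = \<infinity>"
  unfolding fps_conv_radius_def by (rule conv_radius_inftyI'') (use g_fps_sums sums_summable in blast)

lemma g_jm_eval_fps: "d < m \<Longrightarrow> g_jm (Suc d) m = eval_fps (g_fps m d)"
  using sums_unique[OF g_fps_sums] by (auto simp: eval_fps_def)

lemma fps_conv_radius_higher_deriv:
  fixes f :: "complex fps"
  shows "fps_conv_radius f = \<infinity> \<Longrightarrow> fps_conv_radius ((fps_deriv ^^ i) f) = \<infinity>"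
proof (induction i)
  case (Suc i)
  then show ?case using fps_conv_radius_deriv[of "(fps_deriv ^^ i) f"] by simp
qed simp

lemma higher_deriv_eval_fps:
  fixes f :: "complex fps"
  assumes "fps_conv_radius f = \<infinity>"
  shows "(deriv ^^ i) (eval_fps f) = eval_fps ((fps_deriv ^^ i) f)"
proof (induction i)
  case (Suc i)
  have "deriv (eval_fps ((fps_deriv ^^ i) f)) z = eval_fps (fps_deriv ((fps_deriv ^^ i) f)) z" for z
    by (intro DERIV_imp_deriv has_field_derivative_eval_fps) (simp add: fps_conv_radius_higher_deriv[OF assms])
  then show ?case using Suc by auto
qed simp

lemma g_jm_higher_deriv:
  assumes "d < m"
  shows "((deriv ^^ i) (g_jm (Suc d) m) has_field_derivative (deriv ^^ Suc i) (g_jm (Suc d) m) z) (at z)"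
  unfolding g_jm_eval_fps[OF assms] higher_deriv_eval_fps[OF fps_conv_radius_g_fps[OF assms]]
  using has_field_derivative_eval_fps[of z "(fps_deriv ^^ i) (g_fps m d)" UNIV]
    fps_conv_radius_higher_deriv[OF fps_conv_radius_g_fps[OF assms], of i] by simp

text \<open>The exponents of g_(d+1) are d, 2m + d, ...; below order m only the first one is seen at
  0.\<close>

lemma g_jm_higher_deriv_0:
  assumes "d < m" "i < m"
  shows "(deriv ^^ i) (g_jm (Suc d) m) 0 = (if i = d then fact d else 0)"
proof -
  have "(deriv ^^ i) (g_jm (Suc d) m) 0 = fact i * fps_nth (g_fps m d) i"
    unfolding g_jm_eval_fps[OF assms(1)] higher_deriv_eval_fps[OF fps_conv_radius_g_fps[OF assms(1)]]
    by (simp add: eval_fps_at_0 fps_0th_higher_deriv)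
  moreover have "fps_nth (g_fps m d) i = (if i = d then 1 else 0)"
  proof (cases "i = d")
    case True
    then show ?thesis using g_fps_nth(1)[OF assms(1), of 0] by (simp add: g_coeff_def)
  next
    case False
    have "i \<noteq> 2 * m * k + d" for k using False assms by (cases k) auto
    then show ?thesis using g_fps_nth(2)[OF assms(1)] False by auto
  qed
  ultimately show ?thesis by simp
qed

lemma fps_nth_higher_deriv:
  fixes f :: "complex fps"
  shows "fps_nth ((fps_deriv ^^ i) f) n = pochhammer (of_nat n + 1) i * fps_nth f (n + i)"
proof (induction i arbitrary: n)
  case (Suc i)
  show ?case by (simp add: Suc pochhammer_rec algebra_simps)
qed simp

text \<open>Applying m derivatives to z^(2mk+d) gives the Pochhammer factor that
  \<open>g_coeff\<close> divides out, hence the previous coefficient at the exponent 2m(k-1) + d +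
  m. The first term z^d is annihilated as d < m.\<close>

lemma g_jm_ode:
  assumes d: "d < m"
  shows "(deriv ^^ m) (g_jm (Suc d) m) z = z ^ m * g_jm (Suc d) m z"
proof -
  have "(fps_deriv ^^ m) (g_fps m d) = fps_X ^ m * g_fps m d"
  proof (rule fps_ext)
    fix n
    show "fps_nth ((fps_deriv ^^ m) (g_fps m d)) n = fps_nth (fps_X ^ m * g_fps m d) n"
      unfolding fps_nth_higher_deriv fps_X_power_mult_nth
    proof (cases "\<exists>k. n + m = 2 * m * k + d")
      case True
      then obtain k where k: "n + m = 2 * m * k + d" by blast
      with d have "k \<noteq> 0" by (cases k) auto
      then obtain k' where k': "k = Suc k'" by (cases k) auto
      have n: "n = 2 * m * k' + m + d" using k unfolding k' by simp
      have p: "pochhammer (real (2 * m * k' + m + d + 1)) m > 0" by (rule pochhammer_of_nat_pos)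
      have "complex_of_nat n + 1 = of_real (real (2 * m * k' + m + d + 1))" unfolding n by simp
      then have "pochhammer (complex_of_nat n + 1) m = of_real (pochhammer (real (2 * m * k' + m + d + 1)) m)"
        by (simp only: pochhammer_of_real)
      moreover have "g_coeff m d (Suc k') = g_coeff m d k' / pochhammer (real (2 * m * k' + m + d + 1)) m"
        by (simp add: g_coeff_def)
      ultimately have "pochhammer (complex_of_nat n + 1) m * of_real (g_coeff m d k) = of_real (g_coeff m d k')"
        using p by (simp add: k' del: of_nat_add)
      then show "pochhammer (complex_of_nat n + 1) m * fps_nth (g_fps m d) (n + m) = (if n < m then 0 else fps_nth (g_fps m d) (n - m))"
        unfolding k g_fps_nth(1)[OF d] using g_fps_nth(1)[OF d, of k'] by (simp add: n)
    next
      case False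
      have "\<nexists>k. n - m = 2 * m * k + d" if "\<not> n < m"
      proof
        assume "\<exists>k. n - m = 2 * m * k + d"
        then obtain k where "n - m = 2 * m * k + d" by blast
        then have "n + m = 2 * m * Suc k + d" using that by simp
        then show False using False by blast
      qed
      then show "pochhammer (complex_of_nat n + 1) m * fps_nth (g_fps m d) (n + m) = (if n < m then 0 else fps_nth (g_fps m d) (n - m))"
        using g_fps_nth(2)[OF d] False by auto
    qed
  qed
  then show ?thesis
    unfolding g_jm_eval_fps[OF d] higher_deriv_eval_fps[OF fps_conv_radius_g_fps[OF d]]
    by (simp add: eval_fps_mult fps_conv_radius_g_fps[OF d])
qed

subsection \<open>The Green function\<close>

definition g_row :: "nat \<Rightarrow> complex \<Rightarrow> nat \<Rightarrow> nat \<Rightarrow> complex" where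
  "g_row m \<zeta> r k = (deriv ^^ r) (g_jm (Suc k) m) \<zeta>"

lemma g_row_deriv:
  "k < m \<Longrightarrow> ((\<lambda>\<zeta>. g_row m \<zeta> r k) has_field_derivative g_row m \<zeta> (Suc r) k) (at \<zeta>)"
  unfolding g_row_def using g_jm_higher_deriv[of k m r \<zeta>] by simp

lemma g_row_ode: "k < m \<Longrightarrow> g_row m \<zeta> m k = \<zeta> ^ m * g_row m \<zeta> 0 k"
  unfolding g_row_def using g_jm_ode[of k m \<zeta>] by simp

lemma rowdet_g_row_ode:
  assumes "l < m"
  shows "rowdet m (\<rho>(l := g_row m \<zeta> m)) = \<zeta> ^ m * rowdet m (\<rho>(l := g_row m \<zeta> 0))"
proof -
  have "rowdet m (\<rho>(l := g_row m \<zeta> m)) = rowdet m (\<rho>(l := \<lambda>k. \<zeta> ^ m * g_row m \<zeta> 0 k))"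
    by (intro rowdet_cong) (simp add: g_row_ode)
  then show ?thesis by (simp only: rowdet_scale_row[OF assms])
qed

text \<open>Abel's identity: differentiating any row but the last duplicates the next one, and the
  last becomes \<zeta>^m times row 0, a different row as m >= 2. Hence the determinant is constant;
  at 0 the matrix is triangular with diagonal 0!, ..., (m-1)!.\<close>

lemma wronskian_g_row:
  assumes m: "m \<ge> 2"
  shows "rowdet m (g_row m \<zeta>) = of_nat (\<Prod>i=1..m-1. fact i)"
proof -
  have D: "((\<lambda>\<zeta>. rowdet m (g_row m \<zeta>)) has_field_derivative 0) (at \<zeta>)" for \<zeta>
  proof -
    have "((\<lambda>\<zeta>. rowdet m (g_row m \<zeta>)) has_field_derivative
        (\<Sum>l<m. rowdet m ((g_row m \<zeta>)(l := g_row m \<zeta> (Suc l))))) (at \<zeta>)"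
      using has_field_derivative_rowdet[of m "g_row m" "\<lambda>l. g_row m \<zeta> (Suc l)" \<zeta>] g_row_deriv by simp
    also have "(\<Sum>l<m. rowdet m ((g_row m \<zeta>)(l := g_row m \<zeta> (Suc l)))) = 0"
    proof (rule sum.neutral, rule ballI)
      fix l assume "l \<in> {..<m}"
      then have l: "l < m" by simp
      show "rowdet m ((g_row m \<zeta>)(l := g_row m \<zeta> (Suc l))) = 0"
      proof (cases "Suc l < m")
        case True
        then show ?thesis by (intro rowdet_identical_rows[of l m "Suc l"]) auto
      next
        case False
        then have "Suc l = m" using l by simp
        moreover have "rowdet m ((g_row m \<zeta>)(l := g_row m \<zeta> 0)) = 0"
          using False l m by (intro rowdet_identical_rows[of l m 0]) auto
        ultimately show ?thesis using rowdet_g_row_ode[OF l, of "g_row m \<zeta>" \<zeta>] by simp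
      qed
    qed
    finally show ?thesis .
  qed
  then obtain C where C: "rowdet m (g_row m \<zeta>) = C" for \<zeta>
    using has_field_derivative_zero_constant[of UNIV "\<lambda>\<zeta>. rowdet m (g_row m \<zeta>)"] by auto
  have "rowdet m (g_row m 0) = of_nat (\<Prod>i=1..m-1. fact i)"
  proof -
    define A where "A = Matrix.mat m m (\<lambda>(r, k). g_row m 0 r k)"
    have A: "A \<in> carrier_mat m m" by (simp add: A_def)
    have ut: "upper_triangular A"
      by (auto simp: A_def upper_triangular_def g_row_def g_jm_higher_deriv_0)
    have "rowdet m (g_row m 0) = prod_list (diag_mat A)"
      unfolding rowdet_def A_def[symmetric] by (rule det_upper_triangular[OF ut A])
    also have "diag_mat A = map (\<lambda>i. fact i) [0..<m]"
      by (auto simp: A_def diag_mat_def g_row_def g_jm_higher_deriv_0)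
    also have "prod_list \<dots> = (\<Prod>i\<in>{0..<m}. fact i)"
      by (subst prod.distinct_set_conv_list[symmetric]) auto
    also have "{0..<m} = insert 0 {1..m-1}" using m by auto
    finally show ?thesis by simp
  qed
  with C show ?thesis by metis
qed

text \<open>Differentiating a row \<open>g\<^sup>(\<^sup>l\<^sup>)\<close> duplicates the next one, unless that one has been replaced by \<open>b\<close>;
  the last row wraps around to \<open>\<zeta>\<^sup>m g\<close>.\<close>

lemma adjoint_row_deriv:
  assumes m: "m \<ge> 2" and i: "i < m"
  shows "((\<lambda>\<zeta>. rowdet m ((g_row m \<zeta>)(i := b))) has_field_derivative
     (if i = 0 then - (\<zeta> ^ m) * rowdet m ((g_row m \<zeta>)(m - 1 := b))
      else - rowdet m ((g_row m \<zeta>)(i - 1 := b)))) (at \<zeta>)"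
proof -
  define \<rho> where "\<rho> = (g_row m \<zeta>)(i := b)"
  define \<rho>' where "\<rho>' l = (if l = i then (\<lambda>k. 0) else g_row m \<zeta> (Suc l))" for l
  define v where "v = (if i = 0 then - (\<zeta> ^ m) * rowdet m ((g_row m \<zeta>)(m - 1 := b))
      else - rowdet m ((g_row m \<zeta>)(i - 1 := b)))"
  \<comment> \<open>The row before i, cyclically. Apart from the constant row i, it is the only one
    whose derivative does not repeat another row, since its successor has been replaced by
    b.\<close>
  define l0 where "l0 = (if i = 0 then m - 1 else i - 1)"
  have D: "((\<lambda>\<zeta>. rowdet m ((g_row m \<zeta>)(i := b))) has_field_derivative
      (\<Sum>l<m. rowdet m (\<rho>(l := \<rho>' l)))) (at \<zeta>)"
    unfolding \<rho>_def
  proof (rule has_field_derivative_rowdet[of m "\<lambda>\<zeta>. (g_row m \<zeta>)(i := b)"])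
    fix r k assume "k < m"
    then show "((\<lambda>x. ((g_row m x)(i := b)) r k) has_field_derivative \<rho>' r k) (at \<zeta>)"
      using g_row_deriv[of k m r \<zeta>] by (cases "r = i") (auto simp: \<rho>'_def)
  qed
  have "rowdet m (\<rho>(l := \<rho>' l)) = (if l = l0 then v else 0)" if l: "l < m" for l
  proof -
    consider "l = i" | "l \<noteq> i" "Suc l < m" "Suc l \<noteq> i" | "Suc l = i" | "l \<noteq> i" "Suc l = m"
      using l by linarith
    then show ?thesis
    proof cases
      case 1
      have "rowdet m (\<rho>(i := \<lambda>k. 0 * b k)) = 0" by (subst rowdet_scale_row[OF i]) simp
      then show ?thesis using 1 m i by (auto simp: \<rho>'_def l0_def)
    next
      case 2
      then show ?thesis using m l
        by (subst rowdet_identical_rows[of l m "Suc l"]) (auto simp: \<rho>'_def \<rho>_def l0_def)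
    next
      case 3
      have "rowdet m (\<rho>(l := \<rho>' l)) = rowdet m ((g_row m \<zeta>)(i := b, l := g_row m \<zeta> i))"
        using 3 by (auto simp: \<rho>_def \<rho>'_def)
      also have "\<dots> = - rowdet m ((g_row m \<zeta>)(i := g_row m \<zeta> i, l := b))"
        by (rule rowdet_swap_rows) (use 3 i l in auto)
      finally show ?thesis using 3 by (auto simp: v_def l0_def)
    next
      case 4
      have e: "rowdet m (\<rho>(l := \<rho>' l)) = \<zeta> ^ m * rowdet m (\<rho>(l := g_row m \<zeta> 0))"
        using 4 rowdet_g_row_ode[OF l] by (simp add: \<rho>'_def)
      show ?thesis
      proof (cases "i = 0")
        case True
        have "rowdet m (\<rho>(l := g_row m \<zeta> 0)) = - rowdet m ((g_row m \<zeta>)(0 := g_row m \<zeta> 0, l := b))"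
          unfolding \<rho>_def True by (rule rowdet_swap_rows) (use 4 True m in auto)
        moreover have "l = m - 1" using 4 by simp
        ultimately show ?thesis using e True by (simp add: v_def l0_def)
      next
        case False
        have "rowdet m (\<rho>(l := g_row m \<zeta> 0)) = 0"
          by (rule rowdet_identical_rows[of l m 0]) (use 4 False m in \<open>auto simp: \<rho>_def\<close>)
        then show ?thesis using e False 4 i by (auto simp: l0_def)
      qed
    qed
  qed
  then have "(\<Sum>l<m. rowdet m (\<rho>(l := \<rho>' l))) = (\<Sum>l<m. if l = l0 then v else 0)"
    by (intro sum.cong) auto
  also have "\<dots> = v" using m i by (auto simp: l0_def)
  finally show ?thesis using D by (simp add: v_def)
qed

lemma continuous_on_W_jm:
  assumes j: "1 \<le> j" "j \<le> m"
  shows "continuous_on S (W_jm j m)"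
proof -
  obtain k0 where k0: "j = Suc k0" "k0 < m" using j by (cases j) auto
  define \<rho> where "\<rho> \<zeta> r k = (deriv ^^ r) (g_jm (if k < k0 then Suc k else Suc (Suc k)) m) \<zeta>" for \<zeta> r k
  have "\<exists>f'. ((\<lambda>\<zeta>. rowdet (m - 1) (\<rho> \<zeta>)) has_field_derivative f') (at \<zeta>)" for \<zeta>
  proof (rule exI, rule has_field_derivative_rowdet)
    fix r k assume k: "k < m - 1"
    show "((\<lambda>\<zeta>. \<rho> \<zeta> r k) has_field_derivative \<rho> \<zeta> (Suc r) k) (at \<zeta>)"
      unfolding \<rho>_def using g_jm_higher_deriv[of k m r \<zeta>] g_jm_higher_deriv[of "Suc k" m r \<zeta>] k by auto
  qed
  then have "continuous_on S (\<lambda>\<zeta>. rowdet (m - 1) (\<rho> \<zeta>))"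
    by (meson DERIV_isCont continuous_at_imp_continuous_on)
  moreover have "W_jm j m = (\<lambda>\<zeta>. rowdet (m - 1) (\<rho> \<zeta>))"
    unfolding k0 \<rho>_def by (rule ext) (rule W_jm_rowdet[OF k0(2)])
  ultimately show ?thesis by simp
qed

lemma mittag_leffler_continuous:
  assumes m: "m \<ge> 1" and c: "c > -1"
  shows "continuous_on S (mittag_leffler (2 * real m) (real m * (1 + c)))"
proof -
  have "rapid (\<lambda>k. complex_of_real (1 / Gam m c (2 * k)))"
    using rapid_inverse_Gam[OF m c] by (simp add: rapid_def norm_divide)
  then have "continuous_on UNIV (\<lambda>u. \<Sum>k. complex_of_real (1 / Gam m c (2 * k)) * u ^ k)"
    by (intro DERIV_continuous_on[where D = "\<lambda>u. \<Sum>k. diffs (\<lambda>k. complex_of_real (1 / Gam m c (2 * k))) k * u ^ k"] 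
        termdiffs_strong_converges_everywhere rapid_summable)
  moreover have "mittag_leffler (2 * real m) (real m * (1 + c)) = (\<lambda>u. \<Sum>k. complex_of_real (1 / Gam m c (2 * k)) * u ^ k)"
    by (intro ext) (simp add: mittag_leffler_def Gam_def algebra_simps)
  ultimately show ?thesis using continuous_on_subset by (metis top_greatest)
qed

text \<open>\<open>kernel_half\<close> and \<open>ml_factor\<close> omit the common factor \<open>(z w)\<^sup>a\<close>, \<open>a = m (1 + c) - 1\<close>,
  and so have no branch cut.\<close>

definition kernel_half :: "nat \<Rightarrow> real \<Rightarrow> complex \<Rightarrow> complex \<Rightarrow> complex" where
  "kernel_half m c z w = z ^ m * (\<Sum>k. kernel_coeff m c k (w ^ (2 * m)) * z ^ (2 * m * k))"

definition ml_factor :: "nat \<Rightarrow> real \<Rightarrow> complex \<Rightarrow> real \<Rightarrow> complex" where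
  "ml_factor m c u t = of_real (t powr (real m * (1 + c) - 1)) *
     mittag_leffler (2 * real m) (real m * (1 + c)) ((of_real t * u) ^ (2 * m))"

lemma set_integrable_ml_factor:
  assumes m: "m \<ge> 1" and c: "c > -1" and f: "continuous_on {0..1} f"
  shows "set_integrable lborel {0..1} (\<lambda>t. f t * ml_factor m c u t)"
proof -
  have "continuous_on {0..1} (\<lambda>t::real. mittag_leffler (2 * real m) (real m * (1 + c)) ((of_real t * u) ^ (2 * m)))"
    by (rule continuous_on_compose2[OF mittag_leffler_continuous[OF m c, of UNIV]]) (auto intro!: continuous_intros)
  with f have "continuous_on {0..1} (\<lambda>t. f t * mittag_leffler (2 * real m) (real m * (1 + c)) ((of_real t * u) ^ (2 * m)))"
    by (rule continuous_on_mult)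
  moreover have "real m * (1 + c) - 1 > -1" using m c by simp
  ultimately have "set_integrable lborel {0..1} (\<lambda>t. f t *
      mittag_leffler (2 * real m) (real m * (1 + c)) ((of_real t * u) ^ (2 * m)) * of_real (t powr (real m * (1 + c) - 1)))"
    by (intro set_integrable_powr_mult)
  then show ?thesis unfolding ml_factor_def by (simp only: mult_ac)
qed

text \<open>\<open>N i\<close> is the normalised Wronskian determinant with row i replaced by
  \<open>b\<close>, the values at the fixed endpoint z. At t = 1 the vector b coincides with row 0,
  so \<open>N 0\<close> is 1 and every other \<open>N i\<close> has two equal rows. These are the
  end conditions of \<open>adjoint_system_integral\<close>, and \<open>rowdet_last_row\<close>
  identifies \<open>N (m - 1)\<close>.\<close>

lemma green_integral:
  assumes m: "m \<ge> 2" and c: "c > -1"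
  shows "(LINT t:{0..1}|lborel. (\<Sum>j=1..m. (-1) ^ (m - j) / of_nat (\<Prod>i=1..m-1. fact i) *
      (z * g_jm j m z * W_jm j m (of_real t * z))) * ml_factor m c (z * w) t) = kernel_half m c z w"
proof -
  have m1: "m \<ge> 1" using m by simp
  define C where "C = complex_of_nat (\<Prod>i=1..m-1. fact i)"
  have C: "C \<noteq> 0" unfolding C_def by simp
  define b where "b = g_row m z 0"
  define N where "N i t = rowdet m ((g_row m (of_real t * z))(i := b)) / C" for i and t :: real
  have N': "(N i has_vector_derivative z * (if i = 0 then - ((of_real t * z) ^ m) * N (m - 1) t else - N (i - 1) t)) (at t)"
    if "i < m" for i t
  proof -
    have "((\<lambda>t. of_real t * z) has_vector_derivative z) (at t)"
      by (rule has_vector_derivative_real_field) (auto intro!: derivative_eq_intros)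
    from field_vector_diff_chain_at[OF this DERIV_cdivide[OF adjoint_row_deriv[OF m that, of b], of C]]
    show ?thesis unfolding N_def by (cases "i = 0") (simp_all add: o_def)
  qed
  have K: "z * N (m - 1) t = (\<Sum>j=1..m. (-1) ^ (m - j) / C * (z * g_jm j m z * W_jm j m (of_real t * z)))" for t
  proof -
    have "N (m - 1) t = (\<Sum>j=1..m. (-1) ^ (m - j) * (b (j - 1) * W_jm j m (of_real t * z))) / C"
      unfolding N_def using rowdet_last_row[OF m1, of "of_real t * z" b] by (simp add: g_row_def[abs_def])
    then show ?thesis
      by (simp only: sum_divide_distrib sum_distrib_left) (intro sum.cong, auto simp: b_def g_row_def)
  qed
  have cN: "continuous_on {0..1} (N i)" if "i < m" for i
    by (intro continuous_at_imp_continuous_on ballI has_vector_derivative_continuous[OF N'[OF that]])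
  have "((\<lambda>t. z * N (m - 1) t * (of_real (t powr (real m * (1 + c) - 1)) *
       mittag_leffler (2 * real m) (real m * (1 + c)) ((of_real t * z * w) ^ (2 * m))))
     has_integral z ^ m * (\<Sum>k. kernel_coeff m c k (w ^ (2 * m)) * z ^ (2 * m * k))) {0..1}"
  proof (rule adjoint_system_integral[OF m1 c])
    fix t :: real
    show "(N 0 has_vector_derivative - (z * (of_real t * z) ^ m) * N (m - 1) t) (at t)"
      using N'[of 0 t] m by (simp add: mult.assoc)
    show "(N (Suc i) has_vector_derivative - z * N i t) (at t)" if "Suc i < m" for i
      using N'[of "Suc i" t] that by simp
  next
    show "continuous_on {0..1} (N i)" if "i < m" for i by (rule cN[OF that])
    show "N i 1 = (if i = 0 then 1 else 0)" if "i < m" for i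
    proof (cases "i = 0")
      case True
      then show ?thesis using wronskian_g_row[OF m, of z] C by (simp add: N_def b_def C_def)
    next
      case False
      then have "rowdet m ((g_row m z)(i := b)) = 0"
        by (intro rowdet_identical_rows[of i m 0]) (use that in \<open>auto simp: b_def\<close>)
      then show ?thesis using False by (simp add: N_def)
    qed
  qed
  then have I: "((\<lambda>t. z * N (m - 1) t * ml_factor m c (z * w) t) has_integral kernel_half m c z w) {0..1}"
    by (simp add: ml_factor_def kernel_half_def mult.assoc)
  have "(LINT t:{0..1}|lborel. z * N (m - 1) t * ml_factor m c (z * w) t) = kernel_half m c z w"
  proof -
    have "set_integrable lborel {0..1} (\<lambda>t. z * N (m - 1) t * ml_factor m c (z * w) t)"
      by (intro set_integrable_ml_factor m1 c continuous_intros cN) (use m in auto)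
    from set_borel_integral_eq_integral(2)[OF this] show ?thesis using I by (simp add: integral_unique)
  qed
  then show ?thesis unfolding K C_def .
qed

text \<open>For m = 1 the adjoint system is the single equation N' = -z^2 t N with N = 1 at t = 1,
  solved by the exponential.\<close>

lemma green_integral_1:
  assumes c: "c > -1"
  shows "(LINT t:{0..1}|lborel. (z * exp (of_real (1 / 2 * (1 - t\<^sup>2)) * z\<^sup>2)) * ml_factor 1 c (z * w) t) = kernel_half 1 c z w"
proof -
  define N where "N i t = exp (of_real (1 / 2 * (1 - t\<^sup>2)) * z\<^sup>2)" for i :: nat and t :: real
  have N': "(N i has_vector_derivative - (z * (of_real t * z) ^ 1) * N 0 t) (at t)" for i t
  proof -
    have "((\<lambda>t. complex_of_real (1 / 2 * (1 - t\<^sup>2)) * z\<^sup>2) has_vector_derivative of_real (- t) * z\<^sup>2) (at t)"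
      by (intro has_vector_derivative_mult_left has_vector_derivative_of_real)
         (auto intro!: derivative_eq_intros)
    from field_vector_diff_chain_at[OF this DERIV_exp]
    show ?thesis by (simp add: N_def[abs_def] o_def power2_eq_square mult_ac)
  qed
  have cN: "continuous_on {0..1} (N i)" for i
    by (intro continuous_at_imp_continuous_on ballI has_vector_derivative_continuous[OF N'])
  have "((\<lambda>t. z * N (1 - 1) t * (of_real (t powr (real 1 * (1 + c) - 1)) *
       mittag_leffler (2 * real 1) (real 1 * (1 + c)) ((of_real t * z * w) ^ (2 * 1))))
     has_integral z ^ 1 * (\<Sum>k. kernel_coeff 1 c k (w ^ (2 * 1)) * z ^ (2 * 1 * k))) {0..1}"
    by (rule adjoint_system_integral[OF _ c]) (use N'[of 0] cN in \<open>auto simp: N_def[abs_def]\<close>)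
  then have I: "((\<lambda>t. z * N 0 t * ml_factor 1 c (z * w) t) has_integral kernel_half 1 c z w) {0..1}"
    by (simp add: ml_factor_def kernel_half_def mult.assoc)
  have "set_integrable lborel {0..1} (\<lambda>t. z * N 0 t * ml_factor 1 c (z * w) t)"
    by (intro set_integrable_ml_factor c continuous_intros cN) auto
  from set_borel_integral_eq_integral(2)[OF this] I show ?thesis by (simp add: integral_unique N_def)
qed

lemma F_mc_ml_factor:
  "F_mc m c t z w = z powr of_real (real m * (1 + c) - 1) * w powr of_real (real m * (1 + c) - 1) * ml_factor m c (z * w) t"
  by (simp add: F_mc_def Let_def ml_factor_def mult_ac)

text \<open>The factor z^a w^a leaves the integral, and \<open>ml_factor\<close> depends only on zw,
  so the two halves of the integrand yield one function with its arguments exchanged.\<close>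

lemma kappa_tilde_series:
  assumes m: "m \<ge> 1" and c: "c > -1"
  defines "a \<equiv> complex_of_real (real m * (1 + c) - 1)"
  shows "kappa_tilde m c z w = z powr a * w powr a * (kernel_half m c z w - kernel_half m c w z)"
proof (cases "m = 1")
  case True
  define f where "f z t = z * exp (of_real (1 / 2 * (1 - t\<^sup>2)) * z\<^sup>2)" for z :: complex and t :: real
  define F where "F = ml_factor 1 c (z * w)"
  have int: "set_integrable lborel {0..1} (\<lambda>t. f z t * F t)" for z
    unfolding F_def f_def by (intro set_integrable_ml_factor c continuous_intros) auto
  have h: "(LINT t:{0..1}|lborel. f z t * F t) = kernel_half 1 c z w"
    "(LINT t:{0..1}|lborel. f w t * F t) = kernel_half 1 c w z"
    unfolding f_def F_def using green_integral_1[OF c, of z w] green_integral_1[OF c, of w z]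
    by (simp_all add: mult.commute)
  have "kappa_tilde m c z w = (LINT t:{0..1}|lborel. (z powr a * w powr a) * (f z t * F t - f w t * F t))"
    unfolding kappa_tilde_def F_mc_ml_factor a_def True f_def F_def
    by (simp add: algebra_simps)
  also have "\<dots> = (z powr a * w powr a) * ((LINT t:{0..1}|lborel. f z t * F t) - (LINT t:{0..1}|lborel. f w t * F t))"
    using int by (simp add: set_integral_diff)
  finally show ?thesis unfolding h True by simp
next
  case False
  then have m2: "m \<ge> 2" using m by simp
  define f where "f j z t = z * g_jm j m z * W_jm j m (of_real t * z)" for j and z :: complex and t :: real
  define F where "F = ml_factor m c (z * w)"
  define C where "C j = (-1) ^ (m - j) / complex_of_nat (\<Prod>i=1..m-1. fact i)" for j
  \<comment> \<open>Each summand has to be integrable before sum and difference may be split, since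
    the integral is 0 by convention where it does not exist.\<close>
  have int: "set_integrable lborel {0..1} (\<lambda>t. f j z t * F t)" if "j \<in> {1..m}" for j z
    unfolding F_def
  proof (intro set_integrable_ml_factor m c)
    have "continuous_on {0..1} (\<lambda>t::real. W_jm j m (of_real t * z))"
      by (rule continuous_on_compose2[OF continuous_on_W_jm[of j m UNIV]]) (use that in \<open>auto intro!: continuous_intros\<close>)
    then show "continuous_on {0..1} (f j z)" unfolding f_def by (intro continuous_intros)
  qed
  have S: "(\<Sum>j=1..m. C j * (LINT t:{0..1}|lborel. f j z t * F t)) = (LINT t:{0..1}|lborel. (\<Sum>j=1..m. C j * f j z t) * F t)" for z
  proof -
    have i: "set_integrable lborel {0..1} (\<lambda>t. C j * (f j z t * F t))" if "j \<in> {1..m}" for j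
      using int[OF that] by (rule set_integrable_mult_right)
    have "(LINT t:{0..1}|lborel. (\<Sum>j=1..m. C j * (f j z t * F t))) =
        (\<Sum>j=1..m. LINT t:{0..1}|lborel. C j * (f j z t * F t))"
      unfolding set_lebesgue_integral_def scaleR_sum_right
      by (rule Bochner_Integration.integral_sum) (use i in \<open>auto simp: set_integrable_def\<close>)
    then show ?thesis by (simp add: sum_distrib_right mult.assoc)
  qed
  have h: "(\<Sum>j=1..m. C j * (LINT t:{0..1}|lborel. f j z t * F t)) = kernel_half m c z w"
    "(\<Sum>j=1..m. C j * (LINT t:{0..1}|lborel. f j w t * F t)) = kernel_half m c w z"
    unfolding S unfolding f_def F_def C_def
    using green_integral[OF m2 c, of z w] green_integral[OF m2 c, of w z]
    by (simp_all add: mult.commute[of w z])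
  have "kappa_tilde m c z w = (\<Sum>j=1..m. C j * (LINT t:{0..1}|lborel. (z powr a * w powr a) * (f j z t * F t - f j w t * F t)))"
    unfolding kappa_tilde_def F_mc_ml_factor a_def f_def F_def C_def using False
    by (simp add: algebra_simps)
  also have "\<dots> = (\<Sum>j=1..m. C j * ((z powr a * w powr a) * ((LINT t:{0..1}|lborel. f j z t * F t) - (LINT t:{0..1}|lborel. f j w t * F t))))"
    using int by (intro sum.cong) (simp_all add: set_integral_diff)
  also have "\<dots> = (z powr a * w powr a) * ((\<Sum>j=1..m. C j * (LINT t:{0..1}|lborel. f j z t * F t)) - (\<Sum>j=1..m. C j * (LINT t:{0..1}|lborel. f j w t * F t)))"
    by (simp add: sum_distrib_left sum_subtractf algebra_simps)
  finally show ?thesis unfolding h .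
qed

subsection \<open>The scaling limit\<close>

text \<open>\<open>S z\<close> is X^(2m) for X = sqrt(2/\<lambda>) z^\<lambda> with \<lambda> = 1/m.
  The constant (2m)^m is also the one in r_N^2 = (2m)^m N^(-m), see
  \<open>micro_scale_square\<close>.\<close>

definition kernel_term :: "nat \<Rightarrow> real \<Rightarrow> nat \<Rightarrow> complex \<Rightarrow> complex \<Rightarrow> complex" where
  "kernel_term m c k z w =
     (let S = (\<lambda>u. of_real ((2 * real m) ^ m) * u\<^sup>2)
      in z * S z ^ k * kernel_coeff m c k (S w) - w * S w ^ k * kernel_coeff m c k (S z))"

lemma micro_scale_square:
  assumes m: "m \<ge> 1" and N: "N \<ge> 1"
  shows "(micro_scale (1 / real m) N)\<^sup>2 = (2 * real m) ^ m * real N powr (- real m)"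
proof -
  have "(micro_scale (1 / real m) N)\<^sup>2 = (real N / (2 * real m)) powr (- real m)"
    unfolding micro_scale_def by (simp add: power2_eq_square mult.commute flip: powr_add)
  also have "\<dots> = (2 * real m) powr (real m) * real N powr (- real m)"
    using m N by (simp add: powr_divide powr_minus field_simps)
  also have "(2 * real m) powr (real m) = (2 * real m) ^ m"
    using m by (simp add: powr_realpow)
  finally show ?thesis .
qed

text \<open>Count of the powers of N: r^3 together with one r from the odd monomial contributes -2m,
  the rest of that monomial -mk, and \<open>cpoly_even_poly_rescaled\<close> contributes m(k+2+c).
  The total mc does not depend on k.\<close>

lemma rescaled_pre_kernel_potential:
  assumes m: "m \<ge> 1" and c: "c > -1" and N: "N \<ge> 1"
    and q: "skew_orthogonal N (potential m c N) q s"
  shows "rescaled_pre_kernel (1 / real m) N q s z w =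
    of_real (real N powr (real m * c) * (2 * real m) ^ (2 * m - 1)) * (\<Sum>k<N. kernel_term m c k z w)"
proof -
  define r where "r = complex_of_real (micro_scale (1 / real m) N)"
  define n where "n x = complex_of_real (real N powr x)" for x
  define A where "A = complex_of_real ((2 * real m) ^ m)"
  define h where "h = moment m c N"
  define e where "e k u = kernel_coeff m c k (A * u\<^sup>2)" for k u
  have N0: "real N > 0" using N by simp
  have n_add: "n x * n y = n (x + y)" for x y by (simp add: n_def powr_add)
  have n_pow: "n x ^ k = n (x * real k)" for x k
    using N0 by (simp add: n_def powr_power mult.commute flip: of_real_power)
  have r2: "r\<^sup>2 = A * n (- real m)"
  proof -
    have "r\<^sup>2 = of_real ((micro_scale (1 / real m) N)\<^sup>2)" by (simp only: r_def of_real_power)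
    then show ?thesis by (simp only: micro_scale_square[OF m N] A_def n_def of_real_mult)
  qed
  have r4: "r ^ 3 * r = A\<^sup>2 * n (- 2 * real m)"
  proof -
    have "r ^ 3 * r = (r\<^sup>2)\<^sup>2" by (simp add: power2_eq_square power3_eq_cube)
    then show ?thesis unfolding r2 by (simp add: power_mult_distrib n_pow mult.commute)
  qed
  have E: "cpoly (even_poly h k) (r * u) / of_real (2 * h (2 * k + 1)) = n (real m * (real k + 2 + c)) / (2 * of_nat m) * e k u" for k u
    using cpoly_even_poly_rescaled[OF m c N, of "r * u" "A * u\<^sup>2" k]
    by (simp add: h_def e_def power_mult_distrib r2 n_def mult_ac)
  have odd: "(r * u) ^ (2 * k + 1) = r * u * n (- (real m * real k)) * (A * u\<^sup>2) ^ k" for k u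
  proof -
    have "(r * u) ^ (2 * k + 1) = r * u * (r\<^sup>2 * u\<^sup>2) ^ k" by (simp add: power_mult power_mult_distrib)
    also have "\<dots> = r * u * (n (- real m) ^ k * (A * u\<^sup>2) ^ k)" unfolding r2 by (simp add: power_mult_distrib)
    finally show ?thesis by (simp add: n_pow)
  qed
  have t: "r ^ 3 * ((r * u) ^ (2 * k + 1) * (cpoly (even_poly h k) (r * v) / of_real (2 * h (2 * k + 1)))) =
     n (real m * c) * (A\<^sup>2 / (2 * of_nat m)) * (u * (A * u\<^sup>2) ^ k * e k v)" for k u v
  proof -
    have "n (real m * c) = n (- 2 * real m) * n (- (real m * real k)) * n (real m * (real k + 2 + c))"
      unfolding n_add by (simp add: algebra_simps)
    then have "n (real m * c) * (A\<^sup>2 / (2 * of_nat m)) * (u * (A * u\<^sup>2) ^ k * e k v) =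
      (A\<^sup>2 * n (- 2 * real m)) * u * n (- (real m * real k)) * (A * u\<^sup>2) ^ k * (n (real m * (real k + 2 + c)) / (2 * of_nat m) * e k v)"
      by simp
    then show ?thesis unfolding odd E r4[symmetric] by (simp only: mult_ac)
  qed
  have AA: "A\<^sup>2 / (2 * of_nat m) = of_real ((2 * real m) ^ (2 * m - 1))"
  proof -
    define P where "P = (2 * real m) ^ (2 * m - 1)"
    have "P * (2 * real m) = (2 * real m) ^ (2 * m)"
      unfolding P_def by (rule power_minus_mult) (use m in simp)
    then have "((2 * real m) ^ m)\<^sup>2 = P * (2 * real m)"
      by (simp only: power_mult[symmetric] mult.commute)
    then have "A\<^sup>2 = of_real P * (2 * of_nat m)"
      by (simp only: A_def of_real_power[symmetric]) simp
    then show ?thesis unfolding P_def[symmetric] using m by simp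
  qed
  have "rescaled_pre_kernel (1 / real m) N q s z w = (\<Sum>k<N.
     r ^ 3 * ((r * z) ^ (2 * k + 1) * (cpoly (even_poly h k) (r * w) / of_real (2 * h (2 * k + 1)))) -
     r ^ 3 * ((r * w) ^ (2 * k + 1) * (cpoly (even_poly h k) (r * z) / of_real (2 * h (2 * k + 1)))))"
    unfolding rescaled_pre_kernel_def Let_def r_def[symmetric] pre_kernel_potential[OF m c N q] h_def[symmetric] sum_distrib_left
    by (intro sum.cong refl) (simp only: diff_divide_distrib right_diff_distrib times_divide_eq_left times_divide_eq_right mult_ac)
  also have "\<dots> = n (real m * c) * (A\<^sup>2 / (2 * of_nat m)) * (\<Sum>k<N. kernel_term m c k z w)"
    unfolding t sum_distrib_left
    by (intro sum.cong refl) (simp only: kernel_term_def Let_def e_def A_def right_diff_distrib)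
  finally show ?thesis unfolding AA n_def by simp
qed

text \<open>Since r_N^(2/m) = 2m/N, the factor N/2 cancels in the radial part. The logarithm gives
  (r_N |z|)^c per point; for two points r_N^(2c) is a constant times N^(-mc), which removes the
  power of N left in the pre-kernel.\<close>

lemma exp_potential_rescaled:
  assumes m: "m \<ge> 1" and N: "N \<ge> 1" and z: "z \<noteq> 0"
  shows "exp (- (real N / 2 * potential m c N (of_real (micro_scale (1 / real m) N) * z))) =
     exp (- (cmod z powr (2 * (1 / real m)) / (1 / real m))) *
     (micro_scale (1 / real m) N powr c * cmod z powr c)"
proof -
  define r where "r = micro_scale (1 / real m) N"
  have r: "r > 0" using m N by (simp add: r_def micro_scale_def)
  have rp: "r powr (2 / real m) = 2 * real m / real N"
  proof -
    have "r powr (2 / real m) = (r powr 2) powr (1 / real m)" by (simp add: powr_powr)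
    also have "r powr 2 = ((2 * real m) / real N) powr real m"
      using micro_scale_square[OF m N] r m N
      by (simp add: r_def powr_divide powr_minus powr_realpow field_simps)
    also have "\<dots> powr (1 / real m) = 2 * real m / real N" using m N by (simp add: powr_powr)
    finally show ?thesis .
  qed
  have "real N / 2 * potential m c N (of_real r * z) =
     real N / 2 * (r * cmod z) powr (2 / real m) - c * ln (r * cmod z)"
    unfolding potential_def using r N by (simp add: norm_mult field_simps)
  also have "(r * cmod z) powr (2 / real m) = 2 * real m / real N * cmod z powr (2 / real m)"
    using r by (simp add: powr_mult rp)
  also have "real N / 2 * (2 * real m / real N * cmod z powr (2 / real m)) = real m * cmod z powr (2 / real m)"
    using N by simp
  finally have e: "real N / 2 * potential m c N (of_real r * z) =
     real m * cmod z powr (2 / real m) - c * ln (r * cmod z)" .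
  have e': "- (real N / 2 * potential m c N (of_real r * z)) =
     - (real m * cmod z powr (2 / real m)) + c * ln (r * cmod z)" unfolding e by simp
  have e'': "exp (c * ln (r * cmod z)) = r powr c * cmod z powr c"
    using r z by (simp add: powr_def ln_mult exp_add algebra_simps)
  show ?thesis unfolding r_def[symmetric] e' exp_add e'' by (simp add: mult.commute)
qed

text \<open>This is (z/|z|)^c with the principal branch. On the negative axis the condition h(z)
  h(cnj z) = 1 reads h(z)^2 = 1, which the boundary value exp(i pi c) violates in general; hence the
  value 1 there.\<close>

definition phase :: "real \<Rightarrow> complex \<Rightarrow> complex" where
  "phase c z = (if z \<in> slit_plane then exp (\<i> * of_real (c * Im (Ln z))) else 1)"

lemma cnj_slit_plane: "cnj z \<in> slit_plane \<longleftrightarrow> z \<in> slit_plane"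
  by (auto simp: complex_nonpos_Reals_iff)

text \<open>Here the non-holomorphic |z|^c of the weight and the cocycle merge into a holomorphic
  power.\<close>

lemma norm_phase_mult:
  assumes "z \<in> slit_plane"
  shows "of_real (cmod z powr c) * phase c z = z powr of_real c"
proof -
  have z: "z \<noteq> 0" using assms by auto
  have L: "Ln z = of_real (ln (cmod z)) + \<i> * of_real (Im (Ln z))"
    using complex_eq[of "Ln z"] z by (simp add: Re_Ln)
  have "of_real c * Ln z = of_real (c * ln (cmod z)) + \<i> * of_real (c * Im (Ln z))"
    by (subst L) (simp add: algebra_simps)
  then have "z powr of_real c = exp (of_real (c * ln (cmod z))) * exp (\<i> * of_real (c * Im (Ln z)))"
    using z by (simp only: powr_def exp_add if_False)
  also have "exp (complex_of_real (c * ln (cmod z))) = of_real (cmod z powr c)"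
    using z by (simp add: powr_def flip: exp_of_real)
  finally show ?thesis using assms by (simp add: phase_def)
qed

lemma cocycle_phase: "cocycle (\<lambda>z w. phase c z * phase c w)"
  unfolding cocycle_def
proof (intro exI[of _ "phase c"] conjI allI)
  show "norm (phase c z) = 1" for z by (simp add: phase_def)
  show "phase c z * phase c (cnj z) = 1" for z
  proof (cases "z \<in> slit_plane")
    case True
    then have "Ln (cnj z) = cnj (Ln z)" by (simp add: cnj_Ln)
    then show ?thesis using True cnj_slit_plane[of z] by (simp add: phase_def flip: exp_add)
  next
    case False
    then show ?thesis using cnj_slit_plane[of z] by (simp add: phase_def)
  qed
  have "continuous_on slit_plane (\<lambda>z. exp (\<i> * of_real (c * Im (Ln z))))"
    by (intro continuous_intros) auto
  then show "continuous_on slit_plane (phase c)"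
    by (rule continuous_on_eq) (simp add: phase_def)
qed auto

text \<open>An identity at each N, not only in the limit. All four entries share the weight at (z,
  w), and conjugation keeps the modulus, so |z|^c |w|^c can be moved into each entry as |x|^c |y|^c,
  where \<open>norm_phase_mult\<close> applies.\<close>

lemma matrix_kernel_rescaled:
  assumes m: "m \<ge> 1" and c: "c > -1" and N: "N \<ge> 1"
    and q: "skew_orthogonal N (potential m c N) q s"
    and z: "z \<in> slit_plane" and w: "w \<in> slit_plane"
  shows "matrix_kernel (\<lambda>x. real N / 2 * potential m c N (of_real (micro_scale (1 / real m) N) * x))
       (cocycle_mult (\<lambda>z w. phase c z * phase c w) (rescaled_pre_kernel (1 / real m) N q s)) z w =
     matrix_kernel (\<lambda>x. norm x powr (2 * (1 / real m)) / (1 / real m))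
       (\<lambda>z w. of_real ((2 * real m) powr (real m * c + 2 * real m - 1)) * (z powr of_real c * w powr of_real c) *
          (\<Sum>k<N. kernel_term m c k z w)) z w"
proof -
  define V where "V x = real N / 2 * potential m c N (of_real (micro_scale (1 / real m) N) * x)" for x
  define V' where "V' x = cmod x powr (2 * (1 / real m)) / (1 / real m)" for x
  define \<kappa> where "\<kappa> = cocycle_mult (\<lambda>z w. phase c z * phase c w) (rescaled_pre_kernel (1 / real m) N q s)"
  define \<kappa>' where "\<kappa>' z w = of_real ((2 * real m) powr (real m * c + 2 * real m - 1)) * (z powr of_real c * w powr of_real c) *
          (\<Sum>k<N. kernel_term m c k z w)" for z w
  define r where "r = micro_scale (1 / real m) N"
  have r: "r > 0" using m N by (simp add: r_def micro_scale_def)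
  have rc: "r powr c * r powr c * (real N powr (real m * c) * (2 * real m) ^ (2 * m - 1)) = (2 * real m) powr (real m * c + 2 * real m - 1)"
  proof -
    have p: "(2 * real m) ^ (2 * m - 1) = (2 * real m) powr (2 * real m - 1)"
      using m by (subst powr_realpow[symmetric]) (auto simp: of_nat_diff)
    have "r powr c * r powr c = (r\<^sup>2) powr c" using r by (simp add: power2_eq_square powr_mult)
    also have "\<dots> = ((2 * real m) powr real m * real N powr (- real m)) powr c"
      unfolding r_def micro_scale_square[OF m N] using m by (simp add: powr_realpow)
    also have "\<dots> = (2 * real m) powr (real m * c) * real N powr (- (real m * c))"
      by (simp add: powr_mult powr_powr)
    finally have "r powr c * r powr c * (real N powr (real m * c) * (2 * real m) powr (2 * real m - 1)) =
      (2 * real m) powr (real m * c) * (2 * real m) powr (2 * real m - 1) * (real N powr (- (real m * c)) * real N powr (real m * c))"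
      by (simp only: mult_ac)
    also have "real N powr (- (real m * c)) * real N powr (real m * c) = 1"
      using N by (simp flip: powr_add)
    also have "(2 * real m) powr (real m * c) * (2 * real m) powr (2 * real m - 1) = (2 * real m) powr (real m * c + 2 * real m - 1)"
      unfolding powr_add[symmetric] by (simp add: algebra_simps)
    finally show ?thesis unfolding p by simp
  qed
  have entry: "exp (- (V z + V w)) *\<^sub>R \<kappa> x y = exp (- (V' z + V' w)) *\<^sub>R \<kappa>' x y"
    if x: "x \<in> slit_plane" "cmod x = cmod z" and y: "y \<in> slit_plane" "cmod y = cmod w" for x y
  proof -
    have exp_neg_add: "exp (- (a + b)) = exp (- a) * exp (- b)" for a b :: real
      by (simp flip: exp_add)
    have V: "exp (- V z) = exp (- V' z) * (r powr c * cmod x powr c)"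
      "exp (- V w) = exp (- V' w) * (r powr c * cmod y powr c)"
      unfolding V_def V'_def r_def x(2) y(2) using z w by (intro exp_potential_rescaled m N; auto)+
    have "exp (- (V z + V w)) = exp (- (V' z + V' w)) * (r powr c * r powr c) * (cmod x powr c * cmod y powr c)"
      unfolding exp_neg_add V by (simp only: mult_ac)
    then have "exp (- (V z + V w)) *\<^sub>R \<kappa> x y = exp (- (V' z + V' w)) *\<^sub>R
       (of_real (r powr c * r powr c * (real N powr (real m * c) * (2 * real m) ^ (2 * m - 1))) *
        ((of_real (cmod x powr c) * phase c x) * (of_real (cmod y powr c) * phase c y)) * (\<Sum>k<N. kernel_term m c k x y))"
      unfolding \<kappa>_def cocycle_mult_def rescaled_pre_kernel_potential[OF m c N q]
      by (simp add: scaleR_conv_of_real mult_ac)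
    then show ?thesis unfolding rc norm_phase_mult[OF x(1)] norm_phase_mult[OF y(1)] \<kappa>'_def .
  qed
  have scale: "a *\<^sub>R (vector [vector [x1, x2], vector [x3, x4]] :: complex^2^2) =
      vector [vector [a *\<^sub>R x1, a *\<^sub>R x2], vector [a *\<^sub>R x3, a *\<^sub>R x4]]" for a x1 x2 x3 x4
    by (simp add: vec_eq_iff forall_2)
  have "matrix_kernel V \<kappa> z w = matrix_kernel V' \<kappa>' z w"
    unfolding matrix_kernel_def scale
    using entry[of z w] entry[of z "cnj w"] entry[of "cnj z" w] entry[of "cnj z" "cnj w"]
      z w cnj_slit_plane[of z] cnj_slit_plane[of w] by simp
  then show ?thesis unfolding V_def[abs_def] V'_def[abs_def] \<kappa>_def \<kappa>'_def[abs_def] .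
qed

text \<open>M-test with the majorant of \<open>kernel_coeff_bound\<close>. The terms are polynomials
  in z and w; the cuts come in only with z^c w^c.\<close>

lemma uniform_limit_kernel_sum:
  assumes m: "m \<ge> 1" and c: "c > -1" and K: "bounded K"
  shows "uniform_limit K (\<lambda>N (z, w). \<Sum>k<N. kernel_term m c k z w) (\<lambda>(z, w). \<Sum>k. kernel_term m c k z w) sequentially"
proof -
  obtain \<rho> where \<rho>: "\<And>x. x \<in> K \<Longrightarrow> norm x \<le> \<rho>" and \<rho>0: "\<rho> > 0"
    using K bounded_pos by blast
  define A where "A = (2 * real m) ^ m"
  have A: "A \<ge> 0" by (simp add: A_def)
  define R where "R = A * \<rho>\<^sup>2"
  have R: "R \<ge> 0" using A by (simp add: R_def)
  obtain E where E: "rapid E" "\<And>k u. norm u \<le> R \<Longrightarrow> norm (kernel_coeff m c k u) \<le> E k"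
    using kernel_coeff_bound[OF m c R] by blast
  have E0: "E k \<ge> 0" for k
    using E(2)[of 0 k] R norm_ge_zero[of "kernel_coeff m c k 0"] unfolding norm_zero by linarith
  have bd: "norm (z * (of_real A * z\<^sup>2) ^ k * kernel_coeff m c k (of_real A * w\<^sup>2)) \<le> \<rho> * R ^ k * E k"
    if zw: "norm z \<le> \<rho>" "norm w \<le> \<rho>" for z w k
  proof -
    have S: "norm (of_real A * u\<^sup>2) \<le> R" if "norm u \<le> \<rho>" for u :: complex
      using that A by (auto simp: R_def norm_mult norm_power intro!: mult_left_mono power_mono)
    show ?thesis unfolding norm_mult[of "_ * _"] norm_mult[of z] norm_power[of "of_real A * z\<^sup>2"]
      using zw S[OF zw(1)] E(2)[OF S[OF zw(2)]] \<rho>0 R E0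
      by (intro mult_mono power_mono) (auto intro!: mult_nonneg_nonneg)
  qed
  have "uniform_limit K (\<lambda>N x. \<Sum>k<N. case x of (z, w) \<Rightarrow> kernel_term m c k z w)
      (\<lambda>x. \<Sum>k. case x of (z, w) \<Rightarrow> kernel_term m c k z w) sequentially"
  proof (rule Weierstrass_m_test)
    show "summable (\<lambda>k. 2 * \<rho> * (norm (E k) * R ^ k))"
      by (intro summable_mult rapid_summable_norm E(1) R)
    fix k :: nat and x assume x: "x \<in> K"
    obtain z w where xzw: "x = (z, w)" by (cases x)
    have n: "norm z \<le> \<rho>" "norm w \<le> \<rho>"
      using order_trans[OF norm_fst_le \<rho>[OF x[unfolded xzw]]] order_trans[OF norm_snd_le \<rho>[OF x[unfolded xzw]]] .
    have "norm (kernel_term m c k z w) \<le> \<rho> * R ^ k * E k + \<rho> * R ^ k * E k"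
      unfolding kernel_term_def Let_def A_def[symmetric]
      by (intro order_trans[OF norm_triangle_ineq4] add_mono bd n)
    then show "norm (case x of (z, w) \<Rightarrow> kernel_term m c k z w) \<le> 2 * \<rho> * (norm (E k) * R ^ k)"
      using E0 by (simp add: xzw mult_ac)
  qed
  then show ?thesis by (simp add: case_prod_unfold)
qed

lemma kernel_coeff_holomorphic: "(\<lambda>u. kernel_coeff m c k u) holomorphic_on S"
proof (induction k)
  case (Suc k)
  then show ?case unfolding kernel_coeff.simps divide_inverse by (intro holomorphic_intros)
qed simp

lemma kernel_sum_holomorphic:
  assumes m: "m \<ge> 1" and c: "c > -1" and S: "open S"
  shows "(\<lambda>z. \<Sum>k. kernel_term m c k z w) holomorphic_on S"
proof (rule holomorphic_uniform_sequence[OF S, where f = "\<lambda>n z. \<Sum>k<n. kernel_term m c k z w"])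
  fix n
  have "(\<lambda>z. kernel_coeff m c k (of_real ((2 * real m) ^ m) * z\<^sup>2)) holomorphic_on S" for k
  proof -
    have "kernel_coeff m c k \<circ> (\<lambda>z. of_real ((2 * real m) ^ m) * z\<^sup>2) holomorphic_on S"
      by (intro holomorphic_on_compose kernel_coeff_holomorphic holomorphic_on_mult holomorphic_on_const
            holomorphic_on_power holomorphic_on_ident)
    then show ?thesis by (simp only: o_def)
  qed
  then show "(\<lambda>z. \<Sum>k<n. kernel_term m c k z w) holomorphic_on S"
    unfolding kernel_term_def Let_def
    by (intro holomorphic_on_sum holomorphic_on_diff holomorphic_on_mult holomorphic_on_const
          holomorphic_on_power holomorphic_on_ident)
next
  fix x assume "x \<in> S"
  then obtain d where d: "d > 0" "cball x d \<subseteq> S" using S open_contains_cball by blast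
  have "bounded (cball x d \<times> {w})" by (intro bounded_Times) auto
  note lim = uniform_limit_kernel_sum[OF m c this]
  have "uniform_limit (cball x d) (\<lambda>n z. \<Sum>k<n. kernel_term m c k z w) (\<lambda>z. \<Sum>k. kernel_term m c k z w) sequentially"
    unfolding uniform_limit_iff
  proof (intro allI impI)
    fix \<epsilon> :: real assume "\<epsilon> > 0"
    from uniform_limitD[OF lim this]
    show "\<forall>\<^sub>F n in sequentially. \<forall>z\<in>cball x d. dist (\<Sum>k<n. kernel_term m c k z w) (\<Sum>k. kernel_term m c k z w) < \<epsilon>"
      by eventually_elim auto
  qed
  with d show "\<exists>d>0. cball x d \<subseteq> S \<and> uniform_limit (cball x d) (\<lambda>n z. \<Sum>k<n. kernel_term m c k z w)
      (\<lambda>z. \<Sum>k. kernel_term m c k z w) sequentially" by blast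
qed

text \<open>Holomorphy of the limit in w follows from holomorphy in z by this antisymmetry.\<close>

lemma kernel_term_swap: "kernel_term m c k w z = - kernel_term m c k z w"
  by (simp add: kernel_term_def Let_def)

section \<open>From pre-kernels to matrix kernels\<close>

lemma norm_vec_le_sum: "norm (x :: 'a::real_normed_vector ^ 'n) \<le> (\<Sum>i\<in>UNIV. norm (x $ i))"
  unfolding norm_vec_def by (rule L2_set_le_sum) simp

text \<open>The weight exp(-V z - V w) is at most 1, and the norm of a matrix is at most the sum of
  the norms of its entries.\<close>

lemma dist_matrix_kernel:
  assumes V: "\<And>x. V x \<ge> 0"
  shows "dist (matrix_kernel V \<kappa> z w) (matrix_kernel V \<kappa>' z w) \<le>
    dist (\<kappa> z w) (\<kappa>' z w) + dist (\<kappa> z (cnj w)) (\<kappa>' z (cnj w)) +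
    dist (\<kappa> (cnj z) w) (\<kappa>' (cnj z) w) + dist (\<kappa> (cnj z) (cnj w)) (\<kappa>' (cnj z) (cnj w))"
proof -
  define e where "e = exp (- (V z + V w))"
  have e: "0 \<le> e" "e \<le> 1" using V[of z] V[of w] by (auto simp: e_def)
  define M where "M = (vector [vector [\<kappa> z w - \<kappa>' z w, \<kappa> z (cnj w) - \<kappa>' z (cnj w)],
     vector [\<kappa> (cnj z) w - \<kappa>' (cnj z) w, \<kappa> (cnj z) (cnj w) - \<kappa>' (cnj z) (cnj w)]] :: complex^2^2)"
  have "matrix_kernel V \<kappa> z w - matrix_kernel V \<kappa>' z w = e *\<^sub>R M"
    by (simp add: matrix_kernel_def M_def e_def vec_eq_iff forall_2 algebra_simps)
  then have "dist (matrix_kernel V \<kappa> z w) (matrix_kernel V \<kappa>' z w) = e * norm M"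
    using e by (simp add: dist_norm)
  also have "\<dots> \<le> 1 * norm M" using e by (intro mult_right_mono) auto
  also have "1 * norm M \<le> (\<Sum>i\<in>UNIV. norm (vec_nth M i))"
    using norm_vec_le_sum[of M] by simp
  also have "\<dots> \<le> (\<Sum>i\<in>UNIV. \<Sum>j\<in>UNIV. norm (vec_nth (vec_nth M i) j))"
    by (intro sum_mono norm_vec_le_sum)
  finally show ?thesis by (simp add: sum_2 M_def dist_norm)
qed

text \<open>Entries at conjugate points are handled by applying \<open>U\<close> to the image of C
  under conjugation of one or both variables, which is again compact and off the cuts.\<close>

lemma uniform_limit_matrix_kernel:
  assumes V: "\<And>x. V x \<ge> 0" and C: "compact C" "C \<subseteq> slit_plane \<times> slit_plane"
    and U: "\<And>K. compact K \<Longrightarrow> K \<subseteq> slit_plane \<times> slit_plane \<Longrightarrow>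
      uniform_limit K (\<lambda>N (z, w). \<kappa> N z w) (\<lambda>(z, w). \<kappa>' z w) sequentially"
  shows "uniform_limit C (\<lambda>N (z, w). matrix_kernel V (\<kappa> N) z w) (\<lambda>(z, w). matrix_kernel V \<kappa>' z w) sequentially"
  unfolding uniform_limit_iff
proof (intro allI impI)
  fix \<epsilon> :: real assume \<epsilon>: "\<epsilon> > 0"
  have ev: "\<forall>\<^sub>F N in sequentially. \<forall>(z, w)\<in>C. dist (\<kappa> N (f z) (g w)) (\<kappa>' (f z) (g w)) < \<epsilon> / 4"
    if f: "continuous_on UNIV f" "\<And>z. z \<in> slit_plane \<Longrightarrow> f z \<in> slit_plane"
      and g: "continuous_on UNIV g" "\<And>z. z \<in> slit_plane \<Longrightarrow> g z \<in> slit_plane" for f g :: "complex \<Rightarrow> complex"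
  proof -
    define \<phi> where "\<phi> = (\<lambda>(z, w). (f z, g w))"
    have "continuous_on C \<phi>" unfolding \<phi>_def case_prod_unfold
      by (intro continuous_on_Pair continuous_on_compose2[OF f(1)] continuous_on_compose2[OF g(1)] continuous_intros) auto
    then have "compact (\<phi> ` C)" using C by (intro compact_continuous_image)
    moreover have "\<phi> ` C \<subseteq> slit_plane \<times> slit_plane"
    proof (rule image_subsetI)
      fix x assume "x \<in> C"
      then have x: "x \<in> slit_plane \<times> slit_plane" using C(2) by (rule subsetD[rotated])
      show "\<phi> x \<in> slit_plane \<times> slit_plane" unfolding \<phi>_def case_prod_unfold
        by (rule SigmaI; rule f(2) g(2)) (use mem_Times_iff[of x] x in blast)+
    qed
    ultimately have "uniform_limit (\<phi> ` C) (\<lambda>N (z, w). \<kappa> N z w) (\<lambda>(z, w). \<kappa>' z w) sequentially" by (rule U)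
    then have "\<forall>\<^sub>F N in sequentially. \<forall>x\<in>\<phi> ` C. dist (case x of (z, w) \<Rightarrow> \<kappa> N z w) (case x of (z, w) \<Rightarrow> \<kappa>' z w) < \<epsilon> / 4"
      using \<epsilon> by (intro uniform_limitD) auto
    then show ?thesis by eventually_elim (auto simp: \<phi>_def)
  qed
  have cnj: "continuous_on UNIV cnj" "\<And>z. z \<in> slit_plane \<Longrightarrow> cnj z \<in> slit_plane"
    by (intro continuous_intros) (simp only: cnj_slit_plane)
  have id: "continuous_on UNIV (\<lambda>z::complex. z)" by (rule continuous_on_id)
  have e1: "\<forall>\<^sub>F N in sequentially. \<forall>(z, w)\<in>C. dist (\<kappa> N z w) (\<kappa>' z w) < \<epsilon> / 4"
    by (rule ev[OF id _ id])
  have e2: "\<forall>\<^sub>F N in sequentially. \<forall>(z, w)\<in>C. dist (\<kappa> N z (cnj w)) (\<kappa>' z (cnj w)) < \<epsilon> / 4"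
    by (rule ev[OF id _ cnj])
  have e3: "\<forall>\<^sub>F N in sequentially. \<forall>(z, w)\<in>C. dist (\<kappa> N (cnj z) w) (\<kappa>' (cnj z) w) < \<epsilon> / 4"
    by (rule ev[OF cnj id])
  have e4: "\<forall>\<^sub>F N in sequentially. \<forall>(z, w)\<in>C. dist (\<kappa> N (cnj z) (cnj w)) (\<kappa>' (cnj z) (cnj w)) < \<epsilon> / 4"
    by (rule ev[OF cnj cnj])
  show "\<forall>\<^sub>F N in sequentially. \<forall>x\<in>C. dist (case x of (z, w) \<Rightarrow> matrix_kernel V (\<kappa> N) z w)
       (case x of (z, w) \<Rightarrow> matrix_kernel V \<kappa>' z w) < \<epsilon>"
    using e1 e2 e3 e4
  proof eventually_elim
    case (elim N)
    show ?case
    proof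
      fix x assume x: "x \<in> C"
      obtain z w where zw: "x = (z, w)" by (cases x)
      show "dist (case x of (z, w) \<Rightarrow> matrix_kernel V (\<kappa> N) z w) (case x of (z, w) \<Rightarrow> matrix_kernel V \<kappa>' z w) < \<epsilon>"
        using dist_matrix_kernel[of V "\<kappa> N" z w \<kappa>', OF V] elim(1-4)[THEN bspec, OF x] unfolding zw prod.case
        by linarith
    qed
  qed
qed

text \<open>With X = sqrt(2/\<lambda>) z^\<lambda> the powers X^m and X^(2m) are multiples of z and
  z^2, and z^(\<lambda>-1) X^a is a multiple of z^c because \<lambda> - 1 + a \<lambda> = c. The
  constants multiply to (2m)^(m+a).\<close>

lemma limit_kernel_eq:
  assumes m: "m \<ge> 1" and c: "c > -1" and z: "z \<in> slit_plane" and w: "w \<in> slit_plane"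
  defines "lam \<equiv> 1 / real m"
  shows "of_real ((2 / lam) powr (1 / (2 * lam))) * (z powr of_real (lam - 1) * w powr of_real (lam - 1)) *
      kappa_tilde m c (of_real (sqrt (2 / lam)) * z powr of_real lam) (of_real (sqrt (2 / lam)) * w powr of_real lam) =
     of_real ((2 * real m) powr (real m * c + 2 * real m - 1)) * (z powr of_real c * w powr of_real c) *
       (\<Sum>k. kernel_term m c k z w)"
proof -
  define b where "b = 2 * real m"
  have b: "b > 0" using m by (simp add: b_def)
  have lam: "lam > 0" "lam \<le> 1" "lam * real m = 1" using m by (auto simp: lam_def)
  have lam2: "1 / (2 * lam) = real m / 2" by (simp add: lam_def)
  have bl: "2 / lam = b" by (simp add: lam_def b_def)
  define a where "a = real m * (1 + c) - 1"
  define A where "A = (2 * real m) ^ m"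
  define X where "X z = of_real (sqrt b) * z powr of_real lam" for z :: complex
  have Xm: "X z ^ m = of_real (b powr (real m / 2)) * z" if "z \<in> slit_plane" for z
  proof -
    have z0: "z \<noteq> 0" using that by auto
    have "(z powr of_real lam) ^ m = exp (of_nat m * (of_real lam * Ln z))"
      using z0 by (simp add: powr_def exp_of_nat_mult)
    also have "of_nat m * (of_real lam * Ln z) = of_real (lam * real m) * Ln z" by simp
    finally have "(z powr of_real lam) ^ m = z" using z0 lam(3) by simp
    moreover have "sqrt b ^ m = b powr (real m / 2)"
      using b by (simp add: powr_half_sqrt[symmetric] powr_power)
    ultimately show ?thesis unfolding X_def power_mult_distrib by (metis of_real_power)
  qed
  have X2m: "X z ^ (2 * m) = of_real A * z\<^sup>2" if "z \<in> slit_plane" for z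
  proof -
    have "(b powr (real m / 2))\<^sup>2 = A"
      using b by (simp add: power2_eq_square powr_realpow A_def b_def flip: powr_add)
    moreover have "X z ^ (2 * m) = (X z ^ m)\<^sup>2" by (simp add: power_even_eq)
    ultimately show ?thesis unfolding Xm[OF that] power_mult_distrib by (metis of_real_power)
  qed
  have Xp: "z powr of_real (lam - 1) * X z powr of_real a = of_real (b powr (a / 2)) * z powr of_real c"
    if "z \<in> slit_plane" for z
  proof -
    have z0: "z \<noteq> 0" using that by auto
    have XE: "X z = exp (of_real (ln b / 2) + of_real lam * Ln z)"
    proof -
      have "sqrt b = exp (ln b / 2)"
        using b by (simp add: powr_half_sqrt[symmetric] powr_def)
      then have "complex_of_real (sqrt b) = exp (of_real (ln b / 2))"
        by (simp only: exp_of_real)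
      then show ?thesis using z0 by (simp add: X_def powr_def exp_add)
    qed
    have "\<bar>Im (Ln z)\<bar> < pi"
      using that Im_Ln_less_pi[of z] mpi_less_Im_Ln[OF z0] by (simp add: abs_less_iff)
    \<comment> \<open>\<lambda> <= 1 keeps \<lambda> Ln z in the strip of the principal logarithm,
      so that (z^\<lambda>)^a = z^(\<lambda> a).\<close>
    then have "\<bar>lam * Im (Ln z)\<bar> < pi"
      using lam(1,2) mult_mono[of lam 1 "\<bar>Im (Ln z)\<bar>" "\<bar>Im (Ln z)\<bar>"] by (simp add: abs_mult)
    then have LX: "Ln (X z) = of_real (ln b / 2) + of_real lam * Ln z"
      unfolding XE by (intro Ln_exp) auto
    have X0: "X z \<noteq> 0" unfolding XE by simp
    have "z powr of_real (lam - 1) * X z powr of_real a =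
        exp (of_real (lam - 1) * Ln z + of_real a * (of_real (ln b / 2) + of_real lam * Ln z))"
      using z0 X0 by (simp add: powr_def LX exp_add)
    also have "of_real (lam - 1) * Ln z + of_real a * (of_real (ln b / 2) + of_real lam * Ln z) =
        of_real (a / 2 * ln b) + of_real (lam - 1 + a * lam) * Ln z"
      by (simp add: algebra_simps)
    also have "lam - 1 + a * lam = c"
    proof -
      have "a * lam = (lam * real m) * (1 + c) - lam" by (simp add: a_def algebra_simps)
      then show ?thesis unfolding lam(3) by simp
    qed
    also have "exp (of_real (a / 2 * ln b) + of_real c * Ln z) = exp (of_real (a / 2 * ln b)) * exp (of_real c * Ln z)"
      by (rule exp_add)
    also have "exp (complex_of_real (a / 2 * ln b)) = of_real (b powr (a / 2))"
      unfolding exp_of_real using b by (simp add: powr_def)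
    also have "exp (of_real c * Ln z) = z powr of_real c"
      using z0 by (simp add: powr_def)
    finally show ?thesis .
  qed
  have s: "summable (\<lambda>k. (of_real A * u\<^sup>2) ^ k * kernel_coeff m c k (of_real A * v\<^sup>2))" for u v
    using rapid_summable[OF rapid_kernel_coeff[OF m c]] by (simp add: mult.commute)
  have kh: "kernel_half m c (X u) (X v) = of_real (b powr (real m / 2)) *
      (u * (\<Sum>k. (of_real A * u\<^sup>2) ^ k * kernel_coeff m c k (of_real A * v\<^sup>2)))"
    if "u \<in> slit_plane" "v \<in> slit_plane" for u v
    unfolding kernel_half_def power_mult[of _ "2 * m"] X2m[OF that(1)] X2m[OF that(2)] Xm[OF that(1)]
    by (simp add: mult_ac)
  have sum: "u * (\<Sum>k. (of_real A * u\<^sup>2) ^ k * kernel_coeff m c k (of_real A * v\<^sup>2)) =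
      (\<Sum>k. u * (of_real A * u\<^sup>2) ^ k * kernel_coeff m c k (of_real A * v\<^sup>2))"
    "summable (\<lambda>k. u * (of_real A * u\<^sup>2) ^ k * kernel_coeff m c k (of_real A * v\<^sup>2))" for u v
    using suminf_mult[OF s, of u u v] summable_mult[OF s, of u u v] by (simp_all add: mult.assoc)
  have diff: "kernel_half m c (X z) (X w) - kernel_half m c (X w) (X z) =
     of_real (b powr (real m / 2)) * (\<Sum>k. kernel_term m c k z w)"
    unfolding kh[OF z w] kh[OF w z] sum right_diff_distrib[symmetric] kernel_term_def Let_def A_def[symmetric]
    by (subst suminf_diff[OF sum(2) sum(2)]) simp
  have "of_real ((2 / lam) powr (1 / (2 * lam))) * (z powr of_real (lam - 1) * w powr of_real (lam - 1)) *
      kappa_tilde m c (of_real (sqrt (2 / lam)) * z powr of_real lam) (of_real (sqrt (2 / lam)) * w powr of_real lam)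
    = of_real (b powr (real m / 2)) * ((z powr of_real (lam - 1) * X z powr of_real a) * (w powr of_real (lam - 1) * X w powr of_real a)) *
      (kernel_half m c (X z) (X w) - kernel_half m c (X w) (X z))"
    unfolding bl lam2 X_def[symmetric] kappa_tilde_series[OF m c] a_def[symmetric]
    by (simp only: mult_ac)
  also have "\<dots> = of_real (b powr (real m / 2) * b powr (a / 2) * b powr (a / 2) * b powr (real m / 2)) * (z powr of_real c * w powr of_real c) *
       (\<Sum>k. kernel_term m c k z w)"
    unfolding Xp[OF z] Xp[OF w] diff by (simp add: mult_ac)
  also have "b powr (real m / 2) * b powr (a / 2) * b powr (a / 2) * b powr (real m / 2) = b powr (real m * c + 2 * real m - 1)"
    unfolding powr_add[symmetric] by (simp add: a_def algebra_simps)
  finally show ?thesis by (simp add: b_def)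
qed

theorem theorem2p4:
  fixes m :: nat and lam c :: real
    and q :: "nat \<Rightarrow> nat \<Rightarrow> real poly" and s :: "nat \<Rightarrow> nat \<Rightarrow> real"
  assumes "m \<ge> 1" and "lam = 1 / real m" and "c > -1"
    and "\<And>N. N \<ge> 1 \<Longrightarrow> skew_orthogonal N (potential m c N) (q N) (s N)"
  shows "limiting_pre_kernel lam (potential m c) q s
           (\<lambda>z w. of_real ((2 / lam) powr (1 / (2 * lam))) *
                  (z powr of_real (lam - 1) * w powr of_real (lam - 1)) *
                  kappa_tilde m c (of_real (sqrt (2 / lam)) * z powr of_real lam)
                                  (of_real (sqrt (2 / lam)) * w powr of_real lam))"
proof -
  note m = assms(1) and c = assms(3)
  define \<kappa> where "\<kappa> z w = of_real ((2 / lam) powr (1 / (2 * lam))) *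
                  (z powr of_real (lam - 1) * w powr of_real (lam - 1)) *
                  kappa_tilde m c (of_real (sqrt (2 / lam)) * z powr of_real lam)
                                  (of_real (sqrt (2 / lam)) * w powr of_real lam)" for z w
  define D where "D = complex_of_real ((2 * real m) powr (real m * c + 2 * real m - 1))"
  define \<kappa>N where "\<kappa>N N z w = D * (z powr of_real c * w powr of_real c) * (\<Sum>k<N. kernel_term m c k z w)" for N z w
  define \<kappa>I where "\<kappa>I z w = D * (z powr of_real c * w powr of_real c) * (\<Sum>k. kernel_term m c k z w)" for z w
  define V where "V x = norm x powr (2 * lam) / lam" for x :: complex
  have eq: "\<kappa> z w = \<kappa>I z w" if "z \<in> slit_plane" "w \<in> slit_plane" for z w
    unfolding \<kappa>_def \<kappa>I_def D_def assms(2) by (rule limit_kernel_eq[OF m c that])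
  have op: "open (slit_plane)" by (simp add: open_Compl)
  have powr_hol: "(\<lambda>z. z powr of_real c) holomorphic_on slit_plane"
    by (intro holomorphic_on_powr holomorphic_on_ident holomorphic_on_const) auto
  have hol: "(\<lambda>z. \<kappa>I z w) holomorphic_on slit_plane" for w
    unfolding \<kappa>I_def
    by (intro holomorphic_on_mult holomorphic_on_const powr_hol kernel_sum_holomorphic[OF m c op])
  have swap: "\<kappa>I z w = - \<kappa>I w z" for z w
  proof -
    have "(\<lambda>k. kernel_term m c k z w) = (\<lambda>k. - kernel_term m c k w z)"
      by (rule ext) (rule kernel_term_swap)
    moreover have "(\<Sum>k. - kernel_term m c k w z) = - (\<Sum>k. kernel_term m c k w z)"
    proof (rule suminf_minus)
      have "uniform_limit {(w, z)} (\<lambda>N (z, w). \<Sum>k<N. kernel_term m c k z w) (\<lambda>(z, w). \<Sum>k. kernel_term m c k z w) sequentially"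
        by (rule uniform_limit_kernel_sum[OF m c]) simp
      from tendsto_uniform_limitI[OF this, of "(w, z)"]
      show "summable (\<lambda>k. kernel_term m c k w z)" by (auto simp: summable_def sums_def)
    qed
    ultimately show ?thesis unfolding \<kappa>I_def by (simp add: mult_ac)
  qed
  have hol1: "(\<lambda>z. \<kappa> z w) holomorphic_on slit_plane" if "w \<in> slit_plane" for w
    by (rule holomorphic_transform[OF hol[of w]]) (rule eq[symmetric, OF _ that])
  have hol2: "(\<lambda>w. \<kappa> z w) holomorphic_on slit_plane" if "z \<in> slit_plane" for z
  proof (rule holomorphic_transform[OF holomorphic_on_minus[OF hol[of z]]])
    fix x assume "x \<in> slit_plane"
    from eq[OF that this] show "- \<kappa>I x z = \<kappa> z x" by (simp only: swap[of z x])
  qed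
  have U: "uniform_limit K (\<lambda>N (z, w). \<kappa>N N z w) (\<lambda>(z, w). \<kappa> z w) sequentially"
    if K: "compact K" "K \<subseteq> slit_plane \<times> slit_plane" for K
  proof -
    \<comment> \<open>For c < 0 this factor is unbounded near 0, which K avoids; on the compact K it
      is bounded, so multiplication by it preserves uniform convergence.\<close>
    define P where "P = (\<lambda>x. D * (fst x powr of_real c * snd x powr of_real c))"
    have sub: "fst ` K \<subseteq> slit_plane" "snd ` K \<subseteq> slit_plane"
      using image_mono[OF K(2), of fst] image_mono[OF K(2), of snd] by (simp_all only: fst_image_times snd_image_times split: if_splits)
    have "continuous_on K P" unfolding P_def
      by (intro continuous_on_mult continuous_on_const
            continuous_on_compose2[OF holomorphic_on_imp_continuous_on[OF powr_hol]] continuous_intros sub)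
    then have "bounded (P ` K)" using K(1) by (intro compact_imp_bounded compact_continuous_image)
    then obtain B where B: "B > 0" "\<And>x. x \<in> K \<Longrightarrow> norm (P x) \<le> B" unfolding bounded_pos by auto
    have L: "uniform_limit K (\<lambda>N (z, w). \<Sum>k<N. kernel_term m c k z w) (\<lambda>(z, w). \<Sum>k. kernel_term m c k z w) sequentially"
      by (rule uniform_limit_kernel_sum[OF m c compact_imp_bounded[OF K(1)]])
    show ?thesis unfolding uniform_limit_iff
    proof (intro allI impI)
      fix \<epsilon> :: real assume "\<epsilon> > 0"
      then have "\<epsilon> / B > 0" using B by simp
      from uniform_limitD[OF L this]
      show "\<forall>\<^sub>F N in sequentially. \<forall>x\<in>K. dist (case x of (z, w) \<Rightarrow> \<kappa>N N z w) (case x of (z, w) \<Rightarrow> \<kappa> z w) < \<epsilon>"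
      proof eventually_elim
        case (elim N)
        show ?case
        proof
          fix x assume x: "x \<in> K"
          obtain z w where zw: "x = (z, w)" by (cases x)
          have d: "dist (\<Sum>k<N. kernel_term m c k z w) (\<Sum>k. kernel_term m c k z w) < \<epsilon> / B"
            using elim x unfolding zw by auto
          have "\<kappa>N N z w - \<kappa> z w = P x * ((\<Sum>k<N. kernel_term m c k z w) - (\<Sum>k. kernel_term m c k z w))"
            using eq[of z w] K(2) x unfolding zw by (auto simp: \<kappa>N_def \<kappa>I_def P_def right_diff_distrib)
          then have "dist (\<kappa>N N z w) (\<kappa> z w) \<le> B * dist (\<Sum>k<N. kernel_term m c k z w) (\<Sum>k. kernel_term m c k z w)"
            unfolding dist_norm using B(2)[OF x] by (simp add: norm_mult mult_right_mono)
          also have "\<dots> < \<epsilon>" using d B(1) by (simp add: pos_less_divide_eq mult.commute)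
          finally show "dist (case x of (z, w) \<Rightarrow> \<kappa>N N z w) (case x of (z, w) \<Rightarrow> \<kappa> z w) < \<epsilon>" by (simp add: zw)
        qed
      qed
    qed
  qed
  have lim: "uniform_limit C
       (\<lambda>N (z, w). matrix_kernel (\<lambda>x. real N / 2 * potential m c N (of_real (micro_scale lam N) * x))
          (cocycle_mult (\<lambda>z w. phase c z * phase c w) (rescaled_pre_kernel lam N (q N) (s N))) z w)
       (\<lambda>(z, w). matrix_kernel V \<kappa> z w) sequentially"
    if C: "compact C" "C \<subseteq> slit_plane \<times> slit_plane" for C
  proof -
    have "uniform_limit C (\<lambda>N (z, w). matrix_kernel V (\<kappa>N N) z w) (\<lambda>(z, w). matrix_kernel V \<kappa> z w) sequentially"
      by (rule uniform_limit_matrix_kernel[OF _ C U]) (auto simp: V_def assms(2))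
    \<comment> \<open>The two kernels agree on C for every N >= 1, the range in which
      skew-orthogonality is assumed; this is enough for the limit.\<close>
    moreover have "\<forall>\<^sub>F N in sequentially. \<forall>x\<in>C. (case x of (z, w) \<Rightarrow> matrix_kernel V (\<kappa>N N) z w) =
       (case x of (z, w) \<Rightarrow> matrix_kernel (\<lambda>x. real N / 2 * potential m c N (of_real (micro_scale lam N) * x))
          (cocycle_mult (\<lambda>z w. phase c z * phase c w) (rescaled_pre_kernel lam N (q N) (s N))) z w)"
      using eventually_ge_at_top[of 1]
    proof eventually_elim
      case (elim N)
      show ?case
      proof
        fix x assume x: "x \<in> C"
        obtain z w where zw: "x = (z, w)" by (cases x)
        have "z \<in> slit_plane" "w \<in> slit_plane" using x C(2) unfolding zw by auto
        from matrix_kernel_rescaled[OF m c elim assms(4)[OF elim] this]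
        show "(case x of (z, w) \<Rightarrow> matrix_kernel V (\<kappa>N N) z w) =
          (case x of (z, w) \<Rightarrow> matrix_kernel (\<lambda>x. real N / 2 * potential m c N (of_real (micro_scale lam N) * x))
          (cocycle_mult (\<lambda>z w. phase c z * phase c w) (rescaled_pre_kernel lam N (q N) (s N))) z w)"
          unfolding zw V_def \<kappa>N_def D_def assms(2) by simp
      qed
    qed
    ultimately show ?thesis by (subst (asm) uniform_limit_cong) auto
  qed
  \<comment> \<open>The same cocycle serves every N, since the phase of z^c does not depend on
    N.\<close>
  show ?thesis
    unfolding limiting_pre_kernel_def \<kappa>_def[symmetric] V_def[symmetric]
    using hol1 hol2 lim cocycle_phase by (intro conjI ballI exI[of _ "\<lambda>N z w. phase c z * phase c w"]) blast+
qed

end
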